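(* Assume: (1) $\mathcal D$ is coercive on $\mathcal H\times\mathcal H$, i.e. there exists $\delta>0$ such that $\mathcal D(v,v)\ge\delta\|v\|_\omega^2$ for all $v\in\mathcal H$; (2) $|\Gamma_D\cup\Gamma_c|>0$, so that $\mathcal A$ is coercive on $\mathcal W\times\mathcal W$: there is $\alpha>0$ with $\mathcal A(w,w)\ge\alpha\|w\|_\omega^2$ for all $w\in\mathcal W$. Let $\beta>0$ be the inf-sup constant of $\mathcal B$. Then, for every $\mathbf f\in\mathcal W'$, every $\mathbf d\in\mathcal U'$ and every $\kappa>0$, the problem: find $(w,u)\in\mathcal W\times\mathcal U$ such that $$\mathcal A(w,\tilde w)+\mathcal B(u,\tilde w)=\langle \mathbf f,\tilde w\rangle\quad\forall\,\tilde w\in\mathcal W,\qquad \mathcal B(\tilde u,w)-\kappa\,\mathcal D(u,\tilde u)=-\kappa\langle \mathbf d,\tilde u\rangle\quad\forall\,\tilde u\in\mathcal U,$$ has a unique solution, and this solution satisfies $\|u\|+\|w\|\le C(\|\mathbf f\|+\|\mathbf d\|)$, where the constant $C$ depends only on $\kappa$, the stability constants $\alpha,\beta,\delta$ and the continuity constants $a,d$. More precisely, write $u=u_0+u_1$ with $u_0\in\mathcal H$, $u_1\in\mathcal H^\perp$, and let $\mathbf d_0\in\mathcal H'$, $\mathbf d_1\in(\mathcal H^\perp)'$ be the restrictions of $\mathbf d$ to $\mathcal H$ and $\mathcal H^\perp$. Put $q_a:=a/\alpha$, $q_d:=d/\delta$, $r_a:=a/\beta$, $r_d:=d/\beta$ and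 let $Q$ be given by $2Q:=\kappa\alpha^{-1}\bigl(q_dr_a+\sqrt{4\alpha(\kappa\delta)^{-1}+q_d^2r_a^2}\bigr)$. Then $$\|w\|\le\alpha^{-1}\|\mathbf f\|+Q\|\mathbf d_0\|+\kappa\beta^{-1}q_a\|\mathbf d_1\|,$$ $$\|u_0\|\le\beta^{-1}q_d(1+q_a)\|\mathbf f\|+(1+q_dr_aQ)\|\mathbf d_0\|+\kappa\beta^{-1}q_aq_dr_a\|\mathbf d_1\|,$$ $$\|u_1\|\le\beta^{-1}(1+q_a)\|\mathbf f\|+r_aQ\|\mathbf d_0\|+\kappa\beta^{-1}q_ar_a\|\mathbf d_1\|.$$
   Context: Setting. $\Omega\subset\mathbb R^s$ ($1\le s\le 3$) is a bounded connected domain with boundary $\Gamma$ regular enough (e.g. Lipschitz) for the usual trace, Korn and compact embedding results in $H^1$. $\Gamma_D,\Gamma_N\subseteq\Gamma$ satisfy $\Gamma_D\cap\Gamma_N=\emptyset$ and $\Gamma_c:=\Gamma\setminus(\Gamma_N\cup\Gamma_D)$ may be nonempty (boundary conditions unspecified on $\Gamma_c$). $\rho\in L^\infty(\Omega)$ is bounded below by a positive constant; $\omega>0$ is fixed. $\mathcal C\in L^\infty(\Omega;\mathbb Q)$ is a fourth-order elasticity tensor field, where $\mathbb Q$ is the space of fourth-order tensors with $C_{ijkl}=C_{klij}=C_{jikl}$, and it is uniformly elliptic: $\varepsilon:\mathcal C(x):\varepsilon\ge c_0\,\varepsilon:\varepsilon$ for all symmetric $\varepsilon$, with $c_0>0$.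 Spaces (real): $\mathcal V=H^1(\Omega;\mathbb R^s)$, $\mathcal U=\{v\in\mathcal V: v=0\text{ on }\Gamma_D\}$, $\mathcal W=\{v\in\mathcal V: v=0\text{ on }\Gamma_D\cup\Gamma_c\}\subseteq\mathcal U$. $(\cdot,\cdot)$ denotes $L^2(\Omega)$ scalar products and $\varepsilon[v]=\frac12(\nabla v+\nabla v^T)$. Forms: $\mathcal A(v,\tilde v)=(\varepsilon[v],\mathcal C:\varepsilon[\tilde v])$; $\mathcal B(v,\tilde v)=\mathcal A(v,\tilde v)-\omega^2(\rho v,\tilde v)$; $\mathcal D:\mathcal U\times\mathcal U\to\mathbb R$ is a symmetric positive (semidefinite) continuous bilinear form. $\mathcal U$ and $\mathcal W$ carry the inner product $(v,\tilde v)_\omega=\mathcal A(v,\tilde v)+\omega^2(\rho v,\tilde v)$ and norm $\|v\|=\|v\|_\omega=(v,v)_\omega^{1/2}$; dual spaces carry the dual norms. Continuity constants $a,d>0$: $\mathcal A(w,\tilde w)\le a\|w\|\|\tilde w\|$ on $\mathcal W\times\mathcal W$, $\mathcal D(u,\tilde u)\le d\|u\|\|\tilde u\|$ on $\mathcal U\times\mathcal U$. $B:\mathcal U\to\mathcal W'$ is defined by $\langle Bu,\tilde w\rangle=\mathcal B(u,\tilde w)$, $B^t:\mathcal W\to\mathcal U'$ is its transpose, $\mathcal H:=N(B)\subset\mathcal U$ and $\mathcal K:=N(B^t)\subset\mathcal W$ are the null spaces; orthogonal complements are taken for $(\cdot,\cdot)_\omega$. The inf-sup constant is $$\beta=\inf_{w\in\mathcal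 K^\perp}\sup_{u\in\mathcal U}\frac{\mathcal B(u,w)}{\|u\|_\omega\|w\|_\omega}=\inf_{u\in\mathcal H^\perp}\sup_{w\in\mathcal W}\frac{\mathcal B(u,w)}{\|u\|_\omega\|w\|_\omega}>0$$ (infima and suprema over nonzero elements).
   Formalization: In the bound for ‖u_0‖ the coefficient of ‖d_0‖ is δ^{-1}+q_d r_a Q instead of the printed 1+q_d r_a Q, which fails for δ<1 and small κ (e.g. D=δ(P_H·,P_H·)_ω, f=0, d=(h,·)_ω with h in H); for δ≥1 the proved bound implies the printed one. *)

theory Defs
  imports "HOL-Analysis.Analysis"
begin

section \<open>Surface measure\<close>

text \<open>
  The \<open>k\<close>-dimensional Hausdorff outer measure, normalised so that it agrees with Lebesgue measure
  for \<open>k = n\<close>. The boundary of a domain in \<open>\<real>\<^sup>s\<close> carries it with \<open>k = s - 1\<close>; for \<open>s = 1\<close> this is the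
  counting measure (\<open>0 ^ 0 = 1\<close>, and the empty set gets premeasure \<open>0\<close>). Boundedness of the covering
  sets must be required because \<^const>\<open>diameter\<close> is \<open>0\<close> on unbounded sets.
\<close>

definition hausdorff_premeasure :: "nat \<Rightarrow> 'a::metric_space set \<Rightarrow> ennreal" where
  "hausdorff_premeasure k E =
     (if E = {} then 0 else ennreal (unit_ball_vol (real k) * (diameter E / 2) ^ k))"

definition hausdorff_content :: "nat \<Rightarrow> real \<Rightarrow> 'a::metric_space set \<Rightarrow> ennreal" where
  "hausdorff_content k r A =
     (INF E \<in> {E :: nat \<Rightarrow> 'a set. A \<subseteq> (\<Union>i. E i) \<and> (\<forall>i. bounded (E i) \<and> diameter (E i) \<le> r)}.
        \<Sum>i. hausdorff_premeasure k (E i))"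

definition hausdorff_outer :: "nat \<Rightarrow> 'a::metric_space set \<Rightarrow> ennreal" where
  "hausdorff_outer k A = (SUP r \<in> {0<..}. hausdorff_content k r A)"

definition hausdorff_measure :: "nat \<Rightarrow> 'a::metric_space measure" where
  "hausdorff_measure k = measure_of UNIV (sets borel) (hausdorff_outer k)"

text \<open>Caratheodory's criterion: the outer measure is metric, so that all Borel sets are measurable.\<close>

lemma hausdorff_content_mono: "A \<subseteq> B \<Longrightarrow> hausdorff_content k r A \<le> hausdorff_content k r B"
  unfolding hausdorff_content_def by (rule INF_superset_mono) auto

lemma hausdorff_content_antimono: "r \<le> s \<Longrightarrow> hausdorff_content k s A \<le> hausdorff_content k r A"
  unfolding hausdorff_content_def by (rule INF_superset_mono) (auto intro: order_trans)

lemma hausdorff_content_empty: "0 < r \<Longrightarrow> hausdorff_content k r {} = 0"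
proof -
  assume r: "0 < r"
  have "hausdorff_content k r ({} :: 'a set) \<le> (\<Sum>i. hausdorff_premeasure k ((\<lambda>i::nat. {} :: 'a set) i))"
    unfolding hausdorff_content_def by (rule INF_lower) (use r in \<open>auto simp: diameter_empty\<close>)
  then show ?thesis by (simp add: hausdorff_premeasure_def)
qed

lemma hausdorff_content_UN:
  fixes A :: "nat \<Rightarrow> 'a::metric_space set"
  shows "hausdorff_content k r (\<Union>i. A i) \<le> (\<Sum>i. hausdorff_content k r (A i))"
proof (rule ennreal_le_epsilon)
  fix e :: real assume "0 < e" "(\<Sum>n. hausdorff_content k r (A n)) < top"
  then have *: "hausdorff_content k r (A n) < hausdorff_content k r (A n) + e * (1/2)^Suc n" for n
    by (auto simp add: less_top dest!: ennreal_suminf_lessD)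
  have "\<exists>E. A n \<subseteq> (\<Union>i. E i) \<and> (\<forall>i. bounded (E i) \<and> diameter (E i) \<le> r) \<and>
       (\<Sum>i. hausdorff_premeasure k (E i)) \<le> hausdorff_content k r (A n) + e * (1/2)^Suc n" for n
    using *[of n] unfolding hausdorff_content_def[of k r "A n"] INF_less_iff
    by (auto intro: less_imp_le)
  then obtain E where E: "\<And>n. A n \<subseteq> (\<Union>i. E n i)" "\<And>n i. bounded (E n i)"
    "\<And>n i. diameter (E n i) \<le> r"
    "\<And>n. (\<Sum>i. hausdorff_premeasure k (E n i)) \<le> hausdorff_content k r (A n) + e * (1/2)^Suc n"
    by metis
  define G where "G = case_prod E o prod_decode"
  have "hausdorff_content k r (\<Union>i. A i) \<le> (\<Sum>j. hausdorff_premeasure k (G j))"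
    unfolding hausdorff_content_def
  proof (rule INF_lower, safe)
    fix x n assume "x \<in> A n"
    then obtain i where "x \<in> E n i" using E(1) by blast
    then have "x \<in> G (prod_encode (n, i))" by (simp add: G_def)
    then show "x \<in> (\<Union>j. G j)" by blast
  qed (use E in \<open>auto simp: G_def split: prod.split\<close>)
  also have "\<dots> = (\<Sum>n. \<Sum>i. hausdorff_premeasure k (E n i))"
    unfolding G_def comp_def by (intro suminf_ennreal_2dimen) auto
  also have "\<dots> \<le> (\<Sum>n. hausdorff_content k r (A n) + e * (1/2)^Suc n)"
    by (intro suminf_le allI E(4)) auto
  also have "\<dots> = (\<Sum>n. hausdorff_content k r (A n)) + (\<Sum>n. ennreal e * ennreal ((1/2)^Suc n))"
    using \<open>0 < e\<close> by (subst suminf_add[symmetric])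
      (auto simp del: ennreal_suminf_cmult simp add: ennreal_mult[symmetric])
  also have "\<dots> = (\<Sum>n. hausdorff_content k r (A n)) + e"
    unfolding ennreal_suminf_cmult
    by (subst suminf_ennreal_eq[OF zero_le_power power_half_series]) auto
  finally show "hausdorff_content k r (\<Union>i. A i) \<le> (\<Sum>n. hausdorff_content k r (A n)) + e" .
qed

lemma hausdorff_content_le_outer: "0 < r \<Longrightarrow> hausdorff_content k r A \<le> hausdorff_outer k A"
  unfolding hausdorff_outer_def by (rule SUP_upper) auto

lemma hausdorff_outer_mono: "A \<subseteq> B \<Longrightarrow> hausdorff_outer k A \<le> hausdorff_outer k B"
  unfolding hausdorff_outer_def by (intro SUP_mono') (rule hausdorff_content_mono)

lemma hausdorff_outer_empty: "hausdorff_outer k {} = 0"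
  by (simp add: hausdorff_outer_def hausdorff_content_empty)

lemma hausdorff_outer_UN:
  fixes A :: "nat \<Rightarrow> 'a::metric_space set"
  shows "hausdorff_outer k (\<Union>i. A i) \<le> (\<Sum>i. hausdorff_outer k (A i))"
  unfolding hausdorff_outer_def[of k "\<Union>i. A i"]
proof (rule SUP_least)
  fix r :: real assume "r \<in> {0<..}"
  then show "hausdorff_content k r (\<Union>i. A i) \<le> (\<Sum>i. hausdorff_outer k (A i))"
    by (intro order_trans[OF hausdorff_content_UN] suminf_le)
       (auto simp: hausdorff_content_le_outer)
qed

lemma hausdorff_outer_Un: "hausdorff_outer k (A \<union> B) \<le> hausdorff_outer k A + hausdorff_outer k B"
proof -
  have "hausdorff_outer k (\<Union>i. binaryset A B i) \<le> (\<Sum>i. hausdorff_outer k (binaryset A B i))"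
    by (rule hausdorff_outer_UN)
  also have "\<dots> = hausdorff_outer k A + hausdorff_outer k B"
    by (subst suminf_binaryset_eq) (auto simp: hausdorff_outer_empty)
  finally show ?thesis by (simp add: UN_binaryset_eq)
qed

lemma hausdorff_outer_separated:
  fixes A B :: "'a::metric_space set"
  assumes e: "0 < e" and sep: "\<And>x y. x \<in> A \<Longrightarrow> y \<in> B \<Longrightarrow> e \<le> dist x y"
  shows "hausdorff_outer k A + hausdorff_outer k B \<le> hausdorff_outer k (A \<union> B)"
proof -
  have 1: "hausdorff_content k r A + hausdorff_content k r B \<le> hausdorff_content k r (A \<union> B)"
    if r: "0 < r" "r < e" for r
    unfolding hausdorff_content_def[of k r "A \<union> B"]
  proof (rule INF_greatest, safe)
    fix E :: "nat \<Rightarrow> 'a set"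
    assume cov: "A \<union> B \<subseteq> (\<Union>i. E i)" and E: "\<forall>i. bounded (E i) \<and> diameter (E i) \<le> r"
    define F where "F i = (if E i \<inter> A = {} then {} else E i)" for i
    define G where "G i = (if E i \<inter> A = {} then E i else {})" for i
    have no: "E i \<inter> B = {}" if meet: "E i \<inter> A \<noteq> {}" for i
    proof (rule ccontr)
      assume "E i \<inter> B \<noteq> {}"
      with meet obtain x y where xy: "x \<in> E i" "x \<in> A" "y \<in> E i" "y \<in> B" by blast
      have "dist x y \<le> diameter (E i)" using E xy by (intro diameter_bounded_bound) auto
      with sep[OF xy(2) xy(4)] E r show False by (smt (verit))
    qed
    have "hausdorff_content k r A \<le> (\<Sum>i. hausdorff_premeasure k (F i))"
      unfolding hausdorff_content_def
      by (rule INF_lower) (use cov E r in \<open>auto simp: F_def diameter_empty\<close>, blast)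
    moreover have "hausdorff_content k r B \<le> (\<Sum>i. hausdorff_premeasure k (G i))"
      unfolding hausdorff_content_def
      by (rule INF_lower) (use cov E r no in \<open>auto simp: G_def diameter_empty\<close>, blast)
    ultimately have "hausdorff_content k r A + hausdorff_content k r B
        \<le> (\<Sum>i. hausdorff_premeasure k (F i)) + (\<Sum>i. hausdorff_premeasure k (G i))"
      by (rule add_mono)
    also have "\<dots> = (\<Sum>i. hausdorff_premeasure k (F i) + hausdorff_premeasure k (G i))"
      by (rule suminf_add) auto
    also have "\<dots> = (\<Sum>i. hausdorff_premeasure k (E i))"
      by (rule suminf_cong) (simp add: F_def G_def hausdorff_premeasure_def)
    finally show "hausdorff_content k r A + hausdorff_content k r B
        \<le> (\<Sum>i. hausdorff_premeasure k (E i))" .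
  qed
  have 2: "hausdorff_content k r A + hausdorff_content k s B \<le> hausdorff_outer k (A \<union> B)"
    if "0 < r" "0 < s" for r s
  proof -
    define t where "t = min (min r s) (e / 2)"
    have t: "0 < t" "t < e" "t \<le> r" "t \<le> s" using that e by (auto simp: t_def)
    have "hausdorff_content k r A + hausdorff_content k s B
        \<le> hausdorff_content k t A + hausdorff_content k t B"
      by (intro add_mono hausdorff_content_antimono t)
    also have "\<dots> \<le> hausdorff_outer k (A \<union> B)"
      using 1[OF t(1,2)] hausdorff_content_le_outer[OF t(1)] by (rule order_trans)
    finally show ?thesis .
  qed
  have ne: "{0 :: real <..} \<noteq> {}" by auto
  have 3: "hausdorff_content k r A + hausdorff_outer k B \<le> hausdorff_outer k (A \<union> B)" if "0 < r" for r
    unfolding hausdorff_outer_def[of k B] ennreal_SUP_add_right[OF ne]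
    by (rule SUP_least) (use 2 that in auto)
  show ?thesis
    unfolding hausdorff_outer_def[of k A] ennreal_SUP_add_left[OF ne, symmetric]
    by (rule SUP_least) (use 3 in auto)
qed

lemma ennreal_tail_small:
  fixes f :: "nat \<Rightarrow> ennreal"
  assumes fin: "(\<Sum>i. f i) < top" and e: "0 < e"
  shows "\<exists>N. (\<Sum>i. f (i + N)) \<le> ennreal e"
proof -
  define g where "g i = enn2real (f i)" for i
  have "f i < top" for i
    using sum_le_suminf[of f "{i}"] fin by (auto intro: le_less_trans)
  then have fg: "f i = ennreal (g i)" for i by (simp add: g_def)
  have g0: "0 \<le> g i" for i by (simp add: g_def)
  have sg: "summable g"
    using fin g0 by (intro summable_suminf_not_top) (auto simp: fg)
  obtain N where N: "norm (\<Sum>i. g (i + N)) < e"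
    using suminf_exist_split[OF e sg] by blast
  have "(\<Sum>i. f (i + N)) = ennreal (\<Sum>i. g (i + N))"
    using g0 sg unfolding fg by (intro suminf_ennreal2) (auto simp: summable_iff_shift)
  also have "\<dots> \<le> ennreal e" using N by (intro ennreal_leI) auto
  finally show ?thesis by blast
qed

lemma hausdorff_outer_closed:
  fixes F A :: "'a::metric_space set"
  assumes F: "closed F"
  shows "hausdorff_outer k (A \<inter> F) + hausdorff_outer k (A - F) \<le> hausdorff_outer k A"
proof (cases "F = {} \<or> hausdorff_outer k A = top")
  case True
  then show ?thesis by (auto simp: hausdorff_outer_empty)
next
  case False
  then have ne: "F \<noteq> {}" and fin: "hausdorff_outer k A < top" by (auto simp: less_top)
  define D where "D n = {x \<in> A. 1 / (real n + 1) \<le> infdist x F}" for n :: nat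
  define R where "R n = D (Suc n) - D n" for n
  have Dmono: "D n \<subseteq> D (Suc n)" for n
    by (auto simp: D_def elim!: order_trans[rotated] intro!: divide_left_mono)
  have sepR: "\<exists>e>0. \<forall>x\<in>D (Suc i). \<forall>y\<in>R j. e \<le> dist x y" if "Suc i < j" for i j
  proof (intro exI conjI ballI)
    have "real i + 3 \<le> real j + 1" using that by simp
    then have j: "1 / (real j + 1) \<le> 1 / (real i + 3)" by (intro divide_left_mono) auto
    show "0 < 1 / (real i + 2) - 1 / (real i + 3)"
      using frac_less2[of 1 1 "real i + 2" "real i + 3"] by simp
    fix x y assume "x \<in> D (Suc i)" "y \<in> R j"
    then have "1 / (real i + 2) \<le> infdist x F" "infdist y F < 1 / (real j + 1)"
      by (auto simp: D_def R_def add.commute)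
    with infdist_triangle[of x F y] j
    show "1 / (real i + 2) - 1 / (real i + 3) \<le> dist x y" by linarith
  qed
  have par: "(\<Sum>i<m. hausdorff_outer k (R (2 * i + p))) \<le> hausdorff_outer k (\<Union>i<m. R (2 * i + p))" for m p
  proof (induction m)
    case (Suc m)
    have "hausdorff_outer k (\<Union>i<m. R (2 * i + p)) + hausdorff_outer k (R (2 * m + p))
        \<le> hausdorff_outer k ((\<Union>i<m. R (2 * i + p)) \<union> R (2 * m + p))"
    proof (cases m)
      case 0
      then show ?thesis by (simp add: hausdorff_outer_empty)
    next
      case (Suc q)
      have "Suc (2 * q + p) < 2 * m + p" using Suc by simp
      from sepR[OF this] obtain e where e: "e > 0" "\<And>x y. x \<in> D (Suc (2 * q + p)) \<Longrightarrow> y \<in> R (2 * m + p) \<Longrightarrow> e \<le> dist x y"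
        by blast
      have "R (2 * i + p) \<subseteq> D (Suc (2 * q + p))" if "i < m" for i
      proof -
        have "R (2 * i + p) \<subseteq> D (Suc (2 * i + p))" by (auto simp: R_def)
        also have "\<dots> \<subseteq> D (Suc (2 * q + p))"
          by (rule lift_Suc_mono_le[of D, OF Dmono]) (use that Suc in simp)
        finally show ?thesis .
      qed
      then show ?thesis by (intro hausdorff_outer_separated[OF e(1)]) (blast intro: e(2))
    qed
    moreover have "(\<Union>i<m. R (2 * i + p)) \<union> R (2 * m + p) = (\<Union>i<Suc m. R (2 * i + p))"
      by (auto simp: less_Suc_eq)
    ultimately show ?case
      unfolding sum.lessThan_Suc
      by (intro order_trans[OF add_right_mono[OF Suc.IH]]) simp
  qed simp
  have RA: "R i \<subseteq> A" for i by (auto simp: R_def D_def)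
  have half: "(\<Sum>i. hausdorff_outer k (R (2 * i + p))) \<le> hausdorff_outer k A" for p
    by (rule suminf_le_const[OF summableI], rule order_trans[OF par], rule hausdorff_outer_mono)
       (use RA in blast)
  have "(\<Sum>i. hausdorff_outer k (R i)) \<le> hausdorff_outer k A + hausdorff_outer k A"
  proof (rule suminf_le_const[OF summableI])
    fix n
    have "(\<Sum>i<n. hausdorff_outer k (R i)) \<le> (\<Sum>i<2 * n. hausdorff_outer k (R i))"
      by (intro sum_mono2) auto
    also have "\<dots> = (\<Sum>i<n. hausdorff_outer k (R (2 * i + 0))) + (\<Sum>i<n. hausdorff_outer k (R (2 * i + 1)))"
      by (induction n) (simp_all add: ac_simps)
    also have "\<dots> \<le> hausdorff_outer k A + hausdorff_outer k A"
      by (intro add_mono; rule order_trans[OF sum_le_suminf half]) (auto intro: summableI)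
    finally show "(\<Sum>i<n. hausdorff_outer k (R i)) \<le> hausdorff_outer k A + hausdorff_outer k A" .
  qed
  then have finR: "(\<Sum>i. hausdorff_outer k (R i)) < top"
    by (rule le_less_trans) (use fin in simp)
  show ?thesis
  proof (rule ennreal_le_epsilon)
    fix e :: real assume "0 < e"
    then obtain N where N: "(\<Sum>i. hausdorff_outer k (R (i + N))) \<le> ennreal e"
      using ennreal_tail_small[OF finR] by blast
    have "A - F \<subseteq> D N \<union> (\<Union>i. R (i + N))"
    proof
      fix x assume x: "x \<in> A - F"
      then have "0 < infdist x F"
        using F ne in_closed_iff_infdist_zero infdist_nonneg by (metis DiffD2 less_eq_real_def)
      then obtain n where "1 / (real n + 1) < infdist x F"
        using reals_Archimedean by (metis Suc_eq_plus1 inverse_eq_divide of_nat_Suc of_nat_add of_nat_1)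
      then have ex: "x \<in> D n" using x by (auto simp: D_def)
      show "x \<in> D N \<union> (\<Union>i. R (i + N))"
      proof (cases "x \<in> D N")
        case False
        define m where "m = (LEAST m. x \<in> D m)"
        have m: "x \<in> D m" unfolding m_def by (rule LeastI[of _ n]) (rule ex)
        have "\<not> m \<le> N" using False m lift_Suc_mono_le[of D m N] Dmono by blast
        then obtain j where j: "m = Suc (j + N)" by (metis add.commute less_imp_Suc_add not_le)
        have "x \<notin> D (j + N)" using j not_less_Least[of "j + N" "\<lambda>m. x \<in> D m"] by (auto simp: m_def[symmetric])
        with m j show ?thesis by (auto simp: R_def)
      qed simp
    qed
    then have "hausdorff_outer k (A - F) \<le> hausdorff_outer k (D N) + (\<Sum>i. hausdorff_outer k (R (i + N)))"
      by (rule order_trans[OF hausdorff_outer_mono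
            order_trans[OF hausdorff_outer_Un add_left_mono[OF hausdorff_outer_UN]]])
    then have "hausdorff_outer k (A \<inter> F) + hausdorff_outer k (A - F)
        \<le> hausdorff_outer k (A \<inter> F) + (hausdorff_outer k (D N) + ennreal e)"
      by (intro add_left_mono) (rule order_trans[OF _ add_left_mono[OF N]])
    also have "\<dots> = (hausdorff_outer k (A \<inter> F) + hausdorff_outer k (D N)) + ennreal e"
      by (simp add: ac_simps)
    also have "\<dots> \<le> hausdorff_outer k ((A \<inter> F) \<union> D N) + ennreal e"
    proof (intro add_right_mono hausdorff_outer_separated)
      show "0 < 1 / (real N + 1)" by simp
      fix x y assume xy: "x \<in> A \<inter> F" "y \<in> D N"
      then have "infdist y F \<le> dist y x" by (intro infdist_le) auto
      then show "1 / (real N + 1) \<le> dist x y" using xy by (auto simp: D_def dist_commute)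
    qed
    also have "\<dots> \<le> hausdorff_outer k A + ennreal e"
      by (intro add_right_mono hausdorff_outer_mono) (auto simp: D_def)
    finally show "hausdorff_outer k (A \<inter> F) + hausdorff_outer k (A - F) \<le> hausdorff_outer k A + ennreal e" .
  qed
qed

lemma measure_space_hausdorff_outer:
  "measure_space UNIV (sets (borel :: 'a::metric_space measure)) (hausdorff_outer k)"
proof -
  let ?L = "lambda_system (UNIV :: 'a set) (Pow UNIV) (hausdorff_outer k)"
  interpret sigma_algebra "UNIV :: 'a set" "Pow UNIV" by (rule sigma_algebra_Pow)
  have "outer_measure_space (Pow (UNIV :: 'a set)) (hausdorff_outer k)"
    by (auto simp: outer_measure_space_def positive_def increasing_def countably_subadditive_def
        hausdorff_outer_empty hausdorff_outer_mono hausdorff_outer_UN)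
  then have L: "measure_space UNIV ?L (hausdorff_outer k)" by (rule caratheodory_lemma)
  have "closed F \<Longrightarrow> F \<in> ?L" for F :: "'a set"
  proof -
    assume F: "closed F"
    have "hausdorff_outer k (A \<inter> F) + hausdorff_outer k (A - F) = hausdorff_outer k A" for A
    proof (rule antisym)
      have "hausdorff_outer k A = hausdorff_outer k ((A \<inter> F) \<union> (A - F))"
        by (rule arg_cong[where f = "hausdorff_outer k"]) auto
      also have "\<dots> \<le> hausdorff_outer k (A \<inter> F) + hausdorff_outer k (A - F)"
        by (rule hausdorff_outer_Un)
      finally show "hausdorff_outer k A \<le> hausdorff_outer k (A \<inter> F) + hausdorff_outer k (A - F)" .
    qed (rule hausdorff_outer_closed[OF F])
    then show "F \<in> ?L" by (subst lambda_system_eq) simp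
  qed
  then have "sigma_sets UNIV (Collect closed) \<subseteq> ?L"
    using L by (intro sigma_algebra.sigma_sets_subset) (auto simp: measure_space_def)
  then have "sets (borel :: 'a measure) \<subseteq> ?L" by (simp add: borel_eq_closed)
  moreover have "sigma_algebra UNIV (sets (borel :: 'a measure))"
    using sets.sigma_algebra_axioms[of "borel :: 'a measure"] by simp
  ultimately show ?thesis using measure_down[OF L] by blast
qed

lemma sets_hausdorff_measure [simp, measurable_cong]: "sets (hausdorff_measure k) = sets borel"
  unfolding hausdorff_measure_def using sets.sigma_sets_eq[of borel] by simp

lemma space_hausdorff_measure [simp]: "space (hausdorff_measure k) = UNIV"
  by (simp add: hausdorff_measure_def)

lemma emeasure_hausdorff_measure:
  assumes "A \<in> sets borel"
  shows "emeasure (hausdorff_measure k) A = hausdorff_outer k A"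
proof (rule emeasure_measure_of[OF hausdorff_measure_def])
  show "positive (sets (hausdorff_measure k)) (hausdorff_outer k)"
    "countably_additive (sets (hausdorff_measure k)) (hausdorff_outer k)"
    using measure_space_hausdorff_outer[of k] by (auto simp: measure_space_def)
qed (use assms in auto)

definition surface_measure :: "(real^'n) set \<Rightarrow> (real^'n) measure" where
  "surface_measure \<Omega> = restrict_space (hausdorff_measure (CARD('n) - 1)) (frontier \<Omega>)"


section \<open>Sobolev fields and traces\<close>

definition partial_derivative :: "'n \<Rightarrow> (real^'n \<Rightarrow> real) \<Rightarrow> real^'n \<Rightarrow> real" where
  "partial_derivative j f x = frechet_derivative f (at x) (axis j 1)"

primrec times_differentiable :: "nat \<Rightarrow> (real^'n \<Rightarrow> real) \<Rightarrow> bool" where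
  "times_differentiable 0 f \<longleftrightarrow> continuous_on UNIV f"
| "times_differentiable (Suc k) f \<longleftrightarrow>
     (\<forall>x. f differentiable (at x)) \<and> (\<forall>j. times_differentiable k (partial_derivative j f))"

definition smooth :: "(real^'n \<Rightarrow> real) \<Rightarrow> bool" where
  "smooth f \<longleftrightarrow> (\<forall>k. times_differentiable k f)"

definition test_function :: "(real^'n) set \<Rightarrow> (real^'n \<Rightarrow> real) \<Rightarrow> bool" where
  "test_function \<Omega> \<phi> \<longleftrightarrow>
     smooth \<phi> \<and> (\<exists>K. compact K \<and> K \<subseteq> \<Omega> \<and> (\<forall>x. x \<notin> K \<longrightarrow> \<phi> x = 0))"

definition square_integrable :: "'a measure \<Rightarrow> ('a \<Rightarrow> 'b::euclidean_space) \<Rightarrow> bool" where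
  "square_integrable M f \<longleftrightarrow> f \<in> borel_measurable M \<and> integrable M (\<lambda>x. (norm (f x))\<^sup>2)"

text \<open>Gradients are indexed as \<open>(\<nabla>v)\<^sub>i\<^sub>j = \<partial>\<^sub>j v\<^sub>i\<close>; on matrices, \<^const>\<open>norm\<close> is the Frobenius norm and
  \<^const>\<open>inner\<close> the double contraction.\<close>

definition has_weak_gradient ::
  "(real^'n) set \<Rightarrow> (real^'n \<Rightarrow> real^'n) \<Rightarrow> (real^'n \<Rightarrow> real^'n^'n) \<Rightarrow> bool" where
  "has_weak_gradient \<Omega> v G \<longleftrightarrow>
     (\<forall>i j \<phi>. test_function \<Omega> \<phi> \<longrightarrow>
        (\<integral>x. v x $ i * partial_derivative j \<phi> x \<partial>lebesgue_on \<Omega>) =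
        - (\<integral>x. G x $ i $ j * \<phi> x \<partial>lebesgue_on \<Omega>))"

text \<open>
  Elements of function spaces are represented by functions on the whole space of which only the
  values a.e. in \<open>\<Omega>\<close> matter; equality in these spaces is equality a.e. in \<open>\<Omega>\<close>.
\<close>

definition H1 :: "(real^'n) set \<Rightarrow> (real^'n \<Rightarrow> real^'n) set" where
  "H1 \<Omega> = {v. square_integrable (lebesgue_on \<Omega>) v \<and>
               (\<exists>G. square_integrable (lebesgue_on \<Omega>) G \<and> has_weak_gradient \<Omega> v G)}"

definition weak_gradient :: "(real^'n) set \<Rightarrow> (real^'n \<Rightarrow> real^'n) \<Rightarrow> real^'n \<Rightarrow> real^'n^'n" where
  "weak_gradient \<Omega> v =
     (SOME G. square_integrable (lebesgue_on \<Omega>) G \<and> has_weak_gradient \<Omega> v G)"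

definition strain :: "(real^'n) set \<Rightarrow> (real^'n \<Rightarrow> real^'n) \<Rightarrow> real^'n \<Rightarrow> real^'n^'n" where
  "strain \<Omega> v x = (1/2) *\<^sub>R (weak_gradient \<Omega> v x + transpose (weak_gradient \<Omega> v x))"

definition L2_norm :: "'a measure \<Rightarrow> ('a \<Rightarrow> 'b::euclidean_space) \<Rightarrow> real" where
  "L2_norm M f = sqrt (\<integral>x. (norm (f x))\<^sup>2 \<partial>M)"

definition H1_norm :: "(real^'n) set \<Rightarrow> (real^'n \<Rightarrow> real^'n) \<Rightarrow> real" where
  "H1_norm \<Omega> v =
     sqrt ((L2_norm (lebesgue_on \<Omega>) v)\<^sup>2 + (L2_norm (lebesgue_on \<Omega>) (weak_gradient \<Omega> v))\<^sup>2)"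

definition smooth_fields :: "(real^'n) set \<Rightarrow> (real^'n \<Rightarrow> real^'n) set" where
  "smooth_fields \<Omega> = {\<phi> \<in> H1 \<Omega>. \<forall>i. smooth (\<lambda>x. \<phi> x $ i)}"

text \<open>The graph of the trace operator, i.e. the \<open>H\<^sup>1 \<times> L\<^sup>2\<close> closure of the restriction
  \<open>\<phi> \<mapsto> \<phi>|\<^bsub>\<partial>\<Omega>\<^esub>\<close> of smooth fields. On the domains considered below it is a bounded operator defined
  on all of \<open>H\<^sup>1(\<Omega>)\<close>.\<close>

definition is_trace ::
  "(real^'n) set \<Rightarrow> (real^'n \<Rightarrow> real^'n) \<Rightarrow> (real^'n \<Rightarrow> real^'n) \<Rightarrow> bool" where
  "is_trace \<Omega> v g \<longleftrightarrow>
     square_integrable (surface_measure \<Omega>) g \<and>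
     (\<exists>\<phi>. (\<forall>k::nat. \<phi> k \<in> smooth_fields \<Omega>) \<and>
          (\<lambda>k. H1_norm \<Omega> (\<lambda>x. \<phi> k x - v x)) \<longlonglongrightarrow> 0 \<and>
          (\<lambda>k. L2_norm (surface_measure \<Omega>) (\<lambda>x. \<phi> k x - g x)) \<longlonglongrightarrow> 0)"

definition H1_vanishing_on ::
  "(real^'n) set \<Rightarrow> (real^'n) set \<Rightarrow> (real^'n \<Rightarrow> real^'n) set" where
  "H1_vanishing_on \<Omega> \<Sigma> =
     {v \<in> H1 \<Omega>. \<exists>g. is_trace \<Omega> v g \<and> (AE x in surface_measure \<Omega>. x \<in> \<Sigma> \<longrightarrow> g x = 0)}"

text \<open>
  A boundary regular enough for the trace theorem (finite surface measure, density of smooth fields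
  and boundedness of the restriction to the boundary), for Korn's second inequality and for Rellich's
  compact embedding; bounded Lipschitz domains are of this kind.
\<close>

definition regular_domain :: "(real^'n) set \<Rightarrow> bool" where
  "regular_domain \<Omega> \<longleftrightarrow>
     emeasure (surface_measure \<Omega>) (frontier \<Omega>) < \<infinity> \<and>
     (\<forall>v\<in>H1 \<Omega>. \<forall>e>0. \<exists>\<phi>\<in>smooth_fields \<Omega>. H1_norm \<Omega> (\<lambda>x. \<phi> x - v x) < e) \<and>
     (\<exists>c. \<forall>\<phi>\<in>smooth_fields \<Omega>. L2_norm (surface_measure \<Omega>) \<phi> \<le> c * H1_norm \<Omega> \<phi>) \<and>
     (\<exists>c. \<forall>v\<in>H1 \<Omega>. (H1_norm \<Omega> v)\<^sup>2 \<le>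
        c * ((L2_norm (lebesgue_on \<Omega>) v)\<^sup>2 + (L2_norm (lebesgue_on \<Omega>) (strain \<Omega> v))\<^sup>2)) \<and>
     (\<forall>v :: nat \<Rightarrow> real^'n \<Rightarrow> real^'n. (\<forall>k. v k \<in> H1 \<Omega>) \<and> (\<exists>M. \<forall>k. H1_norm \<Omega> (v k) \<le> M) \<longrightarrow>
        (\<exists>r l. strict_mono r \<and> square_integrable (lebesgue_on \<Omega>) l \<and>
               (\<lambda>k. L2_norm (lebesgue_on \<Omega>) (\<lambda>x. v (r k) x - l x)) \<longlonglongrightarrow> 0))"


section \<open>The elastodynamic setting\<close>

record ('n::finite) elastic_body =
  body :: "(real^'n) set"
  dirichlet :: "(real^'n) set"
  neumann :: "(real^'n) set"
  density :: "real^'n \<Rightarrow> real"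
  stiffness :: "real^'n \<Rightarrow> real^'n^'n^'n^'n"
  frequency :: real

text \<open>The part of the boundary on which no boundary condition is specified.\<close>

definition unspecified :: "('n::finite) elastic_body \<Rightarrow> (real^'n) set" where
  "unspecified P = frontier (body P) - (neumann P \<union> dirichlet P)"

definition contract :: "real^'n^'n^'n^'n \<Rightarrow> real^'n^'n \<Rightarrow> real^'n^'n" where
  "contract C E = (\<chi> i j. \<Sum>k\<in>UNIV. \<Sum>l\<in>UNIV. C $ i $ j $ k $ l * E $ k $ l)"

definition elasticity_tensor :: "real^'n^'n^'n^'n \<Rightarrow> bool" where
  "elasticity_tensor C \<longleftrightarrow>
     (\<forall>i j k l. C $ i $ j $ k $ l = C $ k $ l $ i $ j \<and> C $ i $ j $ k $ l = C $ j $ i $ k $ l)"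

definition elastic_setting :: "('n::finite) elastic_body \<Rightarrow> bool" where
  "elastic_setting P \<longleftrightarrow>
     open (body P) \<and> connected (body P) \<and> bounded (body P) \<and> body P \<noteq> {} \<and>
     regular_domain (body P) \<and>
     dirichlet P \<subseteq> frontier (body P) \<and> neumann P \<subseteq> frontier (body P) \<and>
     dirichlet P \<inter> neumann P = {} \<and>
     density P \<in> borel_measurable (lebesgue_on (body P)) \<and>
     (\<exists>M. AE x in lebesgue_on (body P). \<bar>density P x\<bar> \<le> M) \<and>
     (\<exists>r>0. AE x in lebesgue_on (body P). r \<le> density P x) \<and>
     stiffness P \<in> borel_measurable (lebesgue_on (body P)) \<and>
     (\<exists>M. AE x in lebesgue_on (body P). norm (stiffness P x) \<le> M) \<and>
     (AE x in lebesgue_on (body P). elasticity_tensor (stiffness P x)) \<and>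
     (\<exists>c>0. AE x in lebesgue_on (body P).
        \<forall>E. transpose E = E \<longrightarrow> c * (E \<bullet> E) \<le> E \<bullet> contract (stiffness P x) E) \<and>
     frequency P > 0"

definition space_U :: "('n::finite) elastic_body \<Rightarrow> (real^'n \<Rightarrow> real^'n) set" where
  "space_U P = H1_vanishing_on (body P) (dirichlet P)"

definition space_W :: "('n::finite) elastic_body \<Rightarrow> (real^'n \<Rightarrow> real^'n) set" where
  "space_W P = H1_vanishing_on (body P) (dirichlet P \<union> unspecified P)"

definition field_eq ::
  "('n::finite) elastic_body \<Rightarrow> (real^'n \<Rightarrow> real^'n) \<Rightarrow> (real^'n \<Rightarrow> real^'n) \<Rightarrow> bool" where
  "field_eq P u v \<longleftrightarrow> (AE x in lebesgue_on (body P). u x = v x)"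

definition form_A ::
  "('n::finite) elastic_body \<Rightarrow> (real^'n \<Rightarrow> real^'n) \<Rightarrow> (real^'n \<Rightarrow> real^'n) \<Rightarrow> real" where
  "form_A P v v' =
     (\<integral>x. strain (body P) v x \<bullet> contract (stiffness P x) (strain (body P) v' x) \<partial>lebesgue_on (body P))"

definition mass_form ::
  "('n::finite) elastic_body \<Rightarrow> (real^'n \<Rightarrow> real^'n) \<Rightarrow> (real^'n \<Rightarrow> real^'n) \<Rightarrow> real" where
  "mass_form P v v' = (\<integral>x. (density P x *\<^sub>R v x) \<bullet> v' x \<partial>lebesgue_on (body P))"

definition form_B ::
  "('n::finite) elastic_body \<Rightarrow> (real^'n \<Rightarrow> real^'n) \<Rightarrow> (real^'n \<Rightarrow> real^'n) \<Rightarrow> real" where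
  "form_B P v v' = form_A P v v' - (frequency P)\<^sup>2 * mass_form P v v'"

definition inner_w ::
  "('n::finite) elastic_body \<Rightarrow> (real^'n \<Rightarrow> real^'n) \<Rightarrow> (real^'n \<Rightarrow> real^'n) \<Rightarrow> real" where
  "inner_w P v v' = form_A P v v' + (frequency P)\<^sup>2 * mass_form P v v'"

definition norm_w :: "('n::finite) elastic_body \<Rightarrow> (real^'n \<Rightarrow> real^'n) \<Rightarrow> real" where
  "norm_w P v = sqrt (inner_w P v v)"

definition null_H :: "('n::finite) elastic_body \<Rightarrow> (real^'n \<Rightarrow> real^'n) set" where
  "null_H P = {u \<in> space_U P. \<forall>w\<in>space_W P. form_B P u w = 0}"

definition null_K :: "('n::finite) elastic_body \<Rightarrow> (real^'n \<Rightarrow> real^'n) set" where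
  "null_K P = {w \<in> space_W P. \<forall>u\<in>space_U P. form_B P u w = 0}"

definition perp_H :: "('n::finite) elastic_body \<Rightarrow> (real^'n \<Rightarrow> real^'n) set" where
  "perp_H P = {u \<in> space_U P. \<forall>h\<in>null_H P. inner_w P u h = 0}"

definition perp_K :: "('n::finite) elastic_body \<Rightarrow> (real^'n \<Rightarrow> real^'n) set" where
  "perp_K P = {w \<in> space_W P. \<forall>k\<in>null_K P. inner_w P w k = 0}"

text \<open>Extended reals avoid junk values of infima and suprema; the conditions on the norms
  exclude the zero elements.\<close>

definition inf_sup_constant :: "('n::finite) elastic_body \<Rightarrow> ereal" where
  "inf_sup_constant P =
     (INF w\<in>{w \<in> perp_K P. norm_w P w \<noteq> 0}. SUP u\<in>{u \<in> space_U P. norm_w P u \<noteq> 0}.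
        ereal (form_B P u w / (norm_w P u * norm_w P w)))"

definition linear_functional_on ::
  "('a \<Rightarrow> 'b::real_vector) set \<Rightarrow> (('a \<Rightarrow> 'b) \<Rightarrow> real) \<Rightarrow> bool" where
  "linear_functional_on V F \<longleftrightarrow>
     (\<forall>u\<in>V. \<forall>v\<in>V. F (\<lambda>x. u x + v x) = F u + F v) \<and>
     (\<forall>c. \<forall>v\<in>V. F (\<lambda>x. c *\<^sub>R v x) = c * F v)"

definition dual_space ::
  "('n::finite) elastic_body \<Rightarrow> (real^'n \<Rightarrow> real^'n) set \<Rightarrow> ((real^'n \<Rightarrow> real^'n) \<Rightarrow> real) set" where
  "dual_space P V =
     {F. linear_functional_on V F \<and> (\<exists>M. \<forall>v\<in>V. \<bar>F v\<bar> \<le> M * norm_w P v)}"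

text \<open>As in \<^const>\<open>onorm\<close>, null elements contribute \<open>0 / 0 = 0\<close> to the supremum. Since the space is an
  argument, \<open>dual_norm P V' F\<close> with \<open>V' \<subseteq> V\<close> is the norm of the restriction of \<open>F\<close> to \<open>V'\<close>.\<close>

definition dual_norm ::
  "('n::finite) elastic_body \<Rightarrow> (real^'n \<Rightarrow> real^'n) set \<Rightarrow> ((real^'n \<Rightarrow> real^'n) \<Rightarrow> real) \<Rightarrow> real" where
  "dual_norm P V F = (SUP v\<in>V. \<bar>F v\<bar> / norm_w P v)"

definition symmetric_positive_form_on ::
  "('a \<Rightarrow> 'b::real_vector) set \<Rightarrow> (('a \<Rightarrow> 'b) \<Rightarrow> ('a \<Rightarrow> 'b) \<Rightarrow> real) \<Rightarrow> bool" where
  "symmetric_positive_form_on V D \<longleftrightarrow>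
     (\<forall>u\<in>V. linear_functional_on V (D u)) \<and>
     (\<forall>u\<in>V. \<forall>v\<in>V. D u v = D v u) \<and>
     (\<forall>u\<in>V. 0 \<le> D u u)"

definition solves_coupled ::
  "('n::finite) elastic_body \<Rightarrow> ((real^'n \<Rightarrow> real^'n) \<Rightarrow> (real^'n \<Rightarrow> real^'n) \<Rightarrow> real) \<Rightarrow> real \<Rightarrow>
   ((real^'n \<Rightarrow> real^'n) \<Rightarrow> real) \<Rightarrow> ((real^'n \<Rightarrow> real^'n) \<Rightarrow> real) \<Rightarrow>
   (real^'n \<Rightarrow> real^'n) \<Rightarrow> (real^'n \<Rightarrow> real^'n) \<Rightarrow> bool" where
  "solves_coupled P D \<kappa> f d w u \<longleftrightarrow>
     w \<in> space_W P \<and> u \<in> space_U P \<and>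
     (\<forall>w'\<in>space_W P. form_A P w w' + form_B P u w' = f w') \<and>
     (\<forall>u'\<in>space_U P. form_B P u' w - \<kappa> * D u u' = - \<kappa> * d u')"

end

theory Submission
  imports Defs "HOL-Library.Function_Algebras"
begin

text \<open>
  On fields vanishing on part of the boundary, \<open>(\<cdot>, \<cdot>)\<^sub>\<omega>\<close> is equivalent to the \<open>H\<^sup>1\<close> inner
  product by Korn's inequality and ellipticity, and these spaces are complete because traces are
  bounded; so the problem lives in two Hilbert spaces. By duality the inf-sup condition on \<open>K\<^sup>\<bottom>\<close>
  provides, for \<open>u\<^sub>1 \<in> H\<^sup>\<bottom>\<close>, a \<open>w \<in> W\<close> with \<open>B(u\<^sub>1, w) = \<parallel>u\<^sub>1\<parallel>\<^sup>2\<close> and \<open>\<beta>\<parallel>w\<parallel> \<le> \<parallel>u\<^sub>1\<parallel>\<close>, so that the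
  first equation bounds \<open>u\<^sub>1\<close> by \<open>f\<close> and \<open>w\<close>. The second equation tested in \<open>H\<close>, where \<open>B\<close> vanishes and
  \<open>D\<close> is coercive, bounds \<open>u\<^sub>0\<close> by \<open>d\<^sub>0\<close> and \<open>u\<^sub>1\<close>. The energy identity
  \<open>A(w, w) + \<kappa> D(u, u) = f(w) + \<kappa> d(u)\<close> then gives a quadratic inequality for \<open>\<parallel>w\<parallel>\<close>, whose positive
  root is the constant \<open>Q\<close>.

  Function spaces are represented by sets of functions with a semidefinite inner product, so that
  fields equal almost everywhere are never identified: uniqueness means that the difference has
  norm zero.
\<close>

section \<open>Hilbert spaces with a semidefinite inner product\<close>

text \<open>The energy identity sees \<open>D\<close> only through \<open>D u u \<ge> 0\<close>, and
  \<open>D\<close> is coercive only on \<open>H\<close>, so the identity controls \<open>w\<close>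
  alone. The field \<open>u\<close> has to be recovered from \<open>w\<close>: first
  \<open>u1\<close>, at the price a/\<beta>, then \<open>u0\<close>, at the price d/\<delta>. The
  product q_d r_a inside Q is the cost of this detour, made when g acts on \<open>u0\<close>. The
  inf-sup hypothesis concerns \<open>K'\<close>, but the estimate of \<open>u1\<close> needs it on
  \<open>H'\<close>; transposing it is a statement about closed ranges, which is where completeness
  of both spaces enters the estimates and not only existence. On the concrete side the obstacle is
  that \<open>weak_gradient\<close> is an arbitrary choice, so gradient, strain and the forms are
  linear only through equalities almost everywhere. These rest on the uniqueness of weak gradients,
  hence on the fundamental lemma of the calculus of variations, hence on smooth bumps in every box.
  The other obstacle is that boundary conditions must survive limits in H^1, although a trace is
  given only as a limit of restrictions of smooth fields.\<close>

definition linear_form_on :: "'v::real_vector set \<Rightarrow> ('v \<Rightarrow> real) \<Rightarrow> bool" where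
  "linear_form_on V F \<longleftrightarrow>
     (\<forall>u\<in>V. \<forall>v\<in>V. F (u + v) = F u + F v) \<and> (\<forall>c. \<forall>v\<in>V. F (c *\<^sub>R v) = c * F v)"

lemma linear_form_on_add: "linear_form_on V F \<Longrightarrow> u \<in> V \<Longrightarrow> v \<in> V \<Longrightarrow> F (u + v) = F u + F v"
  and linear_form_on_scale: "linear_form_on V F \<Longrightarrow> v \<in> V \<Longrightarrow> F (c *\<^sub>R v) = c * F v"
  by (auto simp: linear_form_on_def)

lemma linear_form_on_zero: "linear_form_on V F \<Longrightarrow> subspace V \<Longrightarrow> F 0 = 0"
  using linear_form_on_scale[of V F 0 0] by (simp add: subspace_0)

lemma linear_form_on_diff:
  "linear_form_on V F \<Longrightarrow> subspace V \<Longrightarrow> u \<in> V \<Longrightarrow> v \<in> V \<Longrightarrow> F (u - v) = F u - F v"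
  using linear_form_on_add[of V F u "(-1) *\<^sub>R v"] linear_form_on_scale[of V F v "-1"]
  by (simp add: subspace_neg)

lemma linear_form_on_subset: "linear_form_on V F \<Longrightarrow> V' \<subseteq> V \<Longrightarrow> linear_form_on V' F"
  by (auto simp: linear_form_on_def subset_iff)

text \<open>Besides the energy product this covers \<open>D\<close>, the elastic and mass forms, the
  Schur complement and the form pulled back in \<open>lift\<close>, so that each of them comes with
  its own Cauchy-Schwarz inequality.\<close>

locale semi_inner =
  fixes V :: "'v::real_vector set" and b :: "'v \<Rightarrow> 'v \<Rightarrow> real"
  assumes subspace: "subspace V"
    and linear: "u \<in> V \<Longrightarrow> linear_form_on V (b u)"
    and sym: "u \<in> V \<Longrightarrow> v \<in> V \<Longrightarrow> b u v = b v u"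
    and nonneg: "u \<in> V \<Longrightarrow> 0 \<le> b u u"
begin

text \<open>Only \<open>b\<close> occurs in the body, so the norm is the same constant on every
  subspace of \<open>V\<close>, and restricting the locale needs no transfer of norms.\<close>

definition nrm :: "'v \<Rightarrow> real" where "nrm u = sqrt (b u u)"

lemma closed_ops [simp, intro]:
  shows "0 \<in> V" "u \<in> V \<Longrightarrow> v \<in> V \<Longrightarrow> u + v \<in> V" "u \<in> V \<Longrightarrow> c *\<^sub>R u \<in> V"
    "u \<in> V \<Longrightarrow> v \<in> V \<Longrightarrow> u - v \<in> V" "u \<in> V \<Longrightarrow> - u \<in> V"
  using subspace by (auto simp: subspace_0 subspace_add subspace_scale subspace_diff subspace_neg)

lemma add_right: "u \<in> V \<Longrightarrow> v \<in> V \<Longrightarrow> w \<in> V \<Longrightarrow> b u (v + w) = b u v + b u w"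
  and scale_right: "u \<in> V \<Longrightarrow> v \<in> V \<Longrightarrow> b u (c *\<^sub>R v) = c * b u v"
  using linear by (auto simp: linear_form_on_def)

lemma add_left: "u \<in> V \<Longrightarrow> v \<in> V \<Longrightarrow> w \<in> V \<Longrightarrow> b (v + w) u = b v u + b w u"
  and scale_left: "u \<in> V \<Longrightarrow> v \<in> V \<Longrightarrow> b (c *\<^sub>R v) u = c * b v u"
  by (simp_all add: sym[of _ u] add_right scale_right)

lemma minus_right: "u \<in> V \<Longrightarrow> v \<in> V \<Longrightarrow> b u (- v) = - b u v"
  and minus_left: "u \<in> V \<Longrightarrow> v \<in> V \<Longrightarrow> b (- v) u = - b v u"
  using scale_right[of u v "-1"] scale_left[of u v "-1"] by simp_all

lemma diff_right: "u \<in> V \<Longrightarrow> v \<in> V \<Longrightarrow> w \<in> V \<Longrightarrow> b u (v - w) = b u v - b u w"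
  and diff_left: "u \<in> V \<Longrightarrow> v \<in> V \<Longrightarrow> w \<in> V \<Longrightarrow> b (v - w) u = b v u - b w u"
  using add_right[of u v "-w"] add_left[of u v "-w"] by (simp_all add: minus_right minus_left)

lemmas bilinear_simps = add_right add_left scale_right scale_left minus_right minus_left
  diff_right diff_left

lemma nrm_nonneg: "u \<in> V \<Longrightarrow> 0 \<le> nrm u"
  by (simp add: nrm_def nonneg)

lemma nrm_square: "u \<in> V \<Longrightarrow> (nrm u)\<^sup>2 = b u u"
  by (simp add: nrm_def nonneg)

lemma cauchy_schwarz: "\<bar>b u v\<bar> \<le> nrm u * nrm v" if "u \<in> V" "v \<in> V"
proof -
  have q: "0 \<le> b u u + 2 * t * b u v + t\<^sup>2 * b v v" for t
  proof -
    have "0 \<le> b (u + t *\<^sub>R v) (u + t *\<^sub>R v)" using that by (intro nonneg) auto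
    also have "\<dots> = b u u + 2 * t * b u v + t\<^sup>2 * b v v"
      using that by (simp add: bilinear_simps sym[of v u] power2_eq_square algebra_simps)
    finally show ?thesis .
  qed
  have "(b u v)\<^sup>2 \<le> b u u * b v v"
  proof (cases "b v v = 0")
    case True
    have "b u v = 0"
    proof (rule ccontr)
      assume "b u v \<noteq> 0"
      \<comment> \<open>For \<open>b v v = 0\<close> the quadratic degenerates to an affine function
        of t, which takes the value -1 at this point.\<close>
      then show False using q[of "- (b u u + 1) / (2 * b u v)"] True by (simp add: field_simps)
    qed
    then show ?thesis using True by simp
  next
    case False
    then have "0 < b v v" using nonneg[OF that(2)] by simp
    with q[of "- b u v / b v v"] show ?thesis
      by (simp add: field_simps power2_eq_square)
  qed
  then have "sqrt ((b u v)\<^sup>2) \<le> sqrt (b u u * b v v)" by (rule real_sqrt_le_mono)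
  then show ?thesis by (simp add: nrm_def real_sqrt_mult)
qed

lemma nrm_triangle: "nrm (u + v) \<le> nrm u + nrm v" if "u \<in> V" "v \<in> V"
proof -
  have "(nrm (u + v))\<^sup>2 = (nrm u)\<^sup>2 + 2 * b u v + (nrm v)\<^sup>2"
    using that by (simp add: nrm_square bilinear_simps sym[of v u])
  also have "\<dots> \<le> (nrm u + nrm v)\<^sup>2"
    using cauchy_schwarz[OF that] by (simp add: power2_eq_square algebra_simps)
  finally show ?thesis using that by (intro power2_le_imp_le[OF _ add_nonneg_nonneg] nrm_nonneg)
qed

lemma nrm_scale: "nrm (c *\<^sub>R u) = \<bar>c\<bar> * nrm u" if "u \<in> V"
  using that by (simp add: nrm_def bilinear_simps real_sqrt_mult flip: mult.assoc power2_eq_square)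

lemma nrm_zero [simp]: "nrm 0 = 0"
  using nrm_scale[of 0 0] by simp

lemma nrm_minus: "u \<in> V \<Longrightarrow> nrm (- u) = nrm u"
  using nrm_scale[of u "-1"] by simp

lemma nrm_minus_commute: "u \<in> V \<Longrightarrow> v \<in> V \<Longrightarrow> nrm (u - v) = nrm (v - u)"
  using nrm_minus[of "v - u"] by simp

lemma nrm_triangle_diff:
  "u \<in> V \<Longrightarrow> v \<in> V \<Longrightarrow> w \<in> V \<Longrightarrow> nrm (u - w) \<le> nrm (u - v) + nrm (v - w)"
  using nrm_triangle[of "u - v" "v - w"] by simp

lemma nrm_triangle_le_sum: "u \<in> V \<Longrightarrow> v \<in> V \<Longrightarrow> nrm (u - v) \<le> nrm u + nrm v"
  using nrm_triangle[of u "- v"] by (simp add: nrm_minus)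

definition cauchy_seq :: "(nat \<Rightarrow> 'v) \<Rightarrow> bool" where
  "cauchy_seq X \<longleftrightarrow> (\<forall>n. X n \<in> V) \<and> (\<forall>e>0. \<exists>N. \<forall>m\<ge>N. \<forall>n\<ge>N. nrm (X m - X n) < e)"

lemma cauchy_seqD: "cauchy_seq X \<Longrightarrow> X n \<in> V"
  "cauchy_seq X \<Longrightarrow> 0 < e \<Longrightarrow> \<exists>N. \<forall>m\<ge>N. \<forall>n\<ge>N. nrm (X m - X n) < e"
  by (auto simp: cauchy_seq_def)

lemma convergent_imp_cauchy_seq:
  assumes X: "\<And>n. X n \<in> V" and l: "l \<in> V" and lim: "(\<lambda>n. nrm (X n - l)) \<longlonglongrightarrow> 0"
  shows "cauchy_seq X"
  unfolding cauchy_seq_def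
proof (intro conjI allI impI X)
  fix e :: real assume "0 < e"
  then have "\<forall>\<^sub>F n in sequentially. nrm (X n - l) < e / 2"
    using lim by (intro order_tendstoD(2)[OF lim]) auto
  then obtain N where N: "\<And>n. n \<ge> N \<Longrightarrow> nrm (X n - l) < e / 2"
    by (auto simp: eventually_sequentially)
  have "nrm (X m - X n) < e" if "m \<ge> N" "n \<ge> N" for m n
    using nrm_triangle_diff[OF X l X, of m n] N[OF that(1)] N[OF that(2)]
      nrm_minus_commute[OF X l, of n] by simp
  then show "\<exists>N. \<forall>m\<ge>N. \<forall>n\<ge>N. nrm (X m - X n) < e" by blast
qed

lemma tendsto_b:
  assumes X: "\<And>n. X n \<in> V" and l: "l \<in> V" and v: "v \<in> V"
    and lim: "(\<lambda>n. nrm (X n - l)) \<longlonglongrightarrow> 0"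
  shows "(\<lambda>n. b (X n) v) \<longlonglongrightarrow> b l v"
proof (rule LIM_zero_cancel, rule Lim_null_comparison)
  show "\<forall>\<^sub>F n in sequentially. norm (b (X n) v - b l v) \<le> nrm (X n - l) * nrm v"
    using cauchy_schwarz[of "X _ - l" v] X l v by (intro always_eventually) (auto simp: bilinear_simps)
  show "(\<lambda>n. nrm (X n - l) * nrm v) \<longlonglongrightarrow> 0" using tendsto_mult_right[OF lim, of "nrm v"] by simp
qed

lemma on_subspace: "subspace V' \<Longrightarrow> V' \<subseteq> V \<Longrightarrow> semi_inner V' b"
  by unfold_locales (auto intro: linear_form_on_subset[OF linear] sym nonneg)

end

locale semi_hilbert = semi_inner +
  assumes complete: "cauchy_seq X \<Longrightarrow> \<exists>l\<in>V. (\<lambda>n. nrm (X n - l)) \<longlonglongrightarrow> 0"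
begin

text \<open>Common null sets of bounded functionals are closed: \<open>G l\<close> equals
  \<open>G (l - X n)\<close> for every n, which tends to 0. All the closed subspaces used later
  (\<open>H\<close>, \<open>K\<close>, \<open>K'\<close>) are of this form.\<close>

lemma on_closed_subspace:
  assumes F: "\<And>F. F \<in> S \<Longrightarrow> linear_form_on V F" "\<And>F. F \<in> S \<Longrightarrow> \<exists>M. \<forall>v\<in>V. \<bar>F v\<bar> \<le> M * nrm v"
  shows "semi_hilbert {v \<in> V. \<forall>F\<in>S. F v = 0} b"
proof -
  let ?V = "{v \<in> V. \<forall>F\<in>S. F v = 0}"
  have "subspace ?V"
    by (rule subspaceI) (auto simp: linear_form_on_add[OF F(1)] linear_form_on_scale[OF F(1)]
        linear_form_on_zero[OF F(1) subspace])
  then interpret S: semi_inner ?V b by (rule on_subspace) auto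
  show ?thesis
  proof
    fix X assume X: "S.cauchy_seq X"
    have "cauchy_seq X" using X by (auto simp: cauchy_seq_def S.cauchy_seq_def)
    then obtain l where l: "l \<in> V" "(\<lambda>n. nrm (X n - l)) \<longlonglongrightarrow> 0" using complete by blast
    have XV: "X n \<in> V" and X0: "F \<in> S \<Longrightarrow> F (X n) = 0" for n F
      using S.cauchy_seqD(1)[OF X] by auto
    have "G l = 0" if G: "G \<in> S" for G
    proof -
      obtain M where M: "\<And>v. v \<in> V \<Longrightarrow> \<bar>G v\<bar> \<le> M * nrm v" using F(2)[OF G] by blast
      have "\<bar>G l\<bar> \<le> M * nrm (X n - l)" for n
        using M[of "X n - l"] linear_form_on_diff[OF F(1)[OF G] subspace XV l(1), of n] X0[OF G, of n]
          l(1) XV by simp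
      moreover have "(\<lambda>n. M * nrm (X n - l)) \<longlonglongrightarrow> 0" using tendsto_mult_left[OF l(2), of M] by simp
      ultimately have "\<bar>G l\<bar> \<le> 0" by (intro LIMSEQ_le_const) auto
      then show ?thesis by simp
    qed
    then show "\<exists>l\<in>?V. (\<lambda>n. S.nrm (X n - l)) \<longlonglongrightarrow> 0" using l by blast
  qed
qed

lemma on_null_space:
  assumes "\<And>i. i \<in> I \<Longrightarrow> linear_form_on V (F i)"
    and "\<And>i. i \<in> I \<Longrightarrow> \<exists>M. \<forall>v\<in>V. \<bar>F i v\<bar> \<le> M * nrm v"
  shows "semi_hilbert {v \<in> V. \<forall>i\<in>I. F i v = 0} b"
proof -
  have "{v \<in> V. \<forall>G\<in>F ` I. G v = 0} = {v \<in> V. \<forall>i\<in>I. F i v = 0}" by auto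
  then show ?thesis using on_closed_subspace[of "F ` I"] assms by fastforce
qed

text \<open>Almost minimisers of \<open>b v v - 2 F v\<close> form a Cauchy sequence, and their Euler-Lagrange residual
  tends to zero.\<close>

theorem riesz:
  assumes F: "linear_form_on V F" and bd: "\<And>v. v \<in> V \<Longrightarrow> \<bar>F v\<bar> \<le> M * nrm v"
  shows "\<exists>u\<in>V. \<forall>v\<in>V. b u v = F v"
proof -
  define J where "J v = b v v - 2 * F v" for v
  \<comment> \<open>J v is at least N^2 - 2 M N with N = \<open>nrm v\<close>; completing the square
    bounds this from below.\<close>
  have J_lower: "- M\<^sup>2 \<le> J v" if "v \<in> V" for v
  proof -
    have "0 \<le> (nrm v - M)\<^sup>2" by simp
    then show ?thesis using bd[OF that] nrm_square[OF that]
      by (simp add: J_def power2_diff mult.commute)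
  qed
  define m where "m = Inf (J ` V)"
  have bdd: "bdd_below (J ` V)" using J_lower by (intro bdd_belowI2) auto
  have m_le: "m \<le> J v" if "v \<in> V" for v unfolding m_def using bdd that by (intro cInf_lower) auto
  have "\<exists>v\<in>V. J v < m + 1 / real (Suc n)" for n
  proof -
    have "Inf (J ` V) < m + 1 / real (Suc n)" by (simp add: m_def)
    then show ?thesis using closed_ops(1) bdd by (subst (asm) cInf_less_iff) auto
  qed
  then obtain X where X: "\<And>n. X n \<in> V" "\<And>n. J (X n) < m + 1 / real (Suc n)" by metis
  have J_add: "J (u + t *\<^sub>R v) = J u + 2 * t * (b u v - F v) + t\<^sup>2 * b v v"
    if "u \<in> V" "v \<in> V" for u v t
    using that by (simp add: J_def bilinear_simps sym[of v u] linear_form_on_add[OF F]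
        linear_form_on_scale[OF F] power2_eq_square algebra_simps)
  \<comment> \<open>Parallelogram law: J at the midpoint is the mean of the two values minus a
    quarter of the squared distance, and it cannot fall below m.\<close>
  have par: "(nrm (u - v))\<^sup>2 \<le> 2 * (J u + J v - 2 * m)" if uv: "u \<in> V" "v \<in> V" for u v
  proof -
    have "m \<le> J ((1/2) *\<^sub>R (u + v))" using uv by (intro m_le) auto
    also have "\<dots> = (J u + J v) / 2 - b (u - v) (u - v) / 4"
      using uv by (simp add: J_def bilinear_simps linear_form_on_add[OF F]
          linear_form_on_scale[OF F] sym[of v u] field_simps)
    finally have "m \<le> (J u + J v) / 2 - (nrm (u - v))\<^sup>2 / 4" using uv by (simp add: nrm_square)
    then show ?thesis by (simp add: field_simps)
  qed
  have "cauchy_seq X" unfolding cauchy_seq_def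
  proof (intro conjI allI impI X(1))
    fix e :: real assume e: "0 < e"
    obtain N where N: "1 / real (Suc N) < e\<^sup>2 / 4"
      using e reals_Archimedean[of "e\<^sup>2 / 4"] by (auto simp: inverse_eq_divide)
    have "nrm (X i - X j) < e" if ij: "i \<ge> N" "j \<ge> N" for i j
    proof -
      have "1 / real (Suc i) \<le> 1 / real (Suc N)" "1 / real (Suc j) \<le> 1 / real (Suc N)"
        using ij by (auto intro!: divide_left_mono)
      then have "J (X i) - m < e\<^sup>2 / 4" "J (X j) - m < e\<^sup>2 / 4"
        using X(2)[of i] X(2)[of j] N by linarith+
      then have "(nrm (X i - X j))\<^sup>2 < e\<^sup>2"
        using par[OF X(1)[of i] X(1)[of j]] by (simp add: field_simps)
      then show ?thesis using e by (intro power2_less_imp_less[of _ e]) auto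
    qed
    then show "\<exists>N. \<forall>i\<ge>N. \<forall>j\<ge>N. nrm (X i - X j) < e" by blast
  qed
  then obtain u where u: "u \<in> V" "(\<lambda>n. nrm (X n - u)) \<longlonglongrightarrow> 0" using complete by blast
  have "b u v = F v" if v: "v \<in> V" for v
  proof -
    \<comment> \<open>The expression is the limit of J (X n + t v) - J (X n), and each of these
      differences is at least -1/(n+1) since J (X n) < m + 1/(n+1).\<close>
    have q: "0 \<le> 2 * t * (b u v - F v) + t\<^sup>2 * b v v" for t
    proof (rule LIMSEQ_le)
      show "(\<lambda>n. 2 * t * (b (X n) v - F v) + t\<^sup>2 * b v v)
          \<longlonglongrightarrow> 2 * t * (b u v - F v) + t\<^sup>2 * b v v"
        by (intro tendsto_intros tendsto_b X u v)
      show "(\<lambda>n. - (1 / real (Suc n))) \<longlonglongrightarrow> 0"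
        using tendsto_minus[OF LIMSEQ_inverse_real_of_nat] by (simp add: inverse_eq_divide)
      have "- (1 / real (Suc n)) \<le> 2 * t * (b (X n) v - F v) + t\<^sup>2 * b v v" for n
        using m_le[of "X n + t *\<^sub>R v"] X[of n] v J_add[OF X(1) v, of n t] by auto
      then show "\<exists>N. \<forall>n\<ge>N. - (1 / real (Suc n)) \<le> 2 * t * (b (X n) v - F v) + t\<^sup>2 * b v v"
        by blast
    qed
    show ?thesis
    proof (rule ccontr)
      assume ne: "b u v \<noteq> F v"
      define r where "r = b u v - F v"
      have r: "r \<noteq> 0" using ne by (simp add: r_def)
      \<comment> \<open>The summand 1 keeps the step -r/s meaningful when
        \<open>b v v = 0\<close>.\<close>
      define s where "s = b v v + 1"
      have s: "s > 0" using nonneg[OF v] by (simp add: s_def)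
      have "0 \<le> 2 * (- r / s) * r + (- r / s)\<^sup>2 * (s - 1)" using q[of "- r / s"] by (simp add: r_def s_def)
      also have "\<dots> = - (r\<^sup>2 / s) - r\<^sup>2 / s\<^sup>2" using s by (simp add: field_simps power2_eq_square)
      finally have "r\<^sup>2 / s + r\<^sup>2 / s\<^sup>2 \<le> 0" by simp
      moreover have "0 < r\<^sup>2 / s" "0 < r\<^sup>2 / s\<^sup>2" using r s by simp_all
      ultimately show False by linarith
    qed
  qed
  then show ?thesis using u by blast
qed

text \<open>Equivalent norms have the same Cauchy sequences and limits. This carries completeness
  from the H^1 product to the energy product, and from \<open>b\<close> to coercive symmetric
  forms.\<close>

lemma equivalent_complete:
  assumes "semi_inner V b'" and c: "0 < c" "\<And>v. v \<in> V \<Longrightarrow> c * b v v \<le> b' v v"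
    and C: "\<And>v. v \<in> V \<Longrightarrow> b' v v \<le> C * b v v"
  shows "semi_hilbert V b'"
proof -
  interpret S: semi_inner V b' by fact
  have le: "nrm v \<le> S.nrm v / sqrt c" if "v \<in> V" for v
  proof -
    have "sqrt (c * b v v) \<le> sqrt (b' v v)" using c that by simp
    then show ?thesis using c by (simp add: nrm_def S.nrm_def real_sqrt_mult field_simps)
  qed
  have ge: "S.nrm v \<le> sqrt C * nrm v" if "v \<in> V" for v
  proof -
    have "sqrt (b' v v) \<le> sqrt (C * b v v)" using C that by simp
    then show ?thesis using c by (simp add: nrm_def S.nrm_def real_sqrt_mult field_simps)
  qed
  show ?thesis
  proof
    fix X assume X: "S.cauchy_seq X"
    have XV: "X n \<in> V" for n using S.cauchy_seqD(1)[OF X] .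
    have "cauchy_seq X"
      unfolding cauchy_seq_def
    proof (intro conjI allI impI XV)
      fix e :: real assume "0 < e"
      then have "0 < e * sqrt c" using c by simp
      then obtain N where N: "\<forall>m\<ge>N. \<forall>n\<ge>N. S.nrm (X m - X n) < e * sqrt c"
        using S.cauchy_seqD(2)[OF X] by blast
      have "nrm (X m - X n) < e" if "m \<ge> N" "n \<ge> N" for m n
      proof -
        have "nrm (X m - X n) \<le> S.nrm (X m - X n) / sqrt c" using XV by (intro le) auto
        also have "\<dots> < e" using N that c by (simp add: field_simps)
        finally show ?thesis .
      qed
      then show "\<exists>N. \<forall>m\<ge>N. \<forall>n\<ge>N. nrm (X m - X n) < e" by blast
    qed
    then obtain l where l: "l \<in> V" "(\<lambda>n. nrm (X n - l)) \<longlonglongrightarrow> 0" using complete by blast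
    have "(\<lambda>n. S.nrm (X n - l)) \<longlonglongrightarrow> 0"
    proof (rule Lim_null_comparison)
      show "\<forall>\<^sub>F n in sequentially. norm (S.nrm (X n - l)) \<le> sqrt C * nrm (X n - l)"
        using ge[of "X _ - l"] XV l by (intro always_eventually) (auto simp: S.nrm_nonneg)
      show "(\<lambda>n. sqrt C * nrm (X n - l)) \<longlonglongrightarrow> 0"
        using tendsto_mult_left[OF l(2), of "sqrt C"] by simp
    qed
    then show "\<exists>l\<in>V. (\<lambda>n. S.nrm (X n - l)) \<longlonglongrightarrow> 0" using l by blast
  qed
qed

end

section \<open>The abstract coupled problem\<close>

text \<open>Completing the square after multiplication by 4p; the positive root is the source of the
  square root in Q.\<close>

lemma quadratic_bound:
  fixes x :: real
  assumes "0 < p" and "p * x\<^sup>2 \<le> q * x + r"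
  shows "x \<le> (q + sqrt (q\<^sup>2 + 4 * p * r)) / (2 * p)"
proof -
  have "4 * p * (p * x\<^sup>2) \<le> 4 * p * (q * x + r)" using assms by (intro mult_left_mono) auto
  then have "(2 * p * x - q)\<^sup>2 \<le> q\<^sup>2 + 4 * p * r"
    by (simp add: power2_eq_square algebra_simps)
  then have "2 * p * x - q \<le> sqrt (q\<^sup>2 + 4 * p * r)" by (rule real_le_rsqrt)
  then show ?thesis using assms(1) by (simp add: field_simps)
qed

corollary quadratic_bound_homogeneous:
  fixes x :: real
  assumes "0 < p" "0 \<le> q" "p * x\<^sup>2 \<le> q * x"
  shows "x \<le> q / p"
  using quadratic_bound[of p x q 0] assms by simp

section \<open>Symmetric Lax-Milgram theorem and orthogonal projection\<close>

context semi_hilbert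
begin

text \<open>A bounded coercive symmetric form is itself a complete inner product, so Riesz
  representation with respect to \<open>b'\<close> already solves the equation.\<close>

lemma lax_milgram_symmetric:
  assumes b': "semi_inner V b'" and c: "0 < c" "\<And>v. v \<in> V \<Longrightarrow> c * b v v \<le> b' v v"
    and C: "\<And>v. v \<in> V \<Longrightarrow> b' v v \<le> C * b v v"
    and F: "linear_form_on V F" and bd: "\<And>v. v \<in> V \<Longrightarrow> \<bar>F v\<bar> \<le> M * nrm v"
  shows "\<exists>u\<in>V. \<forall>v\<in>V. b' u v = F v"
proof -
  interpret S: semi_hilbert V b' by (rule equivalent_complete[OF b' c C])
  show ?thesis
  proof (rule S.riesz[OF F])
    fix v assume v: "v \<in> V"
    have "sqrt (c * b v v) \<le> sqrt (b' v v)" using c v by simp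
    then have le: "nrm v \<le> S.nrm v / sqrt c"
      using c by (simp add: nrm_def S.nrm_def real_sqrt_mult field_simps)
    have "\<bar>F v\<bar> \<le> \<bar>M\<bar> * nrm v"
      using bd[OF v] mult_right_mono[OF abs_ge_self[of M] nrm_nonneg[OF v]] by linarith
    also have "\<dots> \<le> \<bar>M\<bar> * (S.nrm v / sqrt c)" using le by (intro mult_left_mono) auto
    finally show "\<bar>F v\<bar> \<le> (\<bar>M\<bar> / sqrt c) * S.nrm v" by simp
  qed
qed

lemma bounded_b: "u \<in> V \<Longrightarrow> \<exists>M. \<forall>v\<in>V. \<bar>b u v\<bar> \<le> M * nrm v"
  using cauchy_schwarz by blast

text \<open>The projection is the representative in \<open>S\<close> of the functional
  \<open>b v\<close> restricted to \<open>S\<close>.\<close>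

lemma orthogonal_projection:
  assumes "semi_hilbert S b" "S \<subseteq> V" "v \<in> V"
  shows "\<exists>s\<in>S. \<forall>s'\<in>S. b (v - s) s' = 0"
proof -
  interpret S: semi_hilbert S b by fact
  have "\<exists>s\<in>S. \<forall>s'\<in>S. b s s' = b v s'"
    using assms cauchy_schwarz[of v]
    by (intro S.riesz[of _ "nrm v"]) (auto intro: linear_form_on_subset[OF linear])
  then show ?thesis using assms by (metis diff_left eq_iff_diff_eq_0 subset_iff)
qed

end

text \<open>The inf-sup condition is phrased without infima or quotients: any bound c for the
  functional \<open>\<lambda>u. B u w\<close> is at least \<beta> times the norm of
  \<open>w\<close>. This form also covers elements of norm zero. The constant \<open>M\<close>
  serves existence and the construction of lifts only; it enters none of the stability
  bounds.\<close>

locale coupled_problem = semi_hilbert U b + W: semi_hilbert W b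
  for U W :: "'v::real_vector set" and b +
  fixes A B D :: "'v \<Rightarrow> 'v \<Rightarrow> real" and a d \<alpha> \<beta> \<delta> M :: real
    and H K H' K' :: "'v set"
  defines "H \<equiv> {u \<in> U. \<forall>w\<in>W. B u w = 0}"
    and "K \<equiv> {w \<in> W. \<forall>u\<in>U. B u w = 0}"
    and "H' \<equiv> {u \<in> U. \<forall>h\<in>H. b u h = 0}"
    and "K' \<equiv> {w \<in> W. \<forall>k\<in>K. b w k = 0}"
  assumes W_U: "W \<subseteq> U"
    and pos: "0 < a" "0 < d" "0 < \<alpha>" "0 < \<beta>" "0 < \<delta>"
    and A_linear: "w \<in> W \<Longrightarrow> linear_form_on W (A w)"
    and A_sym: "w \<in> W \<Longrightarrow> w' \<in> W \<Longrightarrow> A w w' = A w' w"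
    and A_le: "w \<in> W \<Longrightarrow> w' \<in> W \<Longrightarrow> A w w' \<le> a * nrm w * nrm w'"
    and A_coercive: "w \<in> W \<Longrightarrow> \<alpha> * (nrm w)\<^sup>2 \<le> A w w"
    and B_linear: "u \<in> U \<Longrightarrow> linear_form_on W (B u)"
    and B_linear_left: "w \<in> W \<Longrightarrow> linear_form_on U (\<lambda>u. B u w)"
    and B_bounded: "u \<in> U \<Longrightarrow> w \<in> W \<Longrightarrow> \<bar>B u w\<bar> \<le> M * nrm u * nrm w"
    and D_linear: "u \<in> U \<Longrightarrow> linear_form_on U (D u)"
    and D_sym: "u \<in> U \<Longrightarrow> u' \<in> U \<Longrightarrow> D u u' = D u' u"
    and D_nonneg: "u \<in> U \<Longrightarrow> 0 \<le> D u u"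
    and D_le: "u \<in> U \<Longrightarrow> u' \<in> U \<Longrightarrow> D u u' \<le> d * nrm u * nrm u'"
    and D_coercive: "h \<in> H \<Longrightarrow> \<delta> * (nrm h)\<^sup>2 \<le> D h h"
    and inf_sup: "w \<in> K' \<Longrightarrow> 0 \<le> c \<Longrightarrow> (\<And>u. u \<in> U \<Longrightarrow> B u w \<le> c * nrm u) \<Longrightarrow> \<beta> * nrm w \<le> c"
begin

lemma WU: "w \<in> W \<Longrightarrow> w \<in> U"
  using W_U by blast

lemma H_U: "h \<in> H \<Longrightarrow> h \<in> U" and H'_U: "h' \<in> H' \<Longrightarrow> h' \<in> U"
  and K_W: "k \<in> K \<Longrightarrow> k \<in> W" and K'_W: "k' \<in> K' \<Longrightarrow> k' \<in> W"
  by (auto simp: H_def H'_def K_def K'_def)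

lemma H_B: "h \<in> H \<Longrightarrow> w \<in> W \<Longrightarrow> B h w = 0" and K_B: "k \<in> K \<Longrightarrow> u \<in> U \<Longrightarrow> B u k = 0"
  and H'_b: "u \<in> H' \<Longrightarrow> h \<in> H \<Longrightarrow> b u h = 0" and H'_b': "u \<in> H' \<Longrightarrow> h \<in> H \<Longrightarrow> b h u = 0"
  by (auto simp: H_def H'_def K_def intro: sym[THEN trans])

lemma D_inner: "semi_inner U D"
  by unfold_locales (auto intro: subspace D_linear D_sym D_nonneg)

lemma A_inner: "semi_inner W A"
proof
  show "0 \<le> A w w" if "w \<in> W" for w
    using A_coercive[OF that] pos by (meson less_imp_le mult_nonneg_nonneg order_trans zero_le_power2)
qed (auto intro: W.subspace A_linear A_sym)

sublocale D: semi_inner U D by (rule D_inner)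
sublocale A: semi_inner W A by (rule A_inner)

lemmas B_add_right = linear_form_on_add[OF B_linear]
  and B_scale_right = linear_form_on_scale[OF B_linear]
  and B_diff_right = linear_form_on_diff[OF B_linear W.subspace]
  and B_add_left = linear_form_on_add[OF B_linear_left]
  and B_scale_left = linear_form_on_scale[OF B_linear_left]
  and B_diff_left = linear_form_on_diff[OF B_linear_left subspace]

lemmas B_simps = B_add_right B_scale_right B_diff_right B_add_left B_scale_left B_diff_left

lemma B_bounded_left: "w \<in> W \<Longrightarrow> \<exists>C. \<forall>u\<in>U. \<bar>B u w\<bar> \<le> C * nrm u"
  using B_bounded[of _ w] by (intro exI[of _ "M * nrm w"]) (auto simp: ac_simps)

lemma hilbert_H: "semi_hilbert H b"
  unfolding H_def by (rule on_null_space[OF B_linear_left B_bounded_left])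

lemma hilbert_K: "semi_hilbert K b"
  unfolding K_def
  by (rule W.on_null_space[OF B_linear]) (auto intro: B_bounded)

lemma hilbert_K': "semi_hilbert K' b"
proof -
  have "K' = {w \<in> W. \<forall>k\<in>K. b k w = 0}" unfolding K'_def using W.sym K_W by auto
  then show ?thesis
    using W.on_null_space[of K b] W.linear W.bounded_b K_W by auto
qed

sublocale H: semi_hilbert H b by (rule hilbert_H)
sublocale K': semi_hilbert K' b by (rule hilbert_K')

lemma decomposition:
  assumes "u \<in> U"
  obtains u0 u1 where "u0 \<in> H" "u1 \<in> H'" "u = u0 + u1"
proof -
  obtain h where h: "h \<in> H" "\<forall>h'\<in>H. b (u - h) h' = 0"
    using orthogonal_projection[OF hilbert_H _ assms] H_U by blast
  then have "u - h \<in> H'" using assms H_U by (auto simp: H'_def)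
  then show thesis using that[of h "u - h"] h by simp
qed

text \<open>The transposed inf-sup condition: on the orthogonal complement of \<open>H\<close>, the Riesz
  representatives of \<open>B _ w\<close> form a dense set by the choice of \<open>H\<close> and a closed one by the inf-sup
  condition.\<close>

lemma lift:
  assumes u1: "u1 \<in> H'"
  obtains w where "w \<in> W" "\<And>u. u \<in> U \<Longrightarrow> B u w = b u u1" "\<beta> * nrm w \<le> nrm u1"
proof -
  \<comment> \<open>\<open>T w\<close> will be the Riesz representative in \<open>U\<close> of
    \<open>\<lambda>u. B u w\<close>; the inf-sup condition then reads \<beta> |w| \<le> |T w| on
    \<open>K'\<close>.\<close>
  have "\<exists>t\<in>U. \<forall>u\<in>U. b t u = B u w" if "w \<in> W" for w
    using that B_bounded[OF _ that]
    by (intro riesz[OF B_linear_left, of w "M * nrm w"]) (auto simp: ac_simps)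
  then obtain T where T: "\<And>w. w \<in> W \<Longrightarrow> T w \<in> U" "\<And>u w. w \<in> W \<Longrightarrow> u \<in> U \<Longrightarrow> b (T w) u = B u w"
    by metis
  have T_ge: "\<beta> * nrm w \<le> nrm (T w)" if "w \<in> K'" for w
  proof (rule inf_sup[OF that nrm_nonneg[OF T(1)[OF K'_W[OF that]]]])
    fix u assume u: "u \<in> U"
    show "B u w \<le> nrm (T w) * nrm u"
      using cauchy_schwarz[of "T w" u] T K'_W that u by (metis abs_le_D1)
  qed
  have T_le: "nrm (T w) \<le> M * nrm w" if "w \<in> W" for w
  \<comment> \<open>\<open>M\<close> carries no sign condition. If \<open>T w\<close> is null,
    nonnegativity of \<open>M * nrm w\<close> is read off from the bound on \<open>B\<close> at u =
    w.\<close>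
  proof (cases "nrm (T w) = 0")
    case True
    have "0 \<le> M * nrm w" if "u \<in> U" "nrm u > 0" for u
      using order_trans[OF abs_ge_zero B_bounded[OF that(1) \<open>w \<in> W\<close>]] that
      by (simp add: mult.assoc mult.left_commute[of M] zero_le_mult_iff)
    show ?thesis
    proof (cases "nrm w = 0")
      case False
      then have "nrm w > 0" using nrm_nonneg[OF WU[OF that]] by simp
      then show ?thesis using True \<open>\<And>u. \<lbrakk>u \<in> U; 0 < nrm u\<rbrakk> \<Longrightarrow> 0 \<le> M * nrm w\<close>[OF WU[OF that]] by simp
    qed (use True in simp)
  next
    case False
    then have p: "nrm (T w) > 0" using nrm_nonneg[OF T(1)[OF that]] by simp
    have "nrm (T w) * nrm (T w) = B (T w) w"
      using T that nrm_square[OF T(1)[OF that]] by (simp add: power2_eq_square)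
    also have "\<dots> \<le> M * nrm (T w) * nrm w" using B_bounded[OF T(1)[OF that] that] by linarith
    finally show ?thesis using p by (simp add: ac_simps)
  qed
  \<comment> \<open>The product pulled back along \<open>T\<close>. It is equivalent to
    \<open>b\<close> on \<open>K'\<close>, below by inf-sup and above by continuity, so
    \<open>B u1\<close> has a representative \<open>w\<close> for it; then \<open>T w\<close> is the
    projection of \<open>u1\<close> onto the image of \<open>K'\<close>.\<close>
  define n where "n w w' = b (T w) (T w')" for w w'
  have n: "n w w' = B (T w) w'" if "w \<in> W" "w' \<in> W" for w w'
    unfolding n_def using that T by (metis sym)
  have n_inner: "semi_inner K' n"
  proof
    show "linear_form_on K' (n w)" if "w \<in> K'" for w
      using linear_form_on_subset[OF B_linear[OF T(1)[OF K'_W[OF that]]], of K'] that K'_W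
      by (auto simp: linear_form_on_def n)
    show "n v w = n w v" if "v \<in> K'" "w \<in> K'" for v w
      unfolding n_def using that by (intro sym T K'_W)
    show "0 \<le> n w w" if "w \<in> K'" for w
      unfolding n_def using that by (intro nonneg T K'_W)
  qed (rule K'.subspace)
  interpret N: semi_inner K' n by (rule n_inner)
  have N_nrm: "(nrm (T w))\<^sup>2 = n w w" if "w \<in> K'" for w
    using that by (simp add: n_def nrm_square T K'_W)
  have "\<exists>w\<in>K'. \<forall>w'\<in>K'. n w w' = B u1 w'"
  proof (rule K'.lax_milgram_symmetric[OF n_inner])
    show "0 < \<beta>\<^sup>2" using pos by simp
    show "\<beta>\<^sup>2 * b w w \<le> n w w" if "w \<in> K'" for w
      using power_mono[OF T_ge[OF that], of 2] that pos
      by (simp add: power_mult_distrib N_nrm nrm_square WU K'_W nrm_nonneg)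
    show "n w w \<le> M\<^sup>2 * b w w" if "w \<in> K'" for w
      unfolding N_nrm[OF that, symmetric]
      using power_mono[OF T_le[OF K'_W[OF that]], of 2] that
      by (simp add: power_mult_distrib nrm_square[of w] WU K'_W nrm_nonneg T(1))
    show "linear_form_on K' (B u1)"
      using u1 H'_U K'_W by (intro linear_form_on_subset[OF B_linear]) auto
    show "\<bar>B u1 w\<bar> \<le> M * nrm u1 * nrm w" if "w \<in> K'" for w
      using that u1 by (intro B_bounded H'_U K'_W)
  qed
  then obtain w where w: "w \<in> K'" "\<And>w'. w' \<in> K' \<Longrightarrow> B (T w) w' = B u1 w'"
    using n K'_W by metis
  have wW: "w \<in> W" and TU: "T w \<in> U" and uU: "u1 \<in> U" using w(1) u1 K'_W T H'_U by auto
  \<comment> \<open>The residual z of this projection annihilates \<open>K'\<close> by construction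
    and \<open>K\<close> by the definition of \<open>K\<close>, so it lies in \<open>H\<close>.
    There \<open>u1\<close> and \<open>T w\<close> are both orthogonal to it, so z has norm zero and
    \<open>T w\<close> represents the same functional as \<open>u1\<close>.\<close>
  define z where "z = T w - u1"
  have zU: "z \<in> U" using TU uU by (simp add: z_def)
  have "B z w' = 0" if w': "w' \<in> W" for w'
  proof -
    obtain k where k: "k \<in> K" "\<forall>k'\<in>K. b (w' - k) k' = 0"
      using W.orthogonal_projection[OF hilbert_K _ w'] K_W by blast
    then have k': "w' - k \<in> K'" using w' K_W by (auto simp: K'_def)
    have "B z (w' - k) = 0" using w(2)[OF k'] TU uU k' K'_W by (simp add: z_def B_diff_left)
    moreover have "B z k = 0" using K_B[OF k(1) zU] .
    ultimately show ?thesis using w' K_W[OF k(1)] zU by (simp add: B_diff_right)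
  qed
  then have zH: "z \<in> H" using zU by (simp add: H_def)
  have "b z z = b (T w) z - b u1 z" using TU uU zU by (simp add: z_def diff_left)
  also have "\<dots> = 0" using T(2)[OF wW zU] H_B[OF zH wW] H'_b[OF u1 zH] by simp
  finally have nz: "nrm z = 0" by (simp add: nrm_def)
  have eq: "b (T w) u = b u1 u" if u: "u \<in> U" for u
    using cauchy_schwarz[OF zU u] nz TU uU u by (simp add: z_def diff_left)
  have "b (T w) (T w) = b u1 u1" using eq[OF TU] eq[OF uU] sym[OF TU uU] by simp
  then have "nrm (T w) = nrm u1" by (simp add: nrm_def)
  then have "\<beta> * nrm w \<le> nrm u1" using T_ge[OF w(1)] by simp
  moreover have "B u w = b u u1" if "u \<in> U" for u using T(2)[OF wW that] eq[OF that] sym[OF that uU] by simp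
  ultimately show thesis using that wW by blast
qed

section \<open>The coupled system: a priori estimates and uniqueness\<close>

definition solves :: "real \<Rightarrow> ('v \<Rightarrow> real) \<Rightarrow> ('v \<Rightarrow> real) \<Rightarrow> 'v \<Rightarrow> 'v \<Rightarrow> bool" where
  "solves \<kappa> f g w u \<longleftrightarrow> w \<in> W \<and> u \<in> U \<and>
     (\<forall>w'\<in>W. A w w' + B u w' = f w') \<and> (\<forall>u'\<in>U. B u' w - \<kappa> * D u u' = - \<kappa> * g u')"

lemma solvesD:
  assumes "solves \<kappa> f g w u"
  shows "w \<in> W" "u \<in> U" "w' \<in> W \<Longrightarrow> A w w' + B u w' = f w'"
    "u' \<in> U \<Longrightarrow> B u' w - \<kappa> * D u u' = - \<kappa> * g u'"
  using assms by (auto simp: solves_def)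

lemma solves_add:
  "solves \<kappa> f g w u \<Longrightarrow> solves \<kappa> f' g' w' u' \<Longrightarrow>
     solves \<kappa> (\<lambda>v. f v + f' v) (\<lambda>v. g v + g' v) (w + w') (u + u')"
  by (fastforce simp: solves_def A.bilinear_simps D.bilinear_simps B_simps algebra_simps)

lemma solves_diff:
  "solves \<kappa> f g w u \<Longrightarrow> solves \<kappa> f' g' w' u' \<Longrightarrow>
     solves \<kappa> (\<lambda>v. f v - f' v) (\<lambda>v. g v - g' v) (w - w') (u - u')"
  by (fastforce simp: solves_def A.bilinear_simps D.bilinear_simps B_simps algebra_simps)

lemma D_abs_le: "\<bar>D u u'\<bar> \<le> d * nrm u * nrm u'" if "u \<in> U" "u' \<in> U"
  using D_le[OF that] D_le[of "- u" u'] that by (auto simp: D.bilinear_simps nrm_minus)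

lemma A_abs_le: "\<bar>A w w'\<bar> \<le> a * nrm w * nrm w'" if "w \<in> W" "w' \<in> W"
  using A_le[OF that] A_le[of "- w" w'] that by (auto simp: A.bilinear_simps nrm_minus WU)

text \<open>Bounded forms do not see elements of norm zero. This lets a decomposition of
  \<open>u\<close> that holds only almost everywhere replace \<open>u\<close> in the
  equations.\<close>

lemma solves_null:
  assumes s: "solves \<kappa> f g w u" and u': "u' \<in> U" "nrm (u - u') = 0"
  shows "solves \<kappa> f g w u'"
proof -
  note s' = solvesD[OF s]
  have "B u v = B u' v" if "v \<in> W" for v
    using B_bounded[of "u - u'" v] that s' u' by (simp add: B_simps)
  moreover have "D u v = D u' v" if "v \<in> U" for v
    using D_abs_le[of "u - u'" v] that s' u' by (simp add: D.bilinear_simps)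
  ultimately show ?thesis using s u' by (simp add: solves_def)
qed

text \<open>Testing with \<open>u0\<close> leaves \<kappa> D (u0 + u1) u0 = \<kappa> g u0. The
  factor \<kappa> cancels, and dividing by the coercivity constant produces both G0/\<delta> and the
  ratio q_d.\<close>

lemma D_bounded_H:
  assumes s: "solves \<kappa> f g w (u0 + u1)" and \<kappa>: "0 < \<kappa>" and u0: "u0 \<in> H" and u1: "u1 \<in> H'"
    and g0: "g u0 \<le> G0 * nrm u0" and G0: "0 \<le> G0"
  shows "nrm u0 \<le> G0 / \<delta> + d / \<delta> * nrm u1"
proof (cases "nrm u0 = 0")
  case True
  then show ?thesis using pos G0 nrm_nonneg[OF H'_U[OF u1]] by simp
next
  case False
  have U: "u0 \<in> U" "u1 \<in> U" using u0 u1 H_U H'_U by auto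
  have p: "0 < nrm u0" using False nrm_nonneg[OF U(1)] by simp
  have "D (u0 + u1) u0 = g u0"
    using solvesD(4)[OF s U(1)] H_B[OF u0 solvesD(1)[OF s]] \<kappa> by simp
  then have "D u0 u0 = g u0 - D u1 u0" using U by (simp add: D.bilinear_simps)
  also have "\<dots> \<le> G0 * nrm u0 + d * nrm u1 * nrm u0"
    using g0 D_abs_le[OF U(2,1)] by linarith
  finally have "(\<delta> * nrm u0) * nrm u0 \<le> (G0 + d * nrm u1) * nrm u0"
    using D_coercive[OF u0] by (simp add: power2_eq_square algebra_simps)
  then have "\<delta> * nrm u0 \<le> G0 + d * nrm u1" using p by simp
  then show ?thesis using pos by (simp add: field_simps)
qed

text \<open>Only the first equation is used, tested with the lift of \<open>u1\<close>; the part
  \<open>u0\<close> drops out because \<open>B\<close> vanishes on \<open>H\<close> and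
  \<open>W\<close>. The bound is therefore independent of \<kappa> and g.\<close>

lemma B_bounded_H':
  assumes s: "solves \<kappa> f g w (u0 + u1)" and u0: "u0 \<in> H" and u1: "u1 \<in> H'"
    and f: "\<And>w. w \<in> W \<Longrightarrow> f w \<le> F * nrm w" and F: "0 \<le> F"
  shows "nrm u1 \<le> (F + a * nrm w) / \<beta>"
proof (cases "nrm u1 = 0")
  case True
  then show ?thesis using pos F nrm_nonneg[OF WU[OF solvesD(1)[OF s]]] by simp
next
  case False
  have U: "u0 \<in> U" "u1 \<in> U" using u0 u1 H_U H'_U by auto
  have p: "0 < nrm u1" using False nrm_nonneg[OF U(2)] by simp
  obtain w' where w': "w' \<in> W" "\<And>u. u \<in> U \<Longrightarrow> B u w' = b u u1" "\<beta> * nrm w' \<le> nrm u1"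
    using lift[OF u1] by blast
  have w: "w \<in> W" by (rule solvesD(1)[OF s])
  have "B (u0 + u1) w' = B u1 w'" using U w'(1) u0 H_B by (simp add: B_add_left)
  then have "(nrm u1)\<^sup>2 = B (u0 + u1) w'" using w'(2)[OF U(2)] U by (simp add: nrm_square)
  also have "\<dots> = f w' - A w w'" using solvesD(3)[OF s w'(1)] by simp
  also have "\<dots> \<le> (F + a * nrm w) * nrm w'"
    using f[OF w'(1)] A_abs_le[OF w w'(1)] by (simp add: algebra_simps)
  also have "\<dots> \<le> (F + a * nrm w) * (nrm u1 / \<beta>)"
    using w'(3) pos F nrm_nonneg[OF WU[OF w]]
    by (intro mult_left_mono add_nonneg_nonneg mult_nonneg_nonneg) (auto simp: field_simps)
  finally have "nrm u1 * nrm u1 \<le> ((F + a * nrm w) / \<beta>) * nrm u1"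
    by (simp add: power2_eq_square)
  then show ?thesis using p by (simp only: mult_le_cancel_right)
qed

text \<open>Testing with the solution itself and subtracting the equations cancels
  \<open>B u w\<close>; the term with \<open>D\<close> is then discarded by its sign.\<close>

lemma energy_bound:
  assumes s: "solves \<kappa> f g w u" and \<kappa>: "0 < \<kappa>"
  shows "\<alpha> * (nrm w)\<^sup>2 \<le> f w + \<kappa> * g u"
proof -
  note s' = solvesD[OF s]
  have "A w w + \<kappa> * D u u = f w + \<kappa> * g u"
    using s'(3)[OF s'(1)] s'(4)[OF s'(2)] by simp
  moreover have "0 \<le> \<kappa> * D u u" using D_nonneg[OF s'(2)] \<kappa> by simp
  ultimately show ?thesis using A_coercive[OF s'(1)] by linarith
qed

text \<open>With zero data the energy removes only \<open>w\<close>; then \<open>u1\<close> vanishes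
  by the lifted inf-sup condition, and finally \<open>u0\<close> by coercivity on
  \<open>H\<close>.\<close>

lemma solution_unique:
  assumes "solves \<kappa> f g w u" "solves \<kappa> f g w' u'" and \<kappa>: "0 < \<kappa>"
  shows "nrm (w - w') = 0" "nrm (u - u') = 0"
proof -
  have s: "solves \<kappa> (\<lambda>_. 0) (\<lambda>_. 0) (w - w') (u - u')"
    using solves_diff[OF assms(1,2)] by simp
  note s' = solvesD[OF s]
  obtain u0 u1 where u: "u0 \<in> H" "u1 \<in> H'" "u - u' = u0 + u1" using decomposition[OF s'(2)] by blast
  have "\<alpha> * (nrm (w - w'))\<^sup>2 \<le> 0" using energy_bound[OF s \<kappa>] by simp
  then show w: "nrm (w - w') = 0" using pos by (simp add: mult_le_0_iff)
  have "nrm u1 \<le> 0"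
    using B_bounded_H'[OF s[unfolded u(3)] u(1,2), of 0] w by simp
  then have u1: "nrm u1 = 0" using nrm_nonneg[OF H'_U[OF u(2)]] by simp
  then have "nrm u0 \<le> 0"
    using D_bounded_H[OF s[unfolded u(3)] \<kappa> u(1,2), of 0] by simp
  then have "nrm (u0 + u1) \<le> 0" using nrm_triangle[of u0 u1] u H_U H'_U u1 by fastforce
  then show "nrm (u - u') = 0" using nrm_nonneg[OF s'(2)] u(3) by simp
qed

text \<open>Eliminating \<open>w\<close> leaves a problem for \<open>u\<close> governed by the Schur complement
  \<open>B\<^sup>t A\<^sup>-\<^sup>1 B + \<kappa> D\<close>, which is coercive on \<open>U\<close>.\<close>

lemma solution_exists:
  assumes \<kappa>: "0 < \<kappa>"
    and f: "linear_form_on W f" "\<And>w. w \<in> W \<Longrightarrow> \<bar>f w\<bar> \<le> F * nrm w"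
    and g: "linear_form_on U g" "\<And>u. u \<in> U \<Longrightarrow> \<bar>g u\<bar> \<le> G * nrm u"
  shows "\<exists>w u. solves \<kappa> f g w u"
proof -
  have A_riesz: "\<exists>w\<in>W. \<forall>w'\<in>W. A w w' = f' w'"
    if "linear_form_on W f'" "\<And>w. w \<in> W \<Longrightarrow> \<bar>f' w\<bar> \<le> C * nrm w" for f' C
    using that A_coercive A_le pos
    by (intro W.lax_milgram_symmetric[OF A_inner, of \<alpha> a f' C])
      (auto simp: nrm_square[symmetric] WU power2_eq_square mult.assoc)
  obtain wf where wf: "wf \<in> W" "\<And>w. w \<in> W \<Longrightarrow> A wf w = f w" using A_riesz[OF f] by blast
  have "\<exists>w\<in>W. \<forall>w'\<in>W. A w w' = B u w'" if "u \<in> U" for u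
    using B_bounded[OF that] by (intro A_riesz[OF B_linear[OF that]]) auto
  then obtain R where R: "\<And>u. u \<in> U \<Longrightarrow> R u \<in> W" "\<And>u w. u \<in> U \<Longrightarrow> w \<in> W \<Longrightarrow> A (R u) w = B u w"
    by metis
  \<comment> \<open>\<open>R\<close> is A^{-1} B, so the first summand is the form of B^t A^{-1} B
    written symmetrically.\<close>
  define S where "S u v = A (R u) (R v) + \<kappa> * D u v" for u v
  have S: "S u v = B v (R u) + \<kappa> * D u v" if "u \<in> U" "v \<in> U" for u v
    unfolding S_def using that R by (metis A_sym)
  have S_inner: "semi_inner U S"
  proof
    show "linear_form_on U (S u)" if "u \<in> U" for u
      using that R by (auto simp: linear_form_on_def S B_simps D.bilinear_simps algebra_simps)
    show "S u v = S v u" if "u \<in> U" "v \<in> U" for u v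
      unfolding S_def using that R by (metis A_sym D_sym)
    show "0 \<le> S u u" if "u \<in> U" for u
      unfolding S_def using A.nonneg[OF R(1)[OF that]] D_nonneg[OF that] \<kappa> by simp
  qed (rule subspace)
  \<comment> \<open>Sum of the factors by which \<kappa> D u u and A (R u) (R u) enter the bound of
    |u0|^2 + |u1|^2 below; each factor is then at most p.\<close>
  define p where "p = 2 / (\<delta> * \<kappa>) + (1 + 2 * d / \<delta>) * (a / \<beta>)\<^sup>2 / \<alpha>"
  have p: "0 < p" using pos \<kappa> by (auto simp: p_def intro!: add_pos_pos mult_pos_pos divide_pos_pos)
  have S_ge: "b u u \<le> p * S u u" if u: "u \<in> U" for u
  proof -
    obtain u0 u1 where u01: "u0 \<in> H" "u1 \<in> H'" "u = u0 + u1" using decomposition[OF u] by blast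
    have U: "u0 \<in> U" "u1 \<in> U" using u01 H_U H'_U by auto
    \<comment> \<open>An artificial solution: (-R u, u) solves the first equation with f = 0, and
      the second right-hand side is chosen to make the second equation hold. This makes the estimate
      of \<open>u1\<close> available for an arbitrary u.\<close>
    have "solves \<kappa> (\<lambda>_. 0) (\<lambda>v. D u v - B v (- R u) / \<kappa>) (- R u) (u0 + u1)"
      using R u \<kappa> u01(3) by (auto simp: solves_def A.bilinear_simps field_simps)
    from B_bounded_H'[OF this u01(1,2), of 0]
    have "nrm u1 \<le> a / \<beta> * nrm (R u)" using R u by (simp add: nrm_minus WU)
    then have "(nrm u1)\<^sup>2 \<le> (a / \<beta>)\<^sup>2 * (nrm (R u))\<^sup>2"
      using nrm_nonneg[OF U(2)] by (simp only: power_mult_distrib[symmetric] power_mono)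
    also have "\<dots> \<le> (a / \<beta>)\<^sup>2 * (A (R u) (R u) / \<alpha>)"
      using A_coercive[OF R(1)[OF u]] pos by (intro mult_left_mono) (auto simp: field_simps)
    finally have 1: "(nrm u1)\<^sup>2 \<le> (a / \<beta>)\<^sup>2 / \<alpha> * A (R u) (R u)" by simp
    \<comment> \<open>Nonnegativity at u + u1 gives D(u - u1) \<le> 2 D(u) + 2 D(u1) for the
      quadratic form, and u - u1 is \<open>u0\<close>.\<close>
    have "0 \<le> D (u + u1) (u + u1)" using u U by (intro D_nonneg) auto
    then have "D (u - u1) (u - u1) \<le> 2 * D u u + 2 * D u1 u1"
      using u U by (simp add: D.bilinear_simps)
    also have "\<dots> \<le> 2 * D u u + 2 * (d * (nrm u1)\<^sup>2)"
      using D_le[OF U(2,2)] by (simp add: power2_eq_square mult.assoc)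
    finally have "\<delta> * (nrm u0)\<^sup>2 \<le> 2 * D u u + 2 * (d * (nrm u1)\<^sup>2)"
      using D_coercive[OF u01(1)] u01(3) by simp
    then have 2: "(nrm u0)\<^sup>2 \<le> 2 / \<delta> * D u u + 2 * d / \<delta> * (nrm u1)\<^sup>2"
      using pos by (simp add: field_simps)
    have "b u u = (nrm u0)\<^sup>2 + (nrm u1)\<^sup>2"
      using U u01 H'_b H'_b' by (simp add: nrm_square bilinear_simps)
    also have "\<dots> \<le> 2 / \<delta> * D u u + (1 + 2 * d / \<delta>) * (nrm u1)\<^sup>2"
      using 2 by (simp add: algebra_simps)
    also have "\<dots> \<le> 2 / \<delta> * D u u + (1 + 2 * d / \<delta>) * ((a / \<beta>)\<^sup>2 / \<alpha> * A (R u) (R u))"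
      using 1 pos by (intro add_left_mono mult_left_mono) auto
    also have "\<dots> = 2 / (\<delta> * \<kappa>) * (\<kappa> * D u u) + (1 + 2 * d / \<delta>) * (a / \<beta>)\<^sup>2 / \<alpha> * A (R u) (R u)"
      using \<kappa> by simp
    also have "\<dots> \<le> p * (\<kappa> * D u u) + p * A (R u) (R u)"
    proof (intro add_mono mult_right_mono)
      show "2 / (\<delta> * \<kappa>) \<le> p" using pos \<kappa> by (simp add: p_def)
      show "(1 + 2 * d / \<delta>) * (a / \<beta>)\<^sup>2 / \<alpha> \<le> p" using pos \<kappa> by (simp add: p_def)
      show "0 \<le> \<kappa> * D u u" using \<kappa> D_nonneg[OF u] by simp
      show "0 \<le> A (R u) (R u)" using A.nonneg[OF R(1)[OF u]] .
    qed
    finally show ?thesis by (simp add: S_def algebra_simps)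
  qed
  have S_le: "S u u \<le> (M\<^sup>2 / \<alpha> + \<kappa> * d) * b u u" if u: "u \<in> U" for u
  proof -
    let ?r = "nrm (R u)"
    have AB: "A (R u) (R u) \<le> M * nrm u * ?r"
      using R[OF u] B_bounded[OF u] by (metis abs_le_D1)
    \<comment> \<open>Young's inequality replaces the division by the norm of \<open>R u\<close>,
      which may vanish; half of the right-hand side is absorbed through \<alpha> |R u|^2 \<le> M |u|
      |R u|.\<close>
    have "0 \<le> (M * nrm u - \<alpha> * ?r)\<^sup>2" by simp
    then have "2 * \<alpha> * (M * nrm u * ?r) \<le> M\<^sup>2 * (nrm u)\<^sup>2 + \<alpha> * (\<alpha> * ?r\<^sup>2)"
      by (simp add: power2_eq_square algebra_simps)
    also have "\<dots> \<le> M\<^sup>2 * (nrm u)\<^sup>2 + \<alpha> * (M * nrm u * ?r)"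
      using A_coercive[OF R(1)[OF u]] AB pos by (intro add_left_mono mult_left_mono) auto
    finally have "\<alpha> * (M * nrm u * ?r) \<le> M\<^sup>2 * (nrm u)\<^sup>2" by (simp add: ac_simps)
    then have "M * nrm u * ?r \<le> M\<^sup>2 / \<alpha> * (nrm u)\<^sup>2" using pos by (simp add: field_simps)
    then have "A (R u) (R u) \<le> M\<^sup>2 / \<alpha> * b u u" using AB nrm_square[OF u] by simp
    moreover have "\<kappa> * D u u \<le> \<kappa> * (d * b u u)"
      using D_le[OF u u] nrm_square[OF u] \<kappa> by (simp add: power2_eq_square mult.assoc)
    ultimately show ?thesis by (simp add: S_def algebra_simps)
  qed
  have "\<exists>u\<in>U. \<forall>v\<in>U. S u v = \<kappa> * g v + B v wf"
  proof (rule lax_milgram_symmetric[OF S_inner])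
    show "0 < 1 / p" using p by simp
    show "1 / p * b v v \<le> S v v" if "v \<in> U" for v using S_ge[OF that] p by (simp add: field_simps)
    show "S v v \<le> (M\<^sup>2 / \<alpha> + \<kappa> * d) * b v v" if "v \<in> U" for v by (rule S_le[OF that])
    show "linear_form_on U (\<lambda>v. \<kappa> * g v + B v wf)"
      using wf(1) by (auto simp: linear_form_on_def linear_form_on_add[OF g(1)]
          linear_form_on_scale[OF g(1)] B_simps algebra_simps)
    show "\<bar>\<kappa> * g v + B v wf\<bar> \<le> (\<kappa> * G + M * nrm wf) * nrm v" if "v \<in> U" for v
    proof -
      have "\<bar>\<kappa> * g v\<bar> \<le> \<kappa> * (G * nrm v)" using g(2)[OF that] \<kappa> by (simp add: abs_mult)
      then show ?thesis using B_bounded[OF that wf(1)] abs_triangle_ineq[of "\<kappa> * g v" "B v wf"]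
        by (simp add: algebra_simps)
    qed
  qed
  then obtain u where u: "u \<in> U" "\<And>v. v \<in> U \<Longrightarrow> S u v = \<kappa> * g v + B v wf" by blast
  have "B v (wf - R u) - \<kappa> * D u v = - \<kappa> * g v" if "v \<in> U" for v
    using u(2)[OF that] S[OF u(1) that] wf(1) R(1)[OF u(1)] that by (simp add: B_simps)
  then have "solves \<kappa> f g (wf - R u) u"
    using u wf R by (auto simp: solves_def A.bilinear_simps)
  then show ?thesis by blast
qed

section \<open>Stability bounds for each component of the data\<close>

lemma stability_f:
  assumes s: "solves \<kappa> f (\<lambda>_. 0) w u" and \<kappa>: "0 < \<kappa>" and f: "f w \<le> F * nrm w" and F: "0 \<le> F"
  shows "nrm w \<le> inverse \<alpha> * F"
proof -
  have "\<alpha> * (nrm w)\<^sup>2 \<le> F * nrm w" using energy_bound[OF s \<kappa>] f by simp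
  from quadratic_bound_homogeneous[OF pos(3) F this] show ?thesis
    using F pos by (simp add: field_simps)
qed

text \<open>As g vanishes on \<open>H\<close>, only \<open>u1\<close> contributes, and with f = 0
  its norm is at most (a/\<beta>) |w|. The energy inequality is then homogeneous in |w|, so no
  square root appears.\<close>

lemma stability_g1:
  assumes s: "solves \<kappa> (\<lambda>_. 0) g w u" and \<kappa>: "0 < \<kappa>" and g: "linear_form_on U g"
    and g0: "\<And>h. h \<in> H \<Longrightarrow> g h = 0" and g1: "\<And>u. u \<in> H' \<Longrightarrow> g u \<le> G1 * nrm u" and G1: "0 \<le> G1"
  shows "nrm w \<le> \<kappa> * inverse \<beta> * (a / \<alpha>) * G1"
proof -
  obtain u0 u1 where u: "u0 \<in> H" "u1 \<in> H'" "u = u0 + u1" using decomposition solvesD(2)[OF s] by blast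
  have "nrm u1 \<le> (0 + a * nrm w) / \<beta>" by (rule B_bounded_H'[OF s[unfolded u(3)] u(1,2)]) auto
  then have "G1 * nrm u1 \<le> G1 * (a * nrm w / \<beta>)" using G1 by (intro mult_left_mono) auto
  moreover have "g u = g u1" using u g0 linear_form_on_add[OF g] H_U H'_U by simp
  ultimately have "g u \<le> G1 * (a * nrm w / \<beta>)" using g1[OF u(2)] by linarith
  then have "\<kappa> * g u \<le> \<kappa> * (G1 * (a * nrm w / \<beta>))" using \<kappa> by (intro mult_left_mono) auto
  then have "\<alpha> * (nrm w)\<^sup>2 \<le> (\<kappa> * (G1 * (a / \<beta>))) * nrm w"
    using energy_bound[OF s \<kappa>] by (simp add: ac_simps)
  from quadratic_bound_homogeneous[OF pos(3) _ this] show ?thesis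
    using G1 pos \<kappa> by (simp add: field_simps)
qed

text \<open>Here g acts through \<open>u0\<close>, whose bound contains G0/\<delta> independently of
  w. With x = |w| the energy inequality becomes \<alpha> x^2 \<le> \<kappa> G0 q_d r_a x + \<kappa>
  G0^2/\<delta>. The factor (\<kappa> G0)^2 can be taken out of the discriminant, and the positive
  root is Q G0.\<close>

lemma stability_g0:
  assumes s: "solves \<kappa> (\<lambda>_. 0) g w u" and \<kappa>: "0 < \<kappa>" and g: "linear_form_on U g"
    and g0: "\<And>h. h \<in> H \<Longrightarrow> g h \<le> G0 * nrm h" and g1: "\<And>u. u \<in> H' \<Longrightarrow> g u = 0" and G0: "0 \<le> G0"
  shows "nrm w \<le> \<kappa> * inverse \<alpha> * (d / \<delta> * (a / \<beta>)
    + sqrt (4 * \<alpha> * inverse (\<kappa> * \<delta>) + (d / \<delta>)\<^sup>2 * (a / \<beta>)\<^sup>2)) / 2 * G0"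
proof -
  obtain u0 u1 where u: "u0 \<in> H" "u1 \<in> H'" "u = u0 + u1" using decomposition solvesD(2)[OF s] by blast
  have "nrm u1 \<le> (0 + a * nrm w) / \<beta>" by (rule B_bounded_H'[OF s[unfolded u(3)] u(1,2)]) auto
  then have "d / \<delta> * nrm u1 \<le> d / \<delta> * (a * nrm w / \<beta>)" using pos by (intro mult_left_mono) auto
  with D_bounded_H[OF s[unfolded u(3)] \<kappa> u(1,2) g0[OF u(1)] G0]
  have "nrm u0 \<le> G0 / \<delta> + d / \<delta> * (a * nrm w / \<beta>)" by linarith
  then have "G0 * nrm u0 \<le> G0 * (G0 / \<delta> + d / \<delta> * (a * nrm w / \<beta>))" using G0 by (intro mult_left_mono) auto
  moreover have "g u = g u0" using u g1 linear_form_on_add[OF g] H_U H'_U by simp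
  ultimately have "g u \<le> G0 * (G0 / \<delta> + d / \<delta> * (a * nrm w / \<beta>))" using g0[OF u(1)] by linarith
  then have "\<kappa> * g u \<le> \<kappa> * (G0 * (G0 / \<delta> + d / \<delta> * (a * nrm w / \<beta>)))" using \<kappa> by simp
  then have "\<alpha> * (nrm w)\<^sup>2 \<le> (\<kappa> * G0 * (d / \<delta> * (a / \<beta>))) * nrm w + \<kappa> * G0\<^sup>2 / \<delta>"
    using energy_bound[OF s \<kappa>] by (simp add: power2_eq_square algebra_simps)
  from quadratic_bound[OF pos(3) this]
  have "nrm w \<le> (\<kappa> * G0 * (d / \<delta> * (a / \<beta>))
      + sqrt ((\<kappa> * G0 * (d / \<delta> * (a / \<beta>)))\<^sup>2 + 4 * \<alpha> * (\<kappa> * G0\<^sup>2 / \<delta>))) / (2 * \<alpha>)" .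
  also have "(\<kappa> * G0 * (d / \<delta> * (a / \<beta>)))\<^sup>2 + 4 * \<alpha> * (\<kappa> * G0\<^sup>2 / \<delta>)
      = (\<kappa> * G0)\<^sup>2 * (4 * \<alpha> * inverse (\<kappa> * \<delta>) + (d / \<delta>)\<^sup>2 * (a / \<beta>)\<^sup>2)"
    using \<kappa> pos by (simp add: field_simps power2_eq_square)
  also have "sqrt \<dots> = \<kappa> * G0 * sqrt (4 * \<alpha> * inverse (\<kappa> * \<delta>) + (d / \<delta>)\<^sup>2 * (a / \<beta>)\<^sup>2)"
    using \<kappa> G0 by (simp add: real_sqrt_mult)
  finally show ?thesis by (simp add: inverse_eq_divide algebra_simps add_divide_distrib)
qed

text \<open>The bound on \<open>w\<close> superposes the solutions for \<open>f\<close> and for the restrictions of \<open>g\<close> to \<open>H\<close> and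
  to its complement; estimating all contributions at once would leave mixed terms.\<close>

theorem stability_w:
  assumes s: "solves \<kappa> f g w u" and \<kappa>: "0 < \<kappa>"
    and f: "linear_form_on W f" "\<And>w. w \<in> W \<Longrightarrow> \<bar>f w\<bar> \<le> F * nrm w"
    and g: "linear_form_on U g" "\<And>u. u \<in> U \<Longrightarrow> \<bar>g u\<bar> \<le> G * nrm u"
    and g0: "\<And>h. h \<in> H \<Longrightarrow> \<bar>g h\<bar> \<le> G0 * nrm h" and g1: "\<And>u. u \<in> H' \<Longrightarrow> \<bar>g u\<bar> \<le> G1 * nrm u"
    and nonneg: "0 \<le> F" "0 \<le> G0" "0 \<le> G1"
  shows "nrm w \<le> inverse \<alpha> * F + \<kappa> * inverse \<alpha> * (d / \<delta> * (a / \<beta>)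
    + sqrt (4 * \<alpha> * inverse (\<kappa> * \<delta>) + (d / \<delta>)\<^sup>2 * (a / \<beta>)\<^sup>2)) / 2 * G0
    + \<kappa> * inverse \<beta> * (a / \<alpha>) * G1"
proof -
  \<comment> \<open>Splitting the Riesz representative of g splits g itself: \<open>b y0\<close>
    agrees with g on \<open>H\<close> and vanishes on \<open>H'\<close>, and conversely for
    \<open>b y1\<close>.\<close>
  obtain y where y: "y \<in> U" "\<And>u. u \<in> U \<Longrightarrow> b y u = g u" using riesz[OF g] by blast
  obtain y0 y1 where y01: "y0 \<in> H" "y1 \<in> H'" "y = y0 + y1" using decomposition[OF y(1)] by blast
  have U: "y0 \<in> U" "y1 \<in> U" using y01 H_U H'_U by auto
  have g_eq: "b y0 u + b y1 u = g u" if "u \<in> U" for u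
    using y(2)[OF that] U that y01(3) by (simp add: bilinear_simps)
  have gH: "b y0 h = g h" "b y1 h = 0" if "h \<in> H" for h
    using g_eq[of h] H'_b[OF y01(2)] that H_U by auto
  have gH': "b y1 u = g u" "b y0 u = 0" if "u \<in> H'" for u
    using g_eq[of u] H'_b'[OF that y01(1)] that H'_U by auto
  have zero: "linear_form_on W (\<lambda>_. 0)" "linear_form_on U (\<lambda>_. 0)" by (auto simp: linear_form_on_def)
  obtain wf uf where wf: "solves \<kappa> f (\<lambda>_. 0) wf uf"
    using solution_exists[OF \<kappa> f zero(2), of 0] by auto
  obtain w0 u0 where w0: "solves \<kappa> (\<lambda>_. 0) (b y0) w0 u0"
    using solution_exists[OF \<kappa> zero(1) _ linear[OF U(1)] cauchy_schwarz[OF U(1)], of 0] by auto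
  obtain w1 u1 where w1: "solves \<kappa> (\<lambda>_. 0) (b y1) w1 u1"
    using solution_exists[OF \<kappa> zero(1) _ linear[OF U(2)] cauchy_schwarz[OF U(2)], of 0] by auto
  have "solves \<kappa> f g (wf + w0 + w1) (uf + u0 + u1)"
    using solves_add[OF solves_add[OF wf w0] w1] g_eq by (auto simp: solves_def)
  then have "nrm (w - (wf + w0 + w1)) = 0" using solution_unique(1)[OF s _ \<kappa>] by blast
  moreover have W: "w \<in> U" "wf \<in> U" "w0 \<in> U" "w1 \<in> U"
    using solvesD(1) s wf w0 w1 WU by blast+
  ultimately have "nrm w \<le> nrm (wf + w0 + w1)"
    using nrm_triangle[of "w - (wf + w0 + w1)" "wf + w0 + w1"] by simp
  also have "\<dots> \<le> nrm wf + nrm w0 + nrm w1"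
    using nrm_triangle[of "wf + w0" w1] nrm_triangle[of wf w0] W by simp
  also have "\<dots> \<le> inverse \<alpha> * F + \<kappa> * inverse \<alpha> * (d / \<delta> * (a / \<beta>)
    + sqrt (4 * \<alpha> * inverse (\<kappa> * \<delta>) + (d / \<delta>)\<^sup>2 * (a / \<beta>)\<^sup>2)) / 2 * G0
    + \<kappa> * inverse \<beta> * (a / \<alpha>) * G1"
  proof (intro add_mono)
    show "nrm wf \<le> inverse \<alpha> * F"
      using f(2)[OF solvesD(1)[OF wf]] nonneg by (intro stability_f[OF wf \<kappa>]) auto
    show "nrm w1 \<le> \<kappa> * inverse \<beta> * (a / \<alpha>) * G1"
      using gH(2) gH'(1) g1 nonneg by (intro stability_g1[OF w1 \<kappa> linear[OF U(2)]]) fastforce+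
    show "nrm w0 \<le> \<kappa> * inverse \<alpha> * (d / \<delta> * (a / \<beta>)
      + sqrt (4 * \<alpha> * inverse (\<kappa> * \<delta>) + (d / \<delta>)\<^sup>2 * (a / \<beta>)\<^sup>2)) / 2 * G0"
      using gH(1) gH'(2) g0 nonneg by (intro stability_g0[OF w0 \<kappa> linear[OF U(1)]]) fastforce+
  qed
  finally show ?thesis .
qed

text \<open>The bound on \<open>w\<close> is substituted into that on \<open>u1\<close>, and this
  one into that on \<open>u0\<close>. The factor 1 + q_a arises from F + a F/\<alpha>.\<close>

corollary stability:
  assumes s: "solves \<kappa> f g w u" and \<kappa>: "0 < \<kappa>"
    and f: "linear_form_on W f" "\<forall>w\<in>W. \<bar>f w\<bar> \<le> F * nrm w"
    and g: "linear_form_on U g" "\<forall>u\<in>U. \<bar>g u\<bar> \<le> G * nrm u"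
    and g0: "\<forall>h\<in>H. \<bar>g h\<bar> \<le> G0 * nrm h" and g1: "\<forall>u\<in>H'. \<bar>g u\<bar> \<le> G1 * nrm u"
    and nonneg: "0 \<le> F" "0 \<le> G0" "0 \<le> G1"
    and Q: "Q = \<kappa> * inverse \<alpha> * (d / \<delta> * (a / \<beta>)
      + sqrt (4 * \<alpha> * inverse (\<kappa> * \<delta>) + (d / \<delta>)\<^sup>2 * (a / \<beta>)\<^sup>2)) / 2"
    and u: "u0 \<in> H" "u1 \<in> H'" "nrm (u - (u0 + u1)) = 0"
  shows "nrm w \<le> inverse \<alpha> * F + Q * G0 + \<kappa> * inverse \<beta> * (a / \<alpha>) * G1" (is "_ \<le> ?w")
    and "nrm u0 \<le> inverse \<beta> * (d / \<delta>) * (1 + a / \<alpha>) * F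
      + (inverse \<delta> + d / \<delta> * (a / \<beta>) * Q) * G0
      + \<kappa> * inverse \<beta> * (a / \<alpha>) * (d / \<delta>) * (a / \<beta>) * G1" (is "_ \<le> ?u0")
    and "nrm u1 \<le> inverse \<beta> * (1 + a / \<alpha>) * F + a / \<beta> * Q * G0
      + \<kappa> * inverse \<beta> * (a / \<alpha>) * (a / \<beta>) * G1" (is "_ \<le> ?u1")
    and "nrm u \<le> nrm u0 + nrm u1"
proof -
  have U: "u0 \<in> U" "u1 \<in> U" using u H_U H'_U by auto
  have s': "solves \<kappa> f g w (u0 + u1)" using U by (intro solves_null[OF s _ u(3)]) auto
  show w: "nrm w \<le> ?w" unfolding Q using f g g0 g1 by (intro stability_w[OF s \<kappa> _ _ _ _ _ _ nonneg]) auto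
  have "nrm u1 \<le> (F + a * nrm w) / \<beta>"
    using f(2) nonneg by (intro B_bounded_H'[OF s' u(1,2)]) (auto dest: abs_le_D1)
  also have "\<dots> \<le> (F + a * ?w) / \<beta>" using w pos by (intro divide_right_mono add_left_mono mult_left_mono) auto
  also have "\<dots> = ?u1" by (simp add: divide_inverse algebra_simps)
  finally show u1: "nrm u1 \<le> ?u1" .
  have "nrm u0 \<le> G0 / \<delta> + d / \<delta> * nrm u1"
    using bspec[OF g0 u(1)] nonneg by (intro D_bounded_H[OF s' \<kappa> u(1,2)]) auto
  also have "\<dots> \<le> G0 / \<delta> + d / \<delta> * ?u1" using u1 pos by (intro add_left_mono mult_left_mono) auto
  also have "\<dots> = ?u0" by (simp add: divide_inverse algebra_simps)
  finally show "nrm u0 \<le> ?u0" .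
  have "nrm u \<le> nrm (u - (u0 + u1)) + nrm (u0 + u1)"
    using nrm_triangle[of "u - (u0 + u1)" "u0 + u1"] solvesD(2)[OF s] U by simp
  then show "nrm u \<le> nrm u0 + nrm u1" using nrm_triangle[OF U] u(3) by simp
qed

end

section \<open>The fundamental lemma of the calculus of variations\<close>

lemma partial_derivativeI: "(f has_derivative f') (at x) \<Longrightarrow> partial_derivative j f x = f' (axis j 1)"
  by (simp add: partial_derivative_def frechet_derivative_at[symmetric])

lemma differentiable_has_frechet_derivative:
  "f differentiable (at x) \<Longrightarrow> (f has_derivative frechet_derivative f (at x)) (at x)"
  by (simp add: frechet_derivative_works)

lemma partial_derivative_add:
  assumes "f differentiable (at x)" "g differentiable (at x)"
  shows "partial_derivative j (\<lambda>x. f x + g x) x = partial_derivative j f x + partial_derivative j g x"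
  using partial_derivativeI[OF has_derivative_add[OF assms[THEN differentiable_has_frechet_derivative]]]
  by (simp add: partial_derivative_def)

lemma partial_derivative_mult:
  assumes "f differentiable (at x)" "g differentiable (at x)"
  shows "partial_derivative j (\<lambda>x. f x * g x) x = f x * partial_derivative j g x + partial_derivative j f x * g x"
  using partial_derivativeI[OF has_derivative_mult[OF assms[THEN differentiable_has_frechet_derivative]]]
  by (simp add: partial_derivative_def)

lemma partial_derivative_const [simp]: "partial_derivative j (\<lambda>x. c) x = 0"
  by (rule partial_derivativeI[OF has_derivative_const])

lemma times_differentiable_imp_continuous:
  "times_differentiable k f \<Longrightarrow> continuous_on UNIV f"
  by (cases k) (auto intro!: differentiable_imp_continuous_on simp: differentiable_on_def
      differentiable_at_withinI)

lemma times_differentiable_Suc_imp: "times_differentiable (Suc k) f \<Longrightarrow> times_differentiable k f"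
proof (induction k arbitrary: f)
  case 0
  then show ?case using times_differentiable_imp_continuous[of "Suc 0" f] by simp
next
  case (Suc k)
  then show ?case by (metis times_differentiable.simps(2))
qed

lemma times_differentiable_const: "times_differentiable k (\<lambda>x. c)"
proof (induction k arbitrary: c)
  case (Suc k)
  have "partial_derivative j (\<lambda>x. c) = (\<lambda>x. 0)" for j :: 'a by (simp add: fun_eq_iff)
  then show ?case using Suc by simp
qed simp

lemma times_differentiable_add:
  "times_differentiable k f \<Longrightarrow> times_differentiable k g \<Longrightarrow> times_differentiable k (\<lambda>x. f x + g x)"
proof (induction k arbitrary: f g)
  case (Suc k)
  then have "partial_derivative j (\<lambda>x. f x + g x) = (\<lambda>x. partial_derivative j f x + partial_derivative j g x)" for j
    by (simp add: fun_eq_iff partial_derivative_add)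
  with Suc show ?case by simp
qed (simp add: continuous_on_add)

lemma times_differentiable_mult:
  "times_differentiable k f \<Longrightarrow> times_differentiable k g \<Longrightarrow> times_differentiable k (\<lambda>x. f x * g x)"
proof (induction k arbitrary: f g)
  case (Suc k)
  then have "partial_derivative j (\<lambda>x. f x * g x)
      = (\<lambda>x. f x * partial_derivative j g x + partial_derivative j f x * g x)" for j
    by (simp add: fun_eq_iff partial_derivative_mult)
  moreover have "times_differentiable k f" "times_differentiable k g"
    using Suc.prems times_differentiable_Suc_imp by auto
  ultimately show ?case using Suc by (auto intro!: times_differentiable_add)
qed (simp add: continuous_on_mult)

lemma smooth_const: "smooth (\<lambda>x. c)"
  by (simp add: smooth_def times_differentiable_const)

lemma smooth_add: "smooth f \<Longrightarrow> smooth g \<Longrightarrow> smooth (\<lambda>x. f x + g x)"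
  by (simp add: smooth_def times_differentiable_add)

lemma smooth_mult: "smooth f \<Longrightarrow> smooth g \<Longrightarrow> smooth (\<lambda>x. f x * g x)"
  by (simp add: smooth_def times_differentiable_mult)

lemma smooth_prod: "finite I \<Longrightarrow> (\<And>i. i \<in> I \<Longrightarrow> smooth (f i)) \<Longrightarrow> smooth (\<lambda>x. \<Prod>i\<in>I. f i x)"
  by (induction I rule: finite_induct) (auto intro: smooth_const smooth_mult)

lemma smooth_imp_continuous: "smooth f \<Longrightarrow> continuous_on UNIV f"
  using times_differentiable_imp_continuous smooth_def by blast

lemma smooth_partial_derivative: "smooth f \<Longrightarrow> smooth (partial_derivative j f)"
  unfolding smooth_def by (metis times_differentiable.simps(2))

text \<open>\<open>flat 0\<close> is the classical function e^{-1/t} extended by zero. The powers of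
  1/t are included because the derivatives of \<open>flat 0\<close> are combinations of such
  functions, which makes smoothness an induction over a closed family.\<close>

definition flat :: "nat \<Rightarrow> real \<Rightarrow> real" where
  "flat m t = (if 0 < t then inverse t ^ m * exp (- inverse t) else 0)"

lemma flat_tendsto_0: "(flat m \<longlongrightarrow> 0) (at 0)"
proof -
  have "((\<lambda>t::real. inverse t ^ m / exp (inverse t)) \<longlongrightarrow> 0) (at_right 0)"
    by (rule filterlim_compose[OF tendsto_power_div_exp_0 filterlim_inverse_at_top_right])
  then have "(flat m \<longlongrightarrow> 0) (at_right 0)"
    by (rule Lim_transform_eventually) (auto simp: eventually_at_right_less flat_def exp_minus field_simps
        intro: eventually_at_rightI[of 0 1])
  moreover have "(flat m \<longlongrightarrow> 0) (at_left 0)"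
    by (rule Lim_transform_eventually[OF tendsto_const])
      (auto simp: flat_def eventually_at_left intro!: eventually_at_leftI[of "-1" 0])
  ultimately show ?thesis by (simp add: filterlim_at_split)
qed

lemma flat_has_derivative:
  "(flat m has_real_derivative (- real m * flat (Suc m) t + flat (Suc (Suc m)) t)) (at t)"
proof -
  consider "t < 0" | "t = 0" | "0 < t" by linarith
  then show ?thesis
  proof cases
    case 1
    have "((\<lambda>_. 0) has_real_derivative 0) (at t)" by simp
    then have "(flat m has_real_derivative 0) (at t)"
      by (rule has_field_derivative_transform_within_open[of _ _ _ "{..<0}"]) (use 1 in \<open>auto simp: flat_def\<close>)
    then show ?thesis using 1 by (simp add: flat_def)
  next
    case 2
    \<comment> \<open>The difference quotient at 0 is \<open>flat (Suc m)\<close>, so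
      differentiability there is again decay at 0.\<close>
    have "((\<lambda>h. flat m h / h) \<longlongrightarrow> 0) (at 0)"
      by (rule Lim_transform_eventually[OF flat_tendsto_0[of "Suc m"]])
        (auto simp: flat_def field_simps eventually_at_filter)
    then show ?thesis using 2 by (simp add: DERIV_def flat_def)
  next
    case 3
    have "((\<lambda>t. inverse t ^ m * exp (- inverse t)) has_real_derivative
        (- real m * flat (Suc m) t + flat (Suc (Suc m)) t)) (at t)"
      using 3 by (auto intro!: derivative_eq_intros simp: flat_def)
        (cases m; simp add: field_simps power2_eq_square)
    then show ?thesis
      by (rule has_field_derivative_transform_within_open[of _ _ _ "{0<..}"]) (use 3 in \<open>auto simp: flat_def\<close>)
  qed
qed

lemma flat_affine_has_derivative:
  fixes i :: "'n::finite"
  shows "((\<lambda>x. flat m (c * x $ i + r)) has_derivative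
     (\<lambda>h. c * h $ i * (- real m * flat (Suc m) (c * x $ i + r) + flat (Suc (Suc m)) (c * x $ i + r))))
     (at (x :: real^'n))"
proof -
  have "((\<lambda>x. c * x $ i + r) has_derivative (\<lambda>h. c * h $ i)) (at x)"
    by (auto intro!: derivative_eq_intros bounded_linear.has_derivative[OF bounded_linear_vec_nth])
  from has_derivative_compose[OF this flat_has_derivative[of m, unfolded has_field_derivative_def]]
  show ?thesis by (simp add: mult.commute)
qed

text \<open>The induction must be general in m, since differentiating raises it by one and by
  two.\<close>

lemma smooth_flat_affine: "smooth (\<lambda>x :: real^'n. flat m (c * x $ i + r))"
proof -
  have "times_differentiable k (\<lambda>x :: real^'n. flat m (c * x $ i + r))" for k
  proof (induction k arbitrary: m)
    case 0
    have "isCont (\<lambda>x. flat m (c * x $ i + r)) x" for x :: "real^'n"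
      by (rule has_derivative_continuous[OF flat_affine_has_derivative])
    then show ?case by (simp add: continuous_at_imp_continuous_on)
  next
    case (Suc k)
    have "partial_derivative j (\<lambda>x :: real^'n. flat m (c * x $ i + r)) =
        (\<lambda>x. c * axis j 1 $ i * (- real m) * flat (Suc m) (c * x $ i + r)
           + c * axis j 1 $ i * flat (Suc (Suc m)) (c * x $ i + r))" for j
      by (rule ext, subst partial_derivativeI[OF flat_affine_has_derivative]) (simp add: algebra_simps)
    note eq = this
    have "(\<lambda>x. flat m (c * x $ i + r)) differentiable (at x)" for x :: "real^'n"
      using flat_affine_has_derivative differentiable_def by blast
    then show ?case unfolding times_differentiable.simps eq
      by (intro conjI allI times_differentiable_add times_differentiable_mult times_differentiable_const Suc)
  qed
  then show ?thesis by (simp add: smooth_def)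
qed

text \<open>Each face of the box contributes one factor e^{-1/(m s)}, where s is the signed distance
  to it, replaced by 0 for s \<le> 0. Large m steepens the profile, so the bumps tend to the
  indicator of the open box; the affine arguments are written out to match
  \<open>smooth_flat_affine\<close>.\<close>

definition box_bump :: "real^'n \<Rightarrow> real^'n \<Rightarrow> nat \<Rightarrow> real^'n \<Rightarrow> real" where
  "box_bump a b m x =
     (\<Prod>i\<in>UNIV. flat 0 (real m * x $ i + - real m * a $ i) * flat 0 (- real m * x $ i + real m * b $ i))"

lemma flat_0_bounds: "0 \<le> flat 0 t" "flat 0 t \<le> 1"
  by (auto simp: flat_def)

lemma box_bump_bounds: "0 \<le> box_bump a b m x" "box_bump a b m x \<le> 1"
  by (auto simp: box_bump_def intro!: prod_nonneg prod_le_1 mult_nonneg_nonneg mult_le_one flat_0_bounds)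

lemma box_bump_outside:
  assumes "x \<notin> box a b"
  shows "box_bump a b m x = 0"
proof -
  obtain i where "x $ i \<le> a $ i \<or> b $ i \<le> x $ i" using assms by (auto simp: mem_box_cart not_less)
  then have "flat 0 (real m * x $ i + - real m * a $ i) * flat 0 (- real m * x $ i + real m * b $ i) = 0"
    using mult_left_mono[of "x $ i" "a $ i" "real m"] mult_left_mono[of "b $ i" "x $ i" "real m"]
    by (auto simp: flat_def)
  then show ?thesis unfolding box_bump_def by (intro prod_zero) auto
qed

lemma box_bump_tendsto: "(\<lambda>m. box_bump a b m x) \<longlonglongrightarrow> indicator (box a b) x"
proof (cases "x \<in> box a b")
  case True
  have *: "(\<lambda>m. flat 0 (real m * s)) \<longlonglongrightarrow> 1" if "0 < s" for s :: real
  proof -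
    have "(\<lambda>m. exp (- (inverse (real m) * inverse s))) \<longlonglongrightarrow> exp (- (0 * inverse s))"
      by (intro tendsto_intros lim_inverse_n)
    then have "(\<lambda>m. exp (- (inverse (real m) * inverse s))) \<longlonglongrightarrow> 1" by simp
    then show ?thesis
      by (rule Lim_transform_eventually)
        (use that in \<open>auto simp: flat_def eventually_sequentially intro!: exI[of _ 1]\<close>)
  qed
  have eq: "flat 0 (real m * x $ i + - real m * a $ i) = flat 0 (real m * (x $ i - a $ i))"
    "flat 0 (- real m * x $ i + real m * b $ i) = flat 0 (real m * (b $ i - x $ i))" for m i
    by (simp_all add: algebra_simps)
  have "(\<lambda>m. box_bump a b m x) \<longlonglongrightarrow> (\<Prod>i\<in>(UNIV :: 'a set). 1 * 1)"
    unfolding box_bump_def eq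
    by (intro tendsto_prod tendsto_mult *) (use True in \<open>auto simp: mem_box_cart\<close>)
  then show ?thesis using True by simp
qed (simp add: box_bump_outside)

lemma test_function_box_bump: "cbox a b \<subseteq> \<Omega> \<Longrightarrow> test_function \<Omega> (box_bump a b m)"
  unfolding test_function_def
proof (intro conjI exI[of _ "cbox a b"] allI impI)
  show "smooth (box_bump a b m)" unfolding box_bump_def[abs_def]
    by (intro smooth_prod smooth_mult smooth_flat_affine) auto
qed (auto intro: box_bump_outside simp: box_subset_cbox[THEN subsetD])

lemma continuous_borel_measurable_lebesgue_on:
  "continuous_on UNIV f \<Longrightarrow> f \<in> borel_measurable (lebesgue_on S)"
  by (intro measurable_restrict_space1 measurable_completion) (simp add: borel_measurable_continuous_onI)

text \<open>Boxes form an intersection-stable generator of the Borel sets, so vanishing integrals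
  extend from boxes to all Borel sets by Dynkin induction, and a density with vanishing integrals is
  zero. Cutting k off outside one box gives the total integral zero that complements
  require.\<close>

lemma borel_integral_zero_if_zero_on_boxes:
  fixes k :: "real^'n \<Rightarrow> real"
  assumes k: "integrable lborel k"
    and box: "\<And>c d. cbox c d \<subseteq> cbox a b \<Longrightarrow> (LINT x:box c d|lborel. k x) = 0"
  shows "AE x in lborel. x \<in> box a b \<longrightarrow> k x = 0"
proof -
  define f where "f x = indicat_real (box a b) x *\<^sub>R k x" for x
  have f: "integrable lborel f" unfolding f_def by (intro integrable_mult_indicator k) auto
  have f_set: "integrable lborel (\<lambda>x. indicat_real A x *\<^sub>R f x)" if "A \<in> sets borel" for A
    using that by (intro integrable_mult_indicator f) auto
  let ?E = "range (\<lambda>(a, b). box a b :: (real^'n) set)"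
  have E: "sigma_sets UNIV ?E = sets borel" by (simp add: borel_eq_box)
  have box_eq: "(LINT x:box c d|lborel. f x) = 0" for c d
  proof -
    have "\<exists>c' d'. box c d \<inter> box a b = box c' d' \<and> cbox c' d' \<subseteq> cbox a b"
      by (intro exI conjI, rule box_Int_box) (simp flip: Int_interval)
    then obtain c' d' where *: "box c d \<inter> box a b = box c' d'" "cbox c' d' \<subseteq> cbox a b" by blast
    have "(LINT x:box c d|lborel. f x) = (LINT x:box c' d'|lborel. k x)"
      unfolding set_lebesgue_integral_def f_def *(1)[symmetric] by (simp add: indicator_inter_arith mult.assoc)
    then show ?thesis using box[OF *(2)] by simp
  qed
  have total: "(LINT x|lborel. f x) = 0"
    using box_eq[of a b] by (simp add: set_lebesgue_integral_def f_def flip: mult.assoc indicator_inter_arith)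
  have "(LINT x:A|lborel. f x) = 0" if "A \<in> sets lborel" for A
  proof -
    have st: "Int_stable ?E" by (auto simp: Int_stable_def box_Int_box)
    have "?E \<subseteq> Pow UNIV" "A \<in> sigma_sets UNIV ?E" using that E by simp_all
    with st show ?thesis
    proof (induction A rule: sigma_sets_induct_disjoint)
      case (basic A)
      then show ?case using box_eq by auto
    next
      case (compl A)
      then have A: "A \<in> sets borel" using E by simp
      have "(LINT x:UNIV - A|lborel. f x) = (LINT x|lborel. f x - indicat_real A x *\<^sub>R f x)"
        unfolding set_lebesgue_integral_def
        by (intro Bochner_Integration.integral_cong) (auto simp: indicator_def)
      also have "\<dots> = 0"
        using compl(2) total f f_set[OF A] by (simp add: set_lebesgue_integral_def)
      finally show ?case .
    next
      case (union A)
      then have A: "A i \<in> sets borel" for i using E by auto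
      have "(LINT x:(\<Union>i. A i)|lborel. f x) = (\<Sum>i. LINT x:A i|lborel. f x)"
      proof (rule lebesgue_integral_countable_add)
        show "A i \<inter> A j = {}" if "i \<noteq> j" for i j using union(1) that by (auto simp: disjoint_family_on_def)
        show "set_integrable lborel (\<Union>i. A i) f" unfolding set_integrable_def using A by (intro f_set) auto
      qed (use A in auto)
      then show ?case using union(3) by simp
    qed (auto simp: set_lebesgue_integral_def)
  qed
  then have "AE x in lborel. f x = 0"
    using density_unique_real[OF f integrable_zero] by (simp add: set_lebesgue_integral_def)
  then show ?thesis by eventually_elim (auto simp: f_def indicator_def split: if_splits)
qed

theorem fundamental_lemma_calculus_of_variations:
  fixes h :: "real^'n \<Rightarrow> real"
  assumes \<Omega>: "open \<Omega>" and h: "integrable (lebesgue_on \<Omega>) h"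
    and zero: "\<And>\<phi>. test_function \<Omega> \<phi> \<Longrightarrow> (LINT x|lebesgue_on \<Omega>. h x * \<phi> x) = 0"
  shows "AE x in lebesgue_on \<Omega>. h x = 0"
proof -
  have \<Omega>_sets: "\<Omega> \<inter> space lebesgue \<in> sets lebesgue" using \<Omega> by auto
  define k where "k x = indicat_real \<Omega> x *\<^sub>R h x" for x
  have k: "integrable lebesgue k" using h unfolding k_def integrable_restrict_space[OF \<Omega>_sets] .
  \<comment> \<open>Dynkin induction works with Borel sets, whereas h is only Lebesgue measurable;
    hence a Borel version of its extension by zero.\<close>
  obtain k' where k': "k' \<in> borel_measurable lborel" "AE x in lborel. k x = k' x"
    using completion_ex_borel_measurable_real[of k lborel] k by auto
  have [measurable]: "k' \<in> borel_measurable borel" using k'(1) by simp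
  have k'_leb: "k' \<in> borel_measurable lebesgue" using k'(1) by (intro measurable_completion)
  have kk': "AE x in lebesgue. k x = k' x" using k'(2) by (rule AE_completion)
  have "integrable lebesgue k'"
    using integrable_cong_AE_imp[OF k k'_leb] kk' by auto
  then have k'_int: "integrable lborel k'" using integrable_completion[OF k'(1)] by simp
  have zero': "(LINT x|lborel. k' x * \<phi> x) = 0" if \<phi>: "test_function \<Omega> \<phi>" for \<phi>
  proof -
    have "continuous_on UNIV \<phi>" using \<phi> smooth_imp_continuous by (auto simp: test_function_def)
    then have [measurable]: "\<phi> \<in> borel_measurable borel" by (rule borel_measurable_continuous_onI)
    have m: "\<phi> \<in> borel_measurable lebesgue" by (intro measurable_completion) simp
    have "(LINT x|lborel. k' x * \<phi> x) = (LINT x|lebesgue. k' x * \<phi> x)"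
      by (intro integral_completion[symmetric]) simp
    also have "\<dots> = (LINT x|lebesgue. k x * \<phi> x)"
      using kk' m k k'_leb by (intro integral_cong_AE borel_measurable_times) auto
    also have "\<dots> = (LINT x|lebesgue_on \<Omega>. h x * \<phi> x)"
      unfolding integral_restrict_space[OF \<Omega>_sets] k_def by (simp add: mult.assoc)
    finally show ?thesis using zero[OF \<phi>] by simp
  qed
  \<comment> \<open>The bumps are admissible test functions, they tend to the indicator and are
    bounded by 1, so |k'| dominates the integrands.\<close>
  have box: "(LINT x:box a b|lborel. k' x) = 0" if ab: "cbox a b \<subseteq> \<Omega>" for a b
  proof -
    have [measurable]: "box_bump a b m \<in> borel_measurable borel" for m
      using test_function_box_bump[OF ab, of m]
      by (auto simp: test_function_def intro!: borel_measurable_continuous_onI dest: smooth_imp_continuous)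
    have "(\<lambda>m. LINT x|lborel. k' x * box_bump a b m x) \<longlonglongrightarrow> (LINT x|lborel. k' x * indicat_real (box a b) x)"
    proof (rule integral_dominated_convergence[where w = "\<lambda>x. norm (k' x)"])
      show "(\<lambda>x. k' x * box_bump a b m x) \<in> borel_measurable lborel" for m
        by simp
      show "AE x in lborel. norm (k' x * box_bump a b m x) \<le> norm (k' x)" for m
        using box_bump_bounds[of a b m] by (auto simp: abs_mult mult_left_le)
      show "AE x in lborel. (\<lambda>m. k' x * box_bump a b m x) \<longlonglongrightarrow> k' x * indicat_real (box a b) x"
        by (intro always_eventually allI tendsto_mult_left box_bump_tendsto)
    qed (use k'(1) k'_int in auto)
    then have "(\<lambda>m. 0) \<longlonglongrightarrow> (LINT x|lborel. k' x * indicat_real (box a b) x)"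
      using zero'[OF test_function_box_bump[OF ab]] by simp
    then show ?thesis by (simp add: set_lebesgue_integral_def mult.commute LIMSEQ_const_iff)
  qed
  \<comment> \<open>Countably many closed boxes exhaust \<Omega>; the faces left out by the open
    boxes are negligible.\<close>
  obtain \<D> where \<D>: "countable \<D>" "\<D> \<subseteq> Pow \<Omega>" "\<And>X. X \<in> \<D> \<Longrightarrow> \<exists>a b. X = cbox a b" "\<Union>\<D> = \<Omega>"
    using open_countable_Union_open_cbox[OF \<Omega>] by metis
  have "AE x in lebesgue. x \<in> X \<longrightarrow> k' x = 0" if X: "X \<in> \<D>" for X
  proof -
    obtain a b where ab: "X = cbox a b" using \<D>(3)[OF X] by blast
    then have sub: "cbox a b \<subseteq> \<Omega>" using \<D>(2) X by blast
    have "AE x in lebesgue. x \<in> box a b \<longrightarrow> k' x = 0"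
      by (intro AE_completion borel_integral_zero_if_zero_on_boxes[OF k'_int] box) (use sub in blast)
    moreover have "AE x in lebesgue. x \<notin> cbox a b - box a b"
      using negligible_frontier_interval[of a b] by (intro AE_not_in) (simp add: negligible_iff_null_sets)
    ultimately show ?thesis by eventually_elim (auto simp: ab)
  qed
  then have "AE x in lebesgue. \<forall>X\<in>\<D>. x \<in> X \<longrightarrow> k' x = 0" unfolding AE_ball_countable[OF \<D>(1)] by blast
  then have "AE x in lebesgue. x \<in> \<Omega> \<longrightarrow> h x = 0"
    using kk'
  proof eventually_elim
    case (elim x)
    show ?case
    proof
      assume x: "x \<in> \<Omega>"
      then have "k' x = 0" using elim(1) \<D>(4) by blast
      then show "h x = 0" using elim(2) x by (simp add: k_def)
    qed
  qed
  then show ?thesis using AE_restrict_space_iff[OF \<Omega>_sets] by simp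
qed

section \<open>Completeness of L2\<close>

text \<open>With pointwise scaling, fields form a real vector space on which the abstract locales
  can be interpreted without passing to equivalence classes.\<close>

instantiation "fun" :: (type, real_vector) real_vector
begin

definition "scaleR c f = (\<lambda>x. c *\<^sub>R f x)"

instance
  by standard (simp_all add: scaleR_fun_def fun_eq_iff scaleR_add_right scaleR_add_left)

end

lemma scaleR_fun_apply [simp]: "(c *\<^sub>R f) x = c *\<^sub>R f x"
  by (simp add: scaleR_fun_def)

definition l2_inner :: "'a measure \<Rightarrow> ('a \<Rightarrow> 'b::euclidean_space) \<Rightarrow> ('a \<Rightarrow> 'b) \<Rightarrow> real" where
  "l2_inner M f g = (\<integral>x. f x \<bullet> g x \<partial>M)"

lemma square_integrable_measurable [measurable_dest]: "square_integrable M f \<Longrightarrow> f \<in> borel_measurable M"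
  by (simp add: square_integrable_def)

lemma square_integrable_bound:
  assumes "square_integrable M f" "g \<in> borel_measurable M" "AE x in M. norm (g x) \<le> c * norm (f x)"
  shows "square_integrable M g"
  unfolding square_integrable_def
proof
  show "integrable M (\<lambda>x. (norm (g x))\<^sup>2)"
  proof (rule Bochner_Integration.integrable_bound)
    show "integrable M (\<lambda>x. c\<^sup>2 * (norm (f x))\<^sup>2)" using assms(1) by (simp add: square_integrable_def)
    show "(\<lambda>x. (norm (g x))\<^sup>2) \<in> borel_measurable M" using assms(2) by simp
    show "AE x in M. norm ((norm (g x))\<^sup>2) \<le> norm (c\<^sup>2 * (norm (f x))\<^sup>2)"
      using assms(3)
    proof eventually_elim
      case (elim x)
      then have "(norm (g x))\<^sup>2 \<le> (c * norm (f x))\<^sup>2" by (intro power_mono) auto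
      then show ?case by (simp add: power_mult_distrib)
    qed
  qed
qed fact

lemma square_integrable_zero [simp]: "square_integrable M (\<lambda>x. 0)"
  by (simp add: square_integrable_def)

lemma square_integrable_scaleR: "square_integrable M f \<Longrightarrow> square_integrable M (\<lambda>x. c *\<^sub>R f x)"
  by (rule square_integrable_bound[where c = "\<bar>c\<bar>"])
    (auto intro: borel_measurable_scaleR square_integrable_measurable)

lemma square_integrable_add:
  assumes "square_integrable M f" "square_integrable M g"
  shows "square_integrable M (\<lambda>x. f x + g x)"
  unfolding square_integrable_def
proof
  note [measurable] = assms[THEN square_integrable_measurable]
  show "(\<lambda>x. f x + g x) \<in> borel_measurable M" by measurable
  show "integrable M (\<lambda>x. (norm (f x + g x))\<^sup>2)"
  proof (rule Bochner_Integration.integrable_bound)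
    show "integrable M (\<lambda>x. 2 * (norm (f x))\<^sup>2 + 2 * (norm (g x))\<^sup>2)"
      using assms by (simp add: square_integrable_def)
    have "(norm (f x + g x))\<^sup>2 \<le> 2 * (norm (f x))\<^sup>2 + 2 * (norm (g x))\<^sup>2" for x
    proof -
      have "(norm (f x + g x))\<^sup>2 \<le> (norm (f x) + norm (g x))\<^sup>2"
        by (intro power_mono norm_triangle_ineq) auto
      also have "\<dots> \<le> 2 * (norm (f x))\<^sup>2 + 2 * (norm (g x))\<^sup>2"
        using sum_squares_bound[of "norm (f x)" "norm (g x)"] by (simp add: power2_sum)
      finally show ?thesis .
    qed
    then show "AE x in M. norm ((norm (f x + g x))\<^sup>2) \<le> norm (2 * (norm (f x))\<^sup>2 + 2 * (norm (g x))\<^sup>2)"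
      by simp
  qed measurable
qed

lemma square_integrable_diff:
  "square_integrable M f \<Longrightarrow> square_integrable M g \<Longrightarrow> square_integrable M (\<lambda>x. f x - g x)"
  using square_integrable_add[of M f "\<lambda>x. (-1) *\<^sub>R g x"] square_integrable_scaleR[of M g "-1"] by simp

lemma square_integrable_inner:
  assumes "square_integrable M f" "square_integrable M g"
  shows "integrable M (\<lambda>x. f x \<bullet> g x)"
proof (rule Bochner_Integration.integrable_bound)
  note [measurable] = assms[THEN square_integrable_measurable]
  show "integrable M (\<lambda>x. (norm (f x))\<^sup>2 + (norm (g x))\<^sup>2)"
    using assms by (simp add: square_integrable_def)
  have "\<bar>f x \<bullet> g x\<bar> \<le> (norm (f x))\<^sup>2 + (norm (g x))\<^sup>2" for x
    using Cauchy_Schwarz_ineq2[of "f x" "g x"] sum_squares_bound[of "norm (f x)" "norm (g x)"]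
      zero_le_power2[of "norm (f x)"] zero_le_power2[of "norm (g x)"] by linarith
  then show "AE x in M. norm (f x \<bullet> g x) \<le> norm ((norm (f x))\<^sup>2 + (norm (g x))\<^sup>2)" by simp
  show "(\<lambda>x. f x \<bullet> g x) \<in> borel_measurable M" by measurable
qed

lemma square_integrable_bounded:
  assumes "emeasure M (space M) < \<infinity>" "f \<in> borel_measurable M" "\<And>x. x \<in> space M \<Longrightarrow> norm (f x) \<le> c"
  shows "square_integrable M f"
  unfolding square_integrable_def
proof
  interpret finite_measure M using assms(1) by (intro finite_measureI) auto
  show "integrable M (\<lambda>x. (norm (f x))\<^sup>2)"
    using assms(2,3) by (intro integrable_const_bound[where B = "c\<^sup>2"]) (auto intro!: power_mono AE_I2)
qed fact

lemma square_integrable_imp_integrable: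
  fixes f :: "'a \<Rightarrow> real"
  assumes "emeasure M (space M) < \<infinity>" "square_integrable M f"
  shows "integrable M f"
proof -
  have "square_integrable M (\<lambda>x. 1::real)" by (rule square_integrable_bounded[OF assms(1)]) auto
  from square_integrable_inner[OF assms(2) this] show ?thesis by simp
qed

lemma l2_semi_inner: "semi_inner {f :: 'a \<Rightarrow> 'b::euclidean_space. square_integrable M f} (l2_inner M)"
proof
  show "subspace {f :: 'a \<Rightarrow> 'b. square_integrable M f}"
    by (rule subspaceI)
      (simp_all add: zero_fun_def plus_fun_def scaleR_fun_def square_integrable_add square_integrable_scaleR)
  fix u v :: "'a \<Rightarrow> 'b"
  assume u: "u \<in> {f. square_integrable M f}"
  then show "linear_form_on {f. square_integrable M f} (l2_inner M u)"
    by (auto simp: linear_form_on_def l2_inner_def inner_add_right square_integrable_inner)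
  show "0 \<le> l2_inner M u u" by (simp add: l2_inner_def)
  show "l2_inner M u v = l2_inner M v u" by (simp add: l2_inner_def inner_commute)
qed

lemma l2_nrm: "semi_inner.nrm (l2_inner M) f = L2_norm M f"
  by (simp add: semi_inner.nrm_def[OF l2_semi_inner] l2_inner_def L2_norm_def power2_norm_eq_inner)

lemma square_integrable_nn_integral:
  "square_integrable M f \<Longrightarrow> (\<integral>\<^sup>+x. ennreal ((norm (f x))\<^sup>2) \<partial>M) = ennreal ((L2_norm M f)\<^sup>2)"
  by (subst nn_integral_eq_integral) (auto simp: square_integrable_def L2_norm_def)

lemma strict_mono_above:
  obtains r :: "nat \<Rightarrow> nat" where "strict_mono r" "\<And>k. N k \<le> r k"
proof
  show "strict_mono (\<lambda>k. k + (\<Sum>i\<le>k. N i))" by (rule strict_mono_Suc_iff[THEN iffD2]) simp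
  show "N k \<le> k + (\<Sum>i\<le>k. N i)" for k by (simp add: member_le_sum trans_le_add2)
qed

text \<open>A weighted sum of the increments along a rapidly converging subsequence is integrable, whence
  almost everywhere convergence; Fatou's lemma gives convergence in the mean.\<close>

theorem l2_complete:
  fixes f :: "nat \<Rightarrow> 'a \<Rightarrow> 'b::euclidean_space"
  assumes f: "\<And>n. square_integrable M (f n)"
    and cauchy: "\<And>e. 0 < e \<Longrightarrow> \<exists>N. \<forall>m\<ge>N. \<forall>n\<ge>N. L2_norm M (\<lambda>x. f m x - f n x) < e"
  obtains l r where "square_integrable M l" "(\<lambda>n. L2_norm M (\<lambda>x. f n x - l x)) \<longlonglongrightarrow> 0"
    "strict_mono r" "AE x in M. (\<lambda>n. f (r n) x) \<longlonglongrightarrow> l x"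
proof -
  note [measurable] = f[THEN square_integrable_measurable]
  \<comment> \<open>The rate 4^{-k} leaves room for weights: squared increments have integrals of
    order 16^{-k}, the weights 4^k keep their sum finite, and a finite weighted sum bounds the
    increments pointwise by a multiple of 2^{-k}.\<close>
  have "\<forall>k. \<exists>N. \<forall>m\<ge>N. \<forall>n\<ge>N. L2_norm M (\<lambda>x. f m x - f n x) < (1/4) ^ k"
    using cauchy by simp
  then obtain N where N: "\<And>k m n. m \<ge> N k \<Longrightarrow> n \<ge> N k \<Longrightarrow> L2_norm M (\<lambda>x. f m x - f n x) < (1/4) ^ k"
    by metis
  obtain r where r: "strict_mono r" "\<And>k. N k \<le> r k" using strict_mono_above by blast
  have rk: "N k \<le> r (Suc k)" for k
    using r(2)[of k] strict_monoD[OF r(1), of k "Suc k"] by linarith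
  define \<Delta> where "\<Delta> k x = f (r (Suc k)) x - f (r k) x" for k x
  have \<Delta>: "square_integrable M (\<Delta> k)" for k unfolding \<Delta>_def[abs_def] by (intro square_integrable_diff f)
  note [measurable] = \<Delta>[THEN square_integrable_measurable]
  have \<Delta>_le: "(L2_norm M (\<Delta> k))\<^sup>2 \<le> (1/16) ^ k" for k
  proof -
    have "0 \<le> L2_norm M (\<Delta> k)" by (simp add: L2_norm_def)
    moreover have "L2_norm M (\<Delta> k) \<le> (1/4) ^ k"
      using N[OF rk r(2), of k] unfolding \<Delta>_def[abs_def] by simp
    ultimately have "(L2_norm M (\<Delta> k))\<^sup>2 \<le> ((1/4) ^ k)\<^sup>2" by (intro power_mono)
    then show ?thesis by (simp add: power2_eq_square flip: power_mult_distrib)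
  qed
  have "(\<integral>\<^sup>+x. (\<Sum>k. ennreal (4 ^ k) * ennreal ((norm (\<Delta> k x))\<^sup>2)) \<partial>M)
      = (\<Sum>k. ennreal (4 ^ k) * ennreal ((L2_norm M (\<Delta> k))\<^sup>2))"
    by (subst nn_integral_suminf) (simp_all add: nn_integral_cmult square_integrable_nn_integral[OF \<Delta>])
  also have "\<dots> \<le> (\<Sum>k. ennreal ((1/4) ^ k))"
  proof (intro suminf_le allI)
    show "ennreal (4 ^ k) * ennreal ((L2_norm M (\<Delta> k))\<^sup>2) \<le> ennreal ((1/4) ^ k)" for k
    proof -
      have "4 ^ k * (L2_norm M (\<Delta> k))\<^sup>2 \<le> 4 ^ k * (1/16) ^ k" by (intro mult_left_mono \<Delta>_le) auto
      also have "\<dots> = (1/4) ^ k" by (simp flip: power_mult_distrib)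
      finally show ?thesis by (simp add: ennreal_mult[symmetric])
    qed
  qed auto
  also have "\<dots> < \<infinity>"
    using summable_geometric[of "1/4 :: real"] by (simp add: suminf_ennreal2 less_top[symmetric])
  finally have "AE x in M. (\<Sum>k. ennreal (4 ^ k) * ennreal ((norm (\<Delta> k x))\<^sup>2)) \<noteq> \<infinity>"
    by (intro nn_integral_PInf_AE) auto
  then have conv: "AE x in M. convergent (\<lambda>n. f (r n) x)"
  proof eventually_elim
    case (elim x)
    let ?S = "\<Sum>k. ennreal (4 ^ k) * ennreal ((norm (\<Delta> k x))\<^sup>2)"
    have le: "norm (\<Delta> k x) \<le> sqrt (enn2real ?S) * (1/2) ^ k" for k
    proof -
      have "ennreal (4 ^ k * (norm (\<Delta> k x))\<^sup>2) \<le> ?S"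
        using sum_le_suminf[of "\<lambda>k. ennreal (4 ^ k) * ennreal ((norm (\<Delta> k x))\<^sup>2)" "{k}"]
        by (simp add: ennreal_mult)
      then have "4 ^ k * (norm (\<Delta> k x))\<^sup>2 \<le> enn2real ?S"
        using enn2real_mono[of "ennreal (4 ^ k * (norm (\<Delta> k x))\<^sup>2)" ?S] elim
        by (simp add: less_top[symmetric] del: ennreal_mult'')
      then have "(2 ^ k * norm (\<Delta> k x))\<^sup>2 \<le> enn2real ?S"
        using power_mult[of "2 :: real" 2 k] power_mult[of "2 :: real" k 2]
        by (simp add: power_mult_distrib mult.commute)
      then have "2 ^ k * norm (\<Delta> k x) \<le> sqrt (enn2real ?S)" by (rule real_le_rsqrt)
      then show ?thesis by (simp add: field_simps)
    qed
    have "summable (\<lambda>k. sqrt (enn2real ?S) * (1/2) ^ k)"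
      by (rule summable_mult[OF summable_geometric]) simp
    from summable_comparison_test'[OF this le] have "summable (\<lambda>k. \<Delta> k x)" by blast
    then have "convergent (\<lambda>n. \<Sum>k<n. \<Delta> k x)" by (simp only: summable_iff_convergent)
    moreover have "(\<Sum>k<n. \<Delta> k x) = f (r n) x - f (r 0) x" for n
      unfolding \<Delta>_def by (rule sum_lessThan_telescope)
    ultimately have "convergent (\<lambda>n. f (r n) x - f (r 0) x)" by simp
    from convergent_add[OF this convergent_const[of "f (r 0) x"]] show ?case by simp
  qed
  define l where "l x = lim (\<lambda>n. f (r n) x)" for x
  have [measurable]: "l \<in> borel_measurable M" unfolding l_def[abs_def] by measurable
  have lim: "AE x in M. (\<lambda>n. f (r n) x) \<longlonglongrightarrow> l x"
    using conv by eventually_elim (simp add: l_def convergent_LIMSEQ_iff)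
  have fatou: "(\<integral>\<^sup>+x. ennreal ((norm (f n x - l x))\<^sup>2) \<partial>M) \<le> ennreal (e\<^sup>2)"
    if n: "\<forall>m\<ge>K. L2_norm M (\<lambda>x. f n x - f m x) < e" for n K e
  proof -
    have "(\<integral>\<^sup>+x. ennreal ((norm (f n x - l x))\<^sup>2) \<partial>M)
        = (\<integral>\<^sup>+x. liminf (\<lambda>k. ennreal ((norm (f n x - f (r k) x))\<^sup>2)) \<partial>M)"
    proof (rule nn_integral_cong_AE)
      show "AE x in M. ennreal ((norm (f n x - l x))\<^sup>2) = liminf (\<lambda>k. ennreal ((norm (f n x - f (r k) x))\<^sup>2))"
        using lim
      proof eventually_elim
        case (elim x)
        then have "(\<lambda>k. ennreal ((norm (f n x - f (r k) x))\<^sup>2)) \<longlonglongrightarrow> ennreal ((norm (f n x - l x))\<^sup>2)"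
          by (intro tendsto_intros tendsto_ennrealI)
        then show ?case by (intro lim_imp_Liminf[symmetric]) auto
      qed
    qed
    also have "\<dots> \<le> liminf (\<lambda>k. \<integral>\<^sup>+x. ennreal ((norm (f n x - f (r k) x))\<^sup>2) \<partial>M)"
      by (rule nn_integral_liminf) measurable
    also have "\<dots> \<le> limsup (\<lambda>k. \<integral>\<^sup>+x. ennreal ((norm (f n x - f (r k) x))\<^sup>2) \<partial>M)"
      by (rule Liminf_le_Limsup) simp
    also have "\<dots> \<le> ennreal (e\<^sup>2)"
    proof (rule Limsup_bounded)
      have "(\<integral>\<^sup>+x. ennreal ((norm (f n x - f (r k) x))\<^sup>2) \<partial>M) \<le> ennreal (e\<^sup>2)" if k: "k \<ge> K" for k
      proof -
        have "L2_norm M (\<lambda>x. f n x - f (r k) x) < e"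
          using n k seq_suble[OF r(1), of k] by auto
        then have "(L2_norm M (\<lambda>x. f n x - f (r k) x))\<^sup>2 \<le> e\<^sup>2"
          by (intro power_mono) (auto simp: L2_norm_def)
        then show ?thesis
          by (subst square_integrable_nn_integral[OF square_integrable_diff[OF f f]]) (rule ennreal_leI)
      qed
      then show "\<forall>\<^sub>F k in sequentially. (\<integral>\<^sup>+x. ennreal ((norm (f n x - f (r k) x))\<^sup>2) \<partial>M) \<le> ennreal (e\<^sup>2)"
        by (auto simp: eventually_sequentially)
    qed
    finally show ?thesis .
  qed
  have fl: "square_integrable M (\<lambda>x. f n x - l x)" if "\<forall>m\<ge>K. L2_norm M (\<lambda>x. f n x - f m x) < e" for n K e
    unfolding square_integrable_def
  proof
    show "integrable M (\<lambda>x. (norm (f n x - l x))\<^sup>2)"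
      using fatou[OF that] by (intro integrableI_bounded) (auto simp: less_top[symmetric] top_unique)
  qed measurable
  obtain K1 where K1: "\<forall>m\<ge>K1. \<forall>n\<ge>K1. L2_norm M (\<lambda>x. f m x - f n x) < 1" using cauchy[of 1] by auto
  have "square_integrable M (\<lambda>x. f K1 x - (f K1 x - l x))"
    by (rule square_integrable_diff[OF f fl[of K1 K1 1]]) (use K1 in auto)
  then have l: "square_integrable M l" by simp
  have "(\<lambda>n. L2_norm M (\<lambda>x. f n x - l x)) \<longlonglongrightarrow> 0"
  proof (rule LIMSEQ_I)
    fix e :: real assume e: "0 < e"
    then obtain K where K: "\<forall>m\<ge>K. \<forall>n\<ge>K. L2_norm M (\<lambda>x. f m x - f n x) < e / 2"
      using cauchy[of "e / 2"] by auto
    have "norm (L2_norm M (\<lambda>x. f n x - l x) - 0) < e" if n: "n \<ge> K" for n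
    proof -
      have *: "\<forall>m\<ge>K. L2_norm M (\<lambda>x. f n x - f m x) < e / 2" using K n by auto
      have "ennreal ((L2_norm M (\<lambda>x. f n x - l x))\<^sup>2) \<le> ennreal ((e / 2)\<^sup>2)"
        using fatou[OF *] square_integrable_nn_integral[OF fl[OF *]] by simp
      then have "(L2_norm M (\<lambda>x. f n x - l x))\<^sup>2 \<le> (e / 2)\<^sup>2" by (subst (asm) ennreal_le_iff) simp
      from power2_le_imp_le[OF this] have "L2_norm M (\<lambda>x. f n x - l x) \<le> e / 2" using e by simp
      moreover have "0 \<le> L2_norm M (\<lambda>x. f n x - l x)" by (simp add: L2_norm_def)
      ultimately show ?thesis using e by simp
    qed
    then show "\<exists>K. \<forall>n\<ge>K. norm (L2_norm M (\<lambda>x. f n x - l x) - 0) < e" by blast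
  qed
  from that[OF l this r(1) lim] show thesis .
qed

lemma l2_hilbert: "semi_hilbert {f :: 'a \<Rightarrow> 'b::euclidean_space. square_integrable M f} (l2_inner M)"
proof -
  interpret semi_inner "{f :: 'a \<Rightarrow> 'b. square_integrable M f}" "l2_inner M" by (rule l2_semi_inner)
  show ?thesis
  proof
    fix X :: "nat \<Rightarrow> 'a \<Rightarrow> 'b" assume X: "cauchy_seq X"
    have sq: "square_integrable M (X n)" for n using cauchy_seqD(1)[OF X] by simp
    have "\<exists>N. \<forall>m\<ge>N. \<forall>n\<ge>N. L2_norm M (\<lambda>x. X m x - X n x) < e" if "0 < e" for e
      using cauchy_seqD(2)[OF X that] unfolding l2_nrm fun_diff_def .
    from l2_complete[OF sq this] obtain l where "square_integrable M l"
      "(\<lambda>n. L2_norm M (\<lambda>x. X n x - l x)) \<longlonglongrightarrow> 0" by blast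
    then show "\<exists>l\<in>{f. square_integrable M f}. (\<lambda>n. nrm (X n - l)) \<longlonglongrightarrow> 0"
      unfolding l2_nrm fun_diff_def by blast
  qed
qed

section \<open>Weak gradients and the Sobolev space H1\<close>

lemma continuous_on_axis: "continuous_on S g \<Longrightarrow> continuous_on S (\<lambda>x. axis i (g x))"
  unfolding axis_def
proof (intro continuous_on_vec_lambda)
  show "continuous_on S (\<lambda>x. if k = i then g x else 0)" if "continuous_on S g" for k
    using that by (cases "k = i") auto
qed

lemma l2_inner_cong_AE:
  assumes "square_integrable M f" "square_integrable M f'" "square_integrable M g" "square_integrable M g'"
    and "AE x in M. f x = f' x" "AE x in M. g x = g' x"
  shows "l2_inner M f g = l2_inner M f' g'"
proof -
  note [measurable] = assms(1-4)[THEN square_integrable_measurable]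
  show ?thesis unfolding l2_inner_def
    using assms(5,6) by (intro integral_cong_AE) (auto elim: eventually_elim2)
qed

lemma L2_norm_cong_AE:
  assumes "f \<in> borel_measurable M" "g \<in> borel_measurable M" "AE x in M. f x = g x"
  shows "L2_norm M f = L2_norm M g"
  unfolding L2_norm_def using assms by (intro arg_cong[where f = sqrt] integral_cong_AE) auto

lemma L2_norm_nonneg: "0 \<le> L2_norm M f"
  by (simp add: L2_norm_def)

lemma L2_norm_square: "(L2_norm M f)\<^sup>2 = l2_inner M f f"
  by (simp add: L2_norm_def l2_inner_def power2_norm_eq_inner)

lemma H1_norm_nonneg: "0 \<le> H1_norm \<Omega> v"
  by (simp add: H1_norm_def)

lemma L2_norm_le_H1_norm: "L2_norm (lebesgue_on \<Omega>) v \<le> H1_norm \<Omega> v"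
  "L2_norm (lebesgue_on \<Omega>) (weak_gradient \<Omega> v) \<le> H1_norm \<Omega> v"
  by (simp_all add: H1_norm_def real_le_rsqrt)

locale sobolev_domain =
  fixes \<Omega> :: "(real^'n) set"
  assumes open_domain: "open \<Omega>" and bounded_domain: "bounded \<Omega>"
begin

abbreviation M where "M \<equiv> lebesgue_on \<Omega>"

lemma finite_domain: "emeasure M (space M) < \<infinity>"
proof -
  interpret finite_measure M
    using open_domain bounded_domain
    by (intro finite_measure_lebesgue_on bounded_set_imp_lmeasurable) auto
  show ?thesis by (simp add: less_top[symmetric])
qed

sublocale v: semi_hilbert "{f :: real^'n \<Rightarrow> real^'n. square_integrable M f}" "l2_inner M"
  by (rule l2_hilbert)

sublocale g: semi_hilbert "{f :: real^'n \<Rightarrow> real^'n^'n. square_integrable M f}" "l2_inner M"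
  by (rule l2_hilbert)

lemma continuous_square_integrable:
  fixes f :: "real^'n \<Rightarrow> 'b::euclidean_space"
  assumes "continuous_on UNIV f"
  shows "square_integrable M f"
proof -
  have "compact (f ` closure \<Omega>)"
    using bounded_domain assms by (intro compact_continuous_image)
      (auto intro: continuous_on_subset simp: compact_closure)
  then obtain c where "\<And>x. x \<in> closure \<Omega> \<Longrightarrow> norm (f x) \<le> c"
    using compact_imp_bounded by (metis bounded_iff imageI)
  then show ?thesis
    using closure_subset[of \<Omega>]
    by (intro square_integrable_bounded[OF finite_domain, of _ c] continuous_borel_measurable_lebesgue_on assms)
      auto
qed

lemma test_square_integrable:
  assumes "test_function \<Omega> \<phi>"
  shows "square_integrable M (\<lambda>x. axis i (partial_derivative j \<phi> x) :: real^'n)"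
    and "square_integrable M (\<lambda>x. axis i (axis j (\<phi> x)) :: real^'n^'n)"
proof -
  have "smooth \<phi>" using assms by (simp add: test_function_def)
  then show "square_integrable M (\<lambda>x. axis i (partial_derivative j \<phi> x) :: real^'n)"
    and "square_integrable M (\<lambda>x. axis i (axis j (\<phi> x)) :: real^'n^'n)"
    by (auto intro!: continuous_square_integrable continuous_on_axis smooth_imp_continuous
        smooth_partial_derivative)
qed

text \<open>Reads the integration by parts formula as an identity of L2 products with fixed
  elements, so that linearity and stability under limits become properties of the inner
  product.\<close>

lemma has_weak_gradient_iff:
  "has_weak_gradient \<Omega> v G \<longleftrightarrow> (\<forall>i j \<phi>. test_function \<Omega> \<phi> \<longrightarrow>
     l2_inner M v (\<lambda>x. axis i (partial_derivative j \<phi> x)) = - l2_inner M G (\<lambda>x. axis i (axis j (\<phi> x))))"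
  by (simp add: has_weak_gradient_def l2_inner_def inner_axis)

lemma has_weak_gradient_add:
  assumes "square_integrable M u" "square_integrable M v" "square_integrable M G" "square_integrable M H"
    and "has_weak_gradient \<Omega> u G" "has_weak_gradient \<Omega> v H"
  shows "has_weak_gradient \<Omega> (u + v) (G + H)"
  using assms by (simp add: has_weak_gradient_iff v.add_left g.add_left test_square_integrable)

lemma has_weak_gradient_scale:
  assumes "square_integrable M v" "square_integrable M H" "has_weak_gradient \<Omega> v H"
  shows "has_weak_gradient \<Omega> (c *\<^sub>R v) (c *\<^sub>R H)"
  using assms by (simp add: has_weak_gradient_iff v.scale_left g.scale_left test_square_integrable)

text \<open>The fundamental lemma is applied to each entry of the difference; on a bounded domain
  square integrable entries are integrable.\<close>

lemma has_weak_gradient_unique: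
  assumes "square_integrable M G" "square_integrable M H" "has_weak_gradient \<Omega> v G" "has_weak_gradient \<Omega> v H"
  shows "AE x in M. G x = H x"
proof -
  have D: "square_integrable M (\<lambda>x. G x - H x)" using assms by (intro square_integrable_diff)
  have "AE x in M. G x $ i $ j - H x $ i $ j = 0" for i j
  proof (rule fundamental_lemma_calculus_of_variations[OF open_domain])
    have "square_integrable M (\<lambda>x. G x $ i $ j - H x $ i $ j)"
    proof (rule square_integrable_bound[OF D])
      note [measurable] = assms(1,2)[THEN square_integrable_measurable]
      have "(\<lambda>x. (G x - H x) \<bullet> axis i (axis j 1)) \<in> borel_measurable M" by measurable
      then show "(\<lambda>x. G x $ i $ j - H x $ i $ j) \<in> borel_measurable M" by (simp add: inner_axis)
      have "\<bar>G x $ i $ j - H x $ i $ j\<bar> \<le> norm (G x - H x)" for x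
        using component_le_norm_cart[of "(G x - H x) $ i" j] Finite_Cartesian_Product.norm_nth_le[of "G x - H x" i]
        by simp
      then show "AE x in M. norm (G x $ i $ j - H x $ i $ j) \<le> 1 * norm (G x - H x)" by simp
    qed
    then show "integrable M (\<lambda>x. G x $ i $ j - H x $ i $ j)"
      by (rule square_integrable_imp_integrable[OF finite_domain])
    fix \<phi> assume \<phi>: "test_function \<Omega> \<phi>"
    have "l2_inner M (G - H) (\<lambda>x. axis i (axis j (\<phi> x))) = 0"
      using assms \<phi> by (simp add: has_weak_gradient_iff g.diff_left test_square_integrable)
    then show "(LINT x|M. (G x $ i $ j - H x $ i $ j) * \<phi> x) = 0"
      by (simp add: l2_inner_def inner_axis)
  qed
  then have "AE x in M. \<forall>i j. G x $ i $ j - H x $ i $ j = 0" by (simp add: AE_all_countable)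
  then show ?thesis by eventually_elim (simp add: vec_eq_iff)
qed

lemma H1_D:
  assumes "v \<in> H1 \<Omega>"
  shows "square_integrable M v" "square_integrable M (weak_gradient \<Omega> v)"
    "has_weak_gradient \<Omega> v (weak_gradient \<Omega> v)"
proof -
  have "\<exists>G. square_integrable M G \<and> has_weak_gradient \<Omega> v G" using assms by (simp add: H1_def)
  from someI_ex[OF this] show "square_integrable M (weak_gradient \<Omega> v)"
    "has_weak_gradient \<Omega> v (weak_gradient \<Omega> v)"
    by (simp_all add: weak_gradient_def)
qed (use assms in \<open>simp add: H1_def\<close>)

text \<open>Turns the choice behind \<open>weak_gradient\<close> into something computable:
  exhibiting any square integrable weak gradient determines it almost everywhere.\<close>

lemma H1_I:
  assumes "square_integrable M v" "square_integrable M G" "has_weak_gradient \<Omega> v G"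
  shows "v \<in> H1 \<Omega>" "AE x in M. weak_gradient \<Omega> v x = G x"
proof -
  show v: "v \<in> H1 \<Omega>" using assms by (auto simp: H1_def)
  show "AE x in M. weak_gradient \<Omega> v x = G x"
    by (rule has_weak_gradient_unique[OF H1_D(2)[OF v] assms(2) H1_D(3)[OF v] assms(3)])
qed

lemma H1_add:
  assumes "u \<in> H1 \<Omega>" "v \<in> H1 \<Omega>"
  shows "u + v \<in> H1 \<Omega>"
    and "AE x in M. weak_gradient \<Omega> (u + v) x = weak_gradient \<Omega> u x + weak_gradient \<Omega> v x"
  using H1_I[of "u + v" "weak_gradient \<Omega> u + weak_gradient \<Omega> v"] H1_D[OF assms(1)] H1_D[OF assms(2)]
  by (simp_all add: has_weak_gradient_add v.closed_ops(2)[unfolded mem_Collect_eq]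
      g.closed_ops(2)[unfolded mem_Collect_eq])

lemma H1_scale:
  assumes "v \<in> H1 \<Omega>"
  shows "c *\<^sub>R v \<in> H1 \<Omega>"
    and "AE x in M. weak_gradient \<Omega> (c *\<^sub>R v) x = c *\<^sub>R weak_gradient \<Omega> v x"
  using H1_I[of "c *\<^sub>R v" "c *\<^sub>R weak_gradient \<Omega> v"] H1_D[OF assms]
  by (simp_all add: has_weak_gradient_scale v.closed_ops(3)[unfolded mem_Collect_eq]
      g.closed_ops(3)[unfolded mem_Collect_eq])

lemma zero_H1: "0 \<in> H1 \<Omega>"
proof -
  have "has_weak_gradient \<Omega> 0 0" by (simp add: has_weak_gradient_def)
  then show ?thesis by (intro H1_I(1)[of _ 0]) (simp_all add: zero_fun_def)
qed

lemma subspace_H1: "subspace (H1 \<Omega>)"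
  by (rule subspaceI) (auto intro: zero_H1 H1_add H1_scale)

lemma H1_diff:
  assumes "u \<in> H1 \<Omega>" "v \<in> H1 \<Omega>"
  shows "u - v \<in> H1 \<Omega>"
    and "AE x in M. weak_gradient \<Omega> (u - v) x = weak_gradient \<Omega> u x - weak_gradient \<Omega> v x"
proof -
  have eq: "u - v = u + (-1) *\<^sub>R v" by simp
  show "u - v \<in> H1 \<Omega>" unfolding eq by (intro H1_add H1_scale assms)
  show "AE x in M. weak_gradient \<Omega> (u - v) x = weak_gradient \<Omega> u x - weak_gradient \<Omega> v x"
    unfolding eq using H1_add(2)[OF assms(1) H1_scale(1)[OF assms(2)], of "-1"] H1_scale(2)[OF assms(2), of "-1"]
    by eventually_elim simp
qed

definition h1_inner :: "(real^'n \<Rightarrow> real^'n) \<Rightarrow> (real^'n \<Rightarrow> real^'n) \<Rightarrow> real" where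
  "h1_inner u v = l2_inner M u v + l2_inner M (weak_gradient \<Omega> u) (weak_gradient \<Omega> v)"

lemma h1_semi_inner: "semi_inner (H1 \<Omega>) h1_inner"
proof
  show "linear_form_on (H1 \<Omega>) (h1_inner u)" if u: "u \<in> H1 \<Omega>" for u
    unfolding linear_form_on_def
  proof (intro conjI ballI allI)
    fix v w assume v: "v \<in> H1 \<Omega>" and w: "w \<in> H1 \<Omega>"
    have "l2_inner M (weak_gradient \<Omega> u) (weak_gradient \<Omega> (v + w))
        = l2_inner M (weak_gradient \<Omega> u) (weak_gradient \<Omega> v + weak_gradient \<Omega> w)"
      using H1_add[OF v w] u v w
      by (intro l2_inner_cong_AE H1_D) (auto simp: plus_fun_def intro!: square_integrable_add H1_D)
    then show "h1_inner u (v + w) = h1_inner u v + h1_inner u w"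
      using H1_D(1,2)[OF u] H1_D(1,2)[OF v] H1_D(1,2)[OF w]
      by (simp add: h1_inner_def v.add_right g.add_right)
  next
    fix c v assume v: "v \<in> H1 \<Omega>"
    have "l2_inner M (weak_gradient \<Omega> u) (weak_gradient \<Omega> (c *\<^sub>R v))
        = l2_inner M (weak_gradient \<Omega> u) (c *\<^sub>R weak_gradient \<Omega> v)"
      using H1_scale[OF v, of c] u v
      by (intro l2_inner_cong_AE H1_D) (auto simp: scaleR_fun_def intro!: square_integrable_scaleR H1_D)
    then show "h1_inner u (c *\<^sub>R v) = c * h1_inner u v"
      using H1_D(1,2)[OF u] H1_D(1,2)[OF v]
      by (simp add: h1_inner_def v.scale_right g.scale_right algebra_simps)
  qed
  show "h1_inner u v = h1_inner v u" for u v
    by (simp add: h1_inner_def l2_inner_def inner_commute)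
  show "0 \<le> h1_inner u u" for u
    by (simp add: h1_inner_def flip: L2_norm_square)
qed (rule subspace_H1)

lemma h1_nrm: "semi_inner.nrm h1_inner v = H1_norm \<Omega> v"
  by (simp add: semi_inner.nrm_def[OF h1_semi_inner] h1_inner_def H1_norm_def L2_norm_square)

sublocale h: semi_inner "H1 \<Omega>" h1_inner
  by (rule h1_semi_inner)

lemma has_weak_gradient_closed:
  assumes v: "\<And>k. square_integrable M (v k)" "\<And>k. square_integrable M (G k)" "\<And>k. has_weak_gradient \<Omega> (v k) (G k)"
    and l: "square_integrable M l" "square_integrable M H"
    and lim: "(\<lambda>k. L2_norm M (\<lambda>x. v k x - l x)) \<longlonglongrightarrow> 0" "(\<lambda>k. L2_norm M (\<lambda>x. G k x - H x)) \<longlonglongrightarrow> 0"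
  shows "has_weak_gradient \<Omega> l H"
  unfolding has_weak_gradient_iff
proof (intro allI impI)
  fix i j \<phi> assume \<phi>: "test_function \<Omega> \<phi>"
  have "(\<lambda>k. l2_inner M (v k) (\<lambda>x. axis i (partial_derivative j \<phi> x)))
      \<longlonglongrightarrow> l2_inner M l (\<lambda>x. axis i (partial_derivative j \<phi> x))"
    by (rule v.tendsto_b) (use v l lim test_square_integrable[OF \<phi>] in \<open>simp_all add: l2_nrm fun_diff_def\<close>)
  moreover have "(\<lambda>k. - l2_inner M (G k) (\<lambda>x. axis i (axis j (\<phi> x))))
      \<longlonglongrightarrow> - l2_inner M H (\<lambda>x. axis i (axis j (\<phi> x)))"
    by (rule tendsto_minus, rule g.tendsto_b)
      (use v l lim test_square_integrable[OF \<phi>] in \<open>simp_all add: l2_nrm fun_diff_def\<close>)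
  moreover have "l2_inner M (v k) (\<lambda>x. axis i (partial_derivative j \<phi> x))
      = - l2_inner M (G k) (\<lambda>x. axis i (axis j (\<phi> x)))" for k
    using v(3)[of k] \<phi> unfolding has_weak_gradient_iff by blast
  ultimately show "l2_inner M l (\<lambda>x. axis i (partial_derivative j \<phi> x))
      = - l2_inner M H (\<lambda>x. axis i (axis j (\<phi> x)))"
    using LIMSEQ_unique by simp
qed

lemma weak_gradient_diff_norm:
  assumes "u \<in> H1 \<Omega>" "v \<in> H1 \<Omega>"
  shows "L2_norm M (weak_gradient \<Omega> (u - v)) = L2_norm M (\<lambda>x. weak_gradient \<Omega> u x - weak_gradient \<Omega> v x)"
  using H1_diff[OF assms] assms
  by (intro L2_norm_cong_AE square_integrable_measurable square_integrable_diff H1_D)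

text \<open>Fields and gradients converge separately in L2, and closedness of the weak gradient
  relates the two limits.\<close>

lemma h1_hilbert: "semi_hilbert (H1 \<Omega>) h1_inner"
proof
  fix X assume X: "h.cauchy_seq X"
  have XH: "X n \<in> H1 \<Omega>" for n by (rule h.cauchy_seqD(1)[OF X])
  have cauchy: "\<exists>N. \<forall>m\<ge>N. \<forall>n\<ge>N. H1_norm \<Omega> (X m - X n) < e" if "0 < e" for e
    using h.cauchy_seqD(2)[OF X that] unfolding h1_nrm .
  have 1: "\<exists>N. \<forall>m\<ge>N. \<forall>n\<ge>N. L2_norm M (\<lambda>x. X m x - X n x) < e" if "0 < e" for e
    using cauchy[OF that] le_less_trans[OF L2_norm_le_H1_norm(1)] unfolding fun_diff_def by blast
  have 2: "\<exists>N. \<forall>m\<ge>N. \<forall>n\<ge>N. L2_norm M (\<lambda>x. weak_gradient \<Omega> (X m) x - weak_gradient \<Omega> (X n) x) < e"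
    if "0 < e" for e
    using cauchy[OF that] le_less_trans[OF L2_norm_le_H1_norm(2)]
    unfolding weak_gradient_diff_norm[OF XH XH, symmetric] by blast
  obtain l where l: "square_integrable M l" "(\<lambda>n. L2_norm M (\<lambda>x. X n x - l x)) \<longlonglongrightarrow> 0"
    using l2_complete[OF H1_D(1)[OF XH] 1] by blast
  obtain H where H: "square_integrable M H" "(\<lambda>n. L2_norm M (\<lambda>x. weak_gradient \<Omega> (X n) x - H x)) \<longlonglongrightarrow> 0"
    using l2_complete[OF H1_D(2)[OF XH] 2] by blast
  have "has_weak_gradient \<Omega> l H"
    by (rule has_weak_gradient_closed[OF H1_D[OF XH] l(1) H(1) l(2) H(2)])
  note lH = H1_I[OF l(1) H(1) this]
  have "L2_norm M (weak_gradient \<Omega> (X n - l)) = L2_norm M (\<lambda>x. weak_gradient \<Omega> (X n) x - H x)" for n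
    unfolding weak_gradient_diff_norm[OF XH lH(1)] using lH XH[of n] H(1)
    by (intro L2_norm_cong_AE square_integrable_measurable square_integrable_diff H1_D) auto
  then have "H1_norm \<Omega> (X n - l)
      = sqrt ((L2_norm M (\<lambda>x. X n x - l x))\<^sup>2 + (L2_norm M (\<lambda>x. weak_gradient \<Omega> (X n) x - H x))\<^sup>2)" for n
    unfolding H1_norm_def by (simp add: fun_diff_def)
  moreover have "(\<lambda>n. sqrt ((L2_norm M (\<lambda>x. X n x - l x))\<^sup>2
      + (L2_norm M (\<lambda>x. weak_gradient \<Omega> (X n) x - H x))\<^sup>2)) \<longlonglongrightarrow> sqrt (0\<^sup>2 + 0\<^sup>2)"
    by (intro tendsto_intros l(2) H(2))
  ultimately have "(\<lambda>n. H1_norm \<Omega> (X n - l)) \<longlonglongrightarrow> 0" by simp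
  then show "\<exists>l\<in>H1 \<Omega>. (\<lambda>n. h.nrm (X n - l)) \<longlonglongrightarrow> 0" unfolding h1_nrm using lH(1) by blast
qed

sublocale h: semi_hilbert "H1 \<Omega>" h1_inner
  by (rule h1_hilbert)

end

section \<open>Traces\<close>

lemma smooth_fields_continuous:
  assumes "\<phi> \<in> smooth_fields \<Omega>"
  shows "continuous_on UNIV \<phi>"
proof -
  have "continuous_on UNIV (\<lambda>x. \<chi> i. \<phi> x $ i)"
    using assms by (intro continuous_on_vec_lambda smooth_imp_continuous) (simp add: smooth_fields_def)
  then show ?thesis by simp
qed

locale regular_sobolev_domain = sobolev_domain +
  assumes regular: "regular_domain \<Omega>"
begin

abbreviation S where "S \<equiv> surface_measure \<Omega>"

lemma space_S: "space S = frontier \<Omega>"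
  by (simp add: surface_measure_def space_restrict_space)

lemma finite_surface: "emeasure S (space S) < \<infinity>"
  using regular by (simp add: regular_domain_def space_S)

sublocale s: semi_hilbert "{f :: real^'a \<Rightarrow> real^'a. square_integrable S f}" "l2_inner S"
  by (rule l2_hilbert)

lemma continuous_surface_square_integrable:
  assumes "continuous_on UNIV f"
  shows "square_integrable S f"
proof -
  have "compact (f ` frontier \<Omega>)"
    using bounded_domain assms by (intro compact_continuous_image)
      (auto intro: continuous_on_subset simp: compact_frontier_bounded)
  then obtain c where "\<And>x. x \<in> frontier \<Omega> \<Longrightarrow> norm (f x) \<le> c"
    using compact_imp_bounded by (metis bounded_iff imageI)
  moreover have "f \<in> borel_measurable S"
    unfolding surface_measure_def using assms
    by (intro measurable_restrict_space1)
      (simp add: borel_measurable_continuous_onI cong: measurable_cong_sets)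
  ultimately show ?thesis
    by (intro square_integrable_bounded[OF finite_surface, of _ c]) (auto simp: space_S)
qed

lemma subspace_smooth_fields: "subspace (smooth_fields \<Omega>)"
  by (rule subspaceI)
    (auto simp: smooth_fields_def zero_H1 H1_add H1_scale smooth_const smooth_add smooth_mult)

lemma smooth_fields_D:
  assumes "\<phi> \<in> smooth_fields \<Omega>"
  shows "\<phi> \<in> H1 \<Omega>" "square_integrable S \<phi>"
  using assms continuous_surface_square_integrable[OF smooth_fields_continuous[OF assms]]
  by (auto simp: smooth_fields_def)

lemma is_trace_iff:
  "is_trace \<Omega> v g \<longleftrightarrow> square_integrable S g \<and>
     (\<exists>\<phi>. (\<forall>k. \<phi> k \<in> smooth_fields \<Omega>) \<and> (\<lambda>k. H1_norm \<Omega> (\<phi> k - v)) \<longlonglongrightarrow> 0 \<and>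
        (\<lambda>k. L2_norm S (\<phi> k - g)) \<longlonglongrightarrow> 0)"
  by (simp add: is_trace_def fun_diff_def)

lemma is_trace_zero: "is_trace \<Omega> 0 0"
proof -
  have "\<forall>k::nat. 0 \<in> smooth_fields \<Omega>" using subspace_smooth_fields by (simp add: subspace_0)
  moreover have "H1_norm \<Omega> (0 - 0) = 0" "L2_norm S (0 - 0 :: real^'a \<Rightarrow> real^'a) = 0"
    using h.nrm_zero s.nrm_zero by (simp_all only: h1_nrm l2_nrm diff_self)
  ultimately show ?thesis
    unfolding is_trace_iff by (intro conjI exI[of _ "\<lambda>_. 0"]) (simp_all add: zero_fun_def)
qed

lemma is_trace_add:
  assumes u: "u \<in> H1 \<Omega>" "is_trace \<Omega> u g" and v: "v \<in> H1 \<Omega>" "is_trace \<Omega> v h"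
  shows "is_trace \<Omega> (u + v) (g + h)"
proof -
  obtain \<phi> where \<phi>: "\<And>k. \<phi> k \<in> smooth_fields \<Omega>" "(\<lambda>k. H1_norm \<Omega> (\<phi> k - u)) \<longlonglongrightarrow> 0"
    "(\<lambda>k. L2_norm S (\<phi> k - g)) \<longlonglongrightarrow> 0" using u by (auto simp: is_trace_iff)
  obtain \<psi> where \<psi>: "\<And>k. \<psi> k \<in> smooth_fields \<Omega>" "(\<lambda>k. H1_norm \<Omega> (\<psi> k - v)) \<longlonglongrightarrow> 0"
    "(\<lambda>k. L2_norm S (\<psi> k - h)) \<longlonglongrightarrow> 0" using v by (auto simp: is_trace_iff)
  have g: "square_integrable S g" "square_integrable S h" using u v by (auto simp: is_trace_iff)
  have "(\<lambda>k. H1_norm \<Omega> ((\<phi> k + \<psi> k) - (u + v))) \<longlonglongrightarrow> 0"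
  proof (rule Lim_null_comparison)
    show "(\<lambda>k. H1_norm \<Omega> (\<phi> k - u) + H1_norm \<Omega> (\<psi> k - v)) \<longlonglongrightarrow> 0"
      using tendsto_add[OF \<phi>(2) \<psi>(2)] by simp
    have "H1_norm \<Omega> ((\<phi> k - u) + (\<psi> k - v)) \<le> H1_norm \<Omega> (\<phi> k - u) + H1_norm \<Omega> (\<psi> k - v)" for k
      unfolding h1_nrm[symmetric] using u v \<phi>(1) \<psi>(1) smooth_fields_D
      by (intro h.nrm_triangle h.closed_ops) auto
    then show "\<forall>\<^sub>F k in sequentially. norm (H1_norm \<Omega> ((\<phi> k + \<psi> k) - (u + v)))
        \<le> H1_norm \<Omega> (\<phi> k - u) + H1_norm \<Omega> (\<psi> k - v)"
      by (simp add: H1_norm_nonneg add_diff_add)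
  qed
  moreover have "(\<lambda>k. L2_norm S ((\<phi> k + \<psi> k) - (g + h))) \<longlonglongrightarrow> 0"
  proof (rule Lim_null_comparison)
    show "(\<lambda>k. L2_norm S (\<phi> k - g) + L2_norm S (\<psi> k - h)) \<longlonglongrightarrow> 0"
      using tendsto_add[OF \<phi>(3) \<psi>(3)] by simp
    have "L2_norm S ((\<phi> k - g) + (\<psi> k - h)) \<le> L2_norm S (\<phi> k - g) + L2_norm S (\<psi> k - h)" for k
      unfolding l2_nrm[symmetric] using g \<phi>(1) \<psi>(1) smooth_fields_D
      by (intro s.nrm_triangle s.closed_ops) auto
    then show "\<forall>\<^sub>F k in sequentially. norm (L2_norm S ((\<phi> k + \<psi> k) - (g + h)))
        \<le> L2_norm S (\<phi> k - g) + L2_norm S (\<psi> k - h)"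
      by (simp add: L2_norm_nonneg add_diff_add)
  qed
  moreover have "\<phi> k + \<psi> k \<in> smooth_fields \<Omega>" for k
    using \<phi>(1) \<psi>(1) subspace_smooth_fields by (simp add: subspace_add)
  moreover have "square_integrable S (g + h)" using s.closed_ops(2) g by simp
  ultimately show ?thesis unfolding is_trace_iff by (intro conjI exI[of _ "\<lambda>k. \<phi> k + \<psi> k"]) auto
qed

lemma is_trace_scale:
  assumes u: "u \<in> H1 \<Omega>" "is_trace \<Omega> u g"
  shows "is_trace \<Omega> (c *\<^sub>R u) (c *\<^sub>R g)"
proof -
  obtain \<phi> where \<phi>: "\<And>k. \<phi> k \<in> smooth_fields \<Omega>" "(\<lambda>k. H1_norm \<Omega> (\<phi> k - u)) \<longlonglongrightarrow> 0"
    "(\<lambda>k. L2_norm S (\<phi> k - g)) \<longlonglongrightarrow> 0" using u by (auto simp: is_trace_iff)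
  have g: "square_integrable S g" using u by (auto simp: is_trace_iff)
  have "H1_norm \<Omega> (c *\<^sub>R \<phi> k - c *\<^sub>R u) = \<bar>c\<bar> * H1_norm \<Omega> (\<phi> k - u)" for k
    unfolding h1_nrm[symmetric] scaleR_diff_right[symmetric]
    using u smooth_fields_D[OF \<phi>(1)] by (intro h.nrm_scale) auto
  moreover have "L2_norm S (c *\<^sub>R \<phi> k - c *\<^sub>R g) = \<bar>c\<bar> * L2_norm S (\<phi> k - g)" for k
    unfolding l2_nrm[symmetric] scaleR_diff_right[symmetric]
    using g smooth_fields_D[OF \<phi>(1)] by (intro s.nrm_scale s.closed_ops) auto
  moreover have "c *\<^sub>R \<phi> k \<in> smooth_fields \<Omega>" for k
    using \<phi>(1) subspace_smooth_fields by (simp add: subspace_scale)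
  moreover have "square_integrable S (c *\<^sub>R g)" using s.closed_ops(3) g by simp
  ultimately show ?thesis
    unfolding is_trace_iff using tendsto_mult_left[OF \<phi>(2), of "\<bar>c\<bar>"] tendsto_mult_left[OF \<phi>(3), of "\<bar>c\<bar>"]
    by (intro conjI exI[of _ "\<lambda>k. c *\<^sub>R \<phi> k"]) auto
qed

lemma is_trace_diff:
  assumes "u \<in> H1 \<Omega>" "is_trace \<Omega> u g" "v \<in> H1 \<Omega>" "is_trace \<Omega> v h"
  shows "is_trace \<Omega> (u - v) (g - h)"
  using is_trace_add[OF assms(1,2) H1_scale(1)[OF assms(3)] is_trace_scale[OF assms(3,4)], of "-1"] by simp

text \<open>The bound assumed for smooth fields passes to the limit along an approximating sequence,
  and so holds on the whole graph of the trace.\<close>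

lemma trace_bounded:
  obtains c where "0 \<le> c" "\<And>v g. v \<in> H1 \<Omega> \<Longrightarrow> is_trace \<Omega> v g \<Longrightarrow> L2_norm S g \<le> c * H1_norm \<Omega> v"
proof -
  obtain c where c: "\<And>\<phi>. \<phi> \<in> smooth_fields \<Omega> \<Longrightarrow> L2_norm S \<phi> \<le> c * H1_norm \<Omega> \<phi>"
    using regular by (auto simp: regular_domain_def)
  have "L2_norm S g \<le> \<bar>c\<bar> * H1_norm \<Omega> v" if v: "v \<in> H1 \<Omega>" and tr: "is_trace \<Omega> v g" for v g
  proof -
    obtain \<phi> where \<phi>: "\<And>k. \<phi> k \<in> smooth_fields \<Omega>" "(\<lambda>k. H1_norm \<Omega> (\<phi> k - v)) \<longlonglongrightarrow> 0"
      "(\<lambda>k. L2_norm S (\<phi> k - g)) \<longlonglongrightarrow> 0" using tr by (auto simp: is_trace_iff)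
    have g: "square_integrable S g" using tr by (auto simp: is_trace_iff)
    have "L2_norm S g \<le> L2_norm S (\<phi> k - g) + \<bar>c\<bar> * (H1_norm \<Omega> (\<phi> k - v) + H1_norm \<Omega> v)" for k
    proof -
      note \<phi>k = smooth_fields_D[OF \<phi>(1), of k]
      have "L2_norm S g \<le> L2_norm S (\<phi> k) + L2_norm S (\<phi> k - g)"
        using s.nrm_triangle_le_sum[of "\<phi> k" "\<phi> k - g"] g \<phi>k s.closed_ops(4)[of "\<phi> k" g] by (simp add: l2_nrm)
      moreover have "L2_norm S (\<phi> k) \<le> \<bar>c\<bar> * H1_norm \<Omega> (\<phi> k)"
        using c[OF \<phi>(1), of k] mult_right_mono[OF abs_ge_self[of c] H1_norm_nonneg[of \<Omega> "\<phi> k"]] by linarith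
      moreover have "H1_norm \<Omega> (\<phi> k) \<le> H1_norm \<Omega> (\<phi> k - v) + H1_norm \<Omega> v"
        using h.nrm_triangle[of "\<phi> k - v" v] v \<phi>k by (simp add: h1_nrm)
      then have "\<bar>c\<bar> * H1_norm \<Omega> (\<phi> k) \<le> \<bar>c\<bar> * (H1_norm \<Omega> (\<phi> k - v) + H1_norm \<Omega> v)"
        by (intro mult_left_mono) auto
      ultimately show ?thesis by linarith
    qed
    moreover have "(\<lambda>k. L2_norm S (\<phi> k - g) + \<bar>c\<bar> * (H1_norm \<Omega> (\<phi> k - v) + H1_norm \<Omega> v))
        \<longlonglongrightarrow> 0 + \<bar>c\<bar> * (0 + H1_norm \<Omega> v)"
      by (intro tendsto_intros \<phi>)
    ultimately show ?thesis by (intro LIMSEQ_le_const) auto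
  qed
  then show thesis using that[of "\<bar>c\<bar>"] by simp
qed

lemma subspace_vanishing: "subspace (H1_vanishing_on \<Omega> \<Sigma>)"
proof (rule subspaceI)
  show "0 \<in> H1_vanishing_on \<Omega> \<Sigma>" unfolding H1_vanishing_on_def using zero_H1 is_trace_zero by force
  show "u + v \<in> H1_vanishing_on \<Omega> \<Sigma>" if uv: "u \<in> H1_vanishing_on \<Omega> \<Sigma>" "v \<in> H1_vanishing_on \<Omega> \<Sigma>" for u v
  proof -
    obtain g h where g: "is_trace \<Omega> u g" "AE x in S. x \<in> \<Sigma> \<longrightarrow> g x = 0"
      and h: "is_trace \<Omega> v h" "AE x in S. x \<in> \<Sigma> \<longrightarrow> h x = 0"
      using uv by (auto simp: H1_vanishing_on_def)
    have "AE x in S. x \<in> \<Sigma> \<longrightarrow> (g + h) x = 0" using g(2) h(2) by eventually_elim simp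
    then show ?thesis using uv is_trace_add[OF _ g(1) _ h(1)] H1_add
      by (auto simp: H1_vanishing_on_def)
  qed
  show "c *\<^sub>R u \<in> H1_vanishing_on \<Omega> \<Sigma>" if u: "u \<in> H1_vanishing_on \<Omega> \<Sigma>" for c u
  proof -
    obtain g where g: "is_trace \<Omega> u g" "AE x in S. x \<in> \<Sigma> \<longrightarrow> g x = 0"
      using u by (auto simp: H1_vanishing_on_def)
    have "AE x in S. x \<in> \<Sigma> \<longrightarrow> (c *\<^sub>R g) x = 0" using g(2) by eventually_elim simp
    moreover have uH: "u \<in> H1 \<Omega>" using u by (simp add: H1_vanishing_on_def)
    ultimately show ?thesis using is_trace_scale[OF uH g(1), of c] H1_scale(1)[OF uH, of c]
      unfolding H1_vanishing_on_def by blast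
  qed
qed

text \<open>This is what makes U and W complete. The trace bound turns H^1 convergence into a Cauchy
  sequence of traces; its L2 limit inherits the zero values on \<Sigma> from an a.e. convergent
  subsequence, and a diagonal choice of smooth fields shows that it is a trace of l.\<close>

lemma vanishing_closed:
  assumes v: "\<And>k. v k \<in> H1_vanishing_on \<Omega> \<Sigma>" and l: "l \<in> H1 \<Omega>"
    and lim: "(\<lambda>k. H1_norm \<Omega> (v k - l)) \<longlonglongrightarrow> 0"
  shows "l \<in> H1_vanishing_on \<Omega> \<Sigma>"
proof -
  have vH: "v k \<in> H1 \<Omega>" for k using v by (simp add: H1_vanishing_on_def)
  have "\<exists>g. is_trace \<Omega> (v k) g \<and> (AE x in S. x \<in> \<Sigma> \<longrightarrow> g x = 0)" for k
    using v by (simp add: H1_vanishing_on_def)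
  then obtain g where g: "\<And>k. is_trace \<Omega> (v k) (g k)" "\<And>k. AE x in S. x \<in> \<Sigma> \<longrightarrow> g k x = 0" by metis
  have gS: "square_integrable S (g k)" for k using g(1) by (simp add: is_trace_iff)
  obtain c where c: "0 \<le> c" "\<And>v g. v \<in> H1 \<Omega> \<Longrightarrow> is_trace \<Omega> v g \<Longrightarrow> L2_norm S g \<le> c * H1_norm \<Omega> v"
    using trace_bounded by blast
  have cauchy: "\<exists>N. \<forall>m\<ge>N. \<forall>n\<ge>N. L2_norm S (\<lambda>x. g m x - g n x) < e" if e: "0 < e" for e
  proof -
    have "h.cauchy_seq v" by (rule h.convergent_imp_cauchy_seq[OF vH l]) (simp add: h1_nrm lim)
    \<comment> \<open>c may be 0, hence the denominator c + 1.\<close>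
    then obtain N where N: "\<forall>m\<ge>N. \<forall>n\<ge>N. H1_norm \<Omega> (v m - v n) < e / (c + 1)"
      using h.cauchy_seqD(2)[of v "e / (c + 1)"] e c(1) by (auto simp: h1_nrm)
    have "L2_norm S (g m - g n) < e" if "m \<ge> N" "n \<ge> N" for m n
    proof -
      have "L2_norm S (g m - g n) \<le> c * H1_norm \<Omega> (v m - v n)"
        by (intro c(2) is_trace_diff vH g H1_diff)
      also have "\<dots> \<le> c * (e / (c + 1))" using N that c(1) by (intro mult_left_mono) (auto intro: less_imp_le)
      also have "\<dots> < e" using c(1) e by (simp add: field_simps)
      finally show ?thesis .
    qed
    then show ?thesis unfolding fun_diff_def by blast
  qed
  obtain g' r where g': "square_integrable S g'" "(\<lambda>n. L2_norm S (\<lambda>x. g n x - g' x)) \<longlonglongrightarrow> 0"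
    "strict_mono (r :: nat \<Rightarrow> nat)" "AE x in S. (\<lambda>n. g (r n) x) \<longlonglongrightarrow> g' x"
    using l2_complete[OF gS cauchy] by blast
  have g'_lim: "(\<lambda>n. L2_norm S (g n - g')) \<longlonglongrightarrow> 0" using g'(2) by (simp add: fun_diff_def)
  \<comment> \<open>One null set must serve all k before the pointwise limit is taken.\<close>
  have "AE x in S. \<forall>k. x \<in> \<Sigma> \<longrightarrow> g k x = 0" unfolding AE_all_countable by (rule allI, rule g(2))
  then have "AE x in S. x \<in> \<Sigma> \<longrightarrow> g' x = 0"
    using g'(4) by eventually_elim (auto simp: LIMSEQ_const_iff)
  moreover have "is_trace \<Omega> l g'"
  proof -
    \<comment> \<open>Diagonal choice: one smooth field close to \<open>v k\<close> in H^1 and, at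
      the same time, to \<open>g k\<close> on the boundary.\<close>
    have "\<exists>\<phi>\<in>smooth_fields \<Omega>. H1_norm \<Omega> (\<phi> - v k) < inverse (real (Suc k)) \<and>
        L2_norm S (\<phi> - g k) < inverse (real (Suc k))" for k
    proof -
      obtain \<phi> where \<phi>: "\<And>k. \<phi> k \<in> smooth_fields \<Omega>" "(\<lambda>j. H1_norm \<Omega> (\<phi> j - v k)) \<longlonglongrightarrow> 0"
        "(\<lambda>j. L2_norm S (\<phi> j - g k)) \<longlonglongrightarrow> 0" using g(1)[of k] by (auto simp: is_trace_iff)
      have "\<forall>\<^sub>F j in sequentially. H1_norm \<Omega> (\<phi> j - v k) < inverse (real (Suc k)) \<and>
          L2_norm S (\<phi> j - g k) < inverse (real (Suc k))"
        by (intro eventually_conj order_tendstoD(2)[OF \<phi>(2)] order_tendstoD(2)[OF \<phi>(3)]) simp_all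
      from eventually_happens'[OF sequentially_bot this] show ?thesis using \<phi>(1) by blast
    qed
    then obtain \<phi> where \<phi>: "\<And>k. \<phi> k \<in> smooth_fields \<Omega>" "\<And>k. H1_norm \<Omega> (\<phi> k - v k) < inverse (real (Suc k))"
      "\<And>k. L2_norm S (\<phi> k - g k) < inverse (real (Suc k))" by metis
    note \<phi>D = smooth_fields_D[OF \<phi>(1)]
    have "(\<lambda>k. H1_norm \<Omega> (\<phi> k - l)) \<longlonglongrightarrow> 0"
    proof (rule Lim_null_comparison)
      have "H1_norm \<Omega> (\<phi> k - l) \<le> inverse (real (Suc k)) + H1_norm \<Omega> (v k - l)" for k
        using h.nrm_triangle_diff[OF \<phi>D(1) vH l, of k k] \<phi>(2)[of k] by (simp add: h1_nrm)
      then show "\<forall>\<^sub>F k in sequentially. norm (H1_norm \<Omega> (\<phi> k - l)) \<le> inverse (real (Suc k)) + H1_norm \<Omega> (v k - l)"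
        by (simp add: H1_norm_nonneg)
      show "(\<lambda>k. inverse (real (Suc k)) + H1_norm \<Omega> (v k - l)) \<longlonglongrightarrow> 0"
        using tendsto_add[OF LIMSEQ_inverse_real_of_nat lim] by simp
    qed
    moreover have "(\<lambda>k. L2_norm S (\<phi> k - g')) \<longlonglongrightarrow> 0"
    proof (rule Lim_null_comparison)
      have "L2_norm S (\<phi> k - g') \<le> inverse (real (Suc k)) + L2_norm S (g k - g')" for k
        using s.nrm_triangle_diff[of "\<phi> k" "g k" g'] \<phi>D(2) gS g'(1) \<phi>(3)[of k] by (simp add: l2_nrm)
      then show "\<forall>\<^sub>F k in sequentially. norm (L2_norm S (\<phi> k - g')) \<le> inverse (real (Suc k)) + L2_norm S (g k - g')"
        by (simp add: L2_norm_nonneg)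
      show "(\<lambda>k. inverse (real (Suc k)) + L2_norm S (g k - g')) \<longlonglongrightarrow> 0"
        using tendsto_add[OF LIMSEQ_inverse_real_of_nat g'_lim] by simp
    qed
    ultimately show ?thesis using \<phi>(1) g'(1) unfolding is_trace_iff by blast
  qed
  ultimately show ?thesis using l unfolding H1_vanishing_on_def by blast
qed

lemma vanishing_hilbert: "semi_hilbert (H1_vanishing_on \<Omega> \<Sigma>) h1_inner"
proof -
  have sub: "H1_vanishing_on \<Omega> \<Sigma> \<subseteq> H1 \<Omega>" by (auto simp: H1_vanishing_on_def)
  interpret V: semi_inner "H1_vanishing_on \<Omega> \<Sigma>" h1_inner
    by (rule h.on_subspace[OF subspace_vanishing sub])
  show ?thesis
  proof
    fix X assume X: "V.cauchy_seq X"
    have "h.cauchy_seq X" using X sub by (auto simp: V.cauchy_seq_def h.cauchy_seq_def)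
    then obtain l where l: "l \<in> H1 \<Omega>" "(\<lambda>n. h.nrm (X n - l)) \<longlonglongrightarrow> 0" using h.complete by blast
    have "l \<in> H1_vanishing_on \<Omega> \<Sigma>"
      using vanishing_closed[OF V.cauchy_seqD(1)[OF X] l(1)] l(2) by (simp add: h1_nrm)
    then show "\<exists>l\<in>H1_vanishing_on \<Omega> \<Sigma>. (\<lambda>n. h.nrm (X n - l)) \<longlonglongrightarrow> 0" using l(2) by blast
  qed
qed

end

section \<open>The elastic energy\<close>

lemma contract_nth: "contract C E $ i $ j = C $ i $ j \<bullet> E"
  by (simp add: contract_def inner_vec_def)

lemma contract_add: "contract C (E + F) = contract C E + contract C F"
  by (simp add: vec_eq_iff contract_nth inner_add_right)

lemma contract_scaleR: "contract C (c *\<^sub>R E) = c *\<^sub>R contract C E"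
  by (simp add: vec_eq_iff contract_nth)

text \<open>Cauchy-Schwarz for each entry, since entry (i, j) is the product of the matrix
  \<open>C $ i $ j\<close> with E; summing squares restores the norm of C.\<close>

lemma norm_contract: "norm (contract C E) \<le> norm C * norm E"
proof -
  have "norm (contract C E $ i) \<le> norm (C $ i) * norm E" for i
  proof -
    have "norm (contract C E $ i) = L2_set (\<lambda>j. norm (C $ i $ j \<bullet> E)) UNIV"
      by (simp add: norm_vec_def contract_nth)
    also have "\<dots> \<le> L2_set (\<lambda>j. norm (C $ i $ j) * norm E) UNIV"
      by (intro L2_set_mono) (auto simp: Cauchy_Schwarz_ineq2)
    also have "\<dots> = norm (C $ i) * norm E"
      by (simp add: norm_vec_def[of "C $ i"] L2_set_left_distrib)
    finally show ?thesis .
  qed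
  then have "L2_set (\<lambda>i. norm (contract C E $ i)) UNIV \<le> L2_set (\<lambda>i. norm (C $ i) * norm E) UNIV"
    by (intro L2_set_mono) auto
  then show ?thesis
    by (simp add: norm_vec_def[of "contract C E"] norm_vec_def[of C] L2_set_left_distrib)
qed

lemma inner_contract: "E \<bullet> contract C F = (\<Sum>i\<in>UNIV. \<Sum>j\<in>UNIV. \<Sum>k\<in>UNIV. \<Sum>l\<in>UNIV. C $ i $ j $ k $ l * E $ i $ j * F $ k $ l)"
  by (simp add: inner_vec_def[of E] inner_vec_def[of "E $ _"] contract_def sum_distrib_left algebra_simps)

lemma inner_contract_sym:
  assumes "elasticity_tensor C"
  shows "E \<bullet> contract C F = F \<bullet> contract C E"
proof -
  let ?t = "\<lambda>i j k l. C $ i $ j $ k $ l * E $ i $ j * F $ k $ l"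
  \<comment> \<open>The pairs (i, j) and (k, l) are exchanged by adjacent swaps of sums, after which
    the symmetry between the two index pairs applies.\<close>
  have "E \<bullet> contract C F = (\<Sum>i\<in>UNIV. \<Sum>k\<in>UNIV. \<Sum>j\<in>UNIV. \<Sum>l\<in>UNIV. ?t i j k l)"
    unfolding inner_contract by (rule sum.cong[OF refl]) (rule sum.swap)
  also have "\<dots> = (\<Sum>k\<in>UNIV. \<Sum>i\<in>UNIV. \<Sum>l\<in>UNIV. \<Sum>j\<in>UNIV. ?t i j k l)"
    by (subst sum.swap) (intro sum.cong refl sum.swap)
  also have "\<dots> = (\<Sum>k\<in>UNIV. \<Sum>l\<in>UNIV. \<Sum>i\<in>UNIV. \<Sum>j\<in>UNIV. ?t i j k l)"
    by (rule sum.cong[OF refl]) (rule sum.swap)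
  also have "\<dots> = F \<bullet> contract C E"
    using assms unfolding inner_contract elasticity_tensor_def
    by (intro sum.cong refl) (simp add: mult.commute mult.left_commute)
  finally show ?thesis .
qed

lemma borel_measurable_contract:
  assumes "C \<in> borel_measurable M" "E \<in> borel_measurable M"
  shows "(\<lambda>x. contract (C x) (E x)) \<in> borel_measurable M"
  using assms unfolding contract_def
  by (rule borel_measurable_continuous_Pair)
    (intro continuous_on_vec_lambda continuous_intros continuous_on_component)

lemma norm_transpose: "norm (transpose A) = norm (A :: real^'n^'n)"
proof -
  have "transpose A \<bullet> transpose A = A \<bullet> A"
    unfolding inner_vec_def transpose_def by (simp, rule sum.swap)
  then show ?thesis by (simp add: norm_eq_sqrt_inner)
qed

lemma transpose_add: "transpose (A + B) = transpose A + transpose (B :: real^'n^'m)"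
  and transpose_scaleR: "transpose (c *\<^sub>R A) = c *\<^sub>R transpose (A :: real^'n^'m)"
  by (simp_all add: vec_eq_iff transpose_def)

lemma transpose_strain: "transpose (strain \<Omega> v x) = strain \<Omega> v x"
  by (simp add: strain_def transpose_add transpose_scaleR add.commute)

lemma norm_strain: "norm (strain \<Omega> v x) \<le> norm (weak_gradient \<Omega> v x)"
  using norm_triangle_ineq[of "weak_gradient \<Omega> v x" "transpose (weak_gradient \<Omega> v x)"]
  by (simp add: strain_def norm_transpose)

context sobolev_domain
begin

lemma strain_square_integrable:
  assumes "v \<in> H1 \<Omega>"
  shows "square_integrable M (strain \<Omega> v)"
proof (rule square_integrable_bound[OF H1_D(2)[OF assms]])
  have "continuous_on UNIV (\<lambda>A :: real^'a^'a. (1/2) *\<^sub>R (A + transpose A))"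
    unfolding transpose_def by (intro continuous_on_vec_lambda continuous_intros continuous_on_component)
  from borel_measurable_continuous_on[OF this square_integrable_measurable[OF H1_D(2)[OF assms]]]
  show "strain \<Omega> v \<in> borel_measurable M" by (simp add: strain_def[abs_def])
  show "AE x in M. norm (strain \<Omega> v x) \<le> 1 * norm (weak_gradient \<Omega> v x)" by (simp add: norm_strain)
qed

lemma strain_add:
  "u \<in> H1 \<Omega> \<Longrightarrow> v \<in> H1 \<Omega> \<Longrightarrow> AE x in M. strain \<Omega> (u + v) x = strain \<Omega> u x + strain \<Omega> v x"
  by (rule eventually_mono[OF H1_add(2)[of u v]]) (simp_all add: strain_def transpose_add algebra_simps)

lemma strain_scale:
  "v \<in> H1 \<Omega> \<Longrightarrow> AE x in M. strain \<Omega> (c *\<^sub>R v) x = c *\<^sub>R strain \<Omega> v x"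
  by (rule eventually_mono[OF H1_scale(2)[of v c]]) (simp_all add: strain_def transpose_scaleR algebra_simps)

end

locale elastic =
  fixes P :: "('n::finite) elastic_body"
  assumes setting: "elastic_setting P"
begin

sublocale regular_sobolev_domain "body P"
  using setting by unfold_locales (auto simp: elastic_setting_def)

abbreviation stress :: "(real^'n \<Rightarrow> real^'n) \<Rightarrow> real^'n \<Rightarrow> real^'n^'n" where
  "stress v x \<equiv> contract (stiffness P x) (strain (body P) v x)"

lemma stiffness_bounded: "\<exists>m. AE x in M. norm (stiffness P x) \<le> m"
  and density_bounded: "\<exists>m. AE x in M. \<bar>density P x\<bar> \<le> m"
  and stiffness_measurable: "stiffness P \<in> borel_measurable M"
  and density_measurable: "density P \<in> borel_measurable M"
  and stiffness_sym: "AE x in M. elasticity_tensor (stiffness P x)"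
  and stiffness_elliptic: "\<exists>c>0. AE x in M.
        \<forall>E. transpose E = E \<longrightarrow> c * (E \<bullet> E) \<le> E \<bullet> contract (stiffness P x) E"
  and density_pos: "\<exists>r>0. AE x in M. r \<le> density P x"
  and frequency_pos: "0 < frequency P"
  using setting by (simp_all add: elastic_setting_def)

lemma stress_le: "\<exists>m\<ge>0. \<forall>v. AE x in M. norm (stress v x) \<le> m * norm (strain (body P) v x)"
proof -
  obtain m where m: "AE x in M. norm (stiffness P x) \<le> m" using stiffness_bounded by blast
  have "AE x in M. norm (stress v x) \<le> \<bar>m\<bar> * norm (strain (body P) v x)" for v
    using m
  proof eventually_elim
    case (elim x)
    have "norm (stress v x) \<le> norm (stiffness P x) * norm (strain (body P) v x)" by (rule norm_contract)
    also have "\<dots> \<le> \<bar>m\<bar> * norm (strain (body P) v x)" using elim by (intro mult_right_mono) auto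
    finally show ?case .
  qed
  then show ?thesis by (intro exI[of _ "\<bar>m\<bar>"]) auto
qed

lemma stress_square_integrable:
  assumes "v \<in> H1 (body P)"
  shows "square_integrable M (stress v)"
proof -
  note E = strain_square_integrable[OF assms]
  obtain m where "AE x in M. norm (stress v x) \<le> m * norm (strain (body P) v x)"
    using stress_le by blast
  with borel_measurable_contract[OF stiffness_measurable square_integrable_measurable[OF E]]
  show ?thesis by (rule square_integrable_bound[OF E])
qed

lemma weighted_square_integrable:
  fixes v :: "real^'n \<Rightarrow> real^'n"
  assumes "square_integrable M v"
  shows "square_integrable M (\<lambda>x. density P x *\<^sub>R v x)"
proof -
  obtain m where m: "AE x in M. \<bar>density P x\<bar> \<le> m" using density_bounded by blast
  show ?thesis
  proof (rule square_integrable_bound[OF assms])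
    show "(\<lambda>x. density P x *\<^sub>R v x) \<in> borel_measurable M"
      by (intro borel_measurable_scaleR density_measurable square_integrable_measurable assms)
    show "AE x in M. norm (density P x *\<^sub>R v x) \<le> m * norm (v x)"
      using m by eventually_elim (simp add: mult_right_mono)
  qed
qed

lemma form_A_eq: "form_A P u v = l2_inner M (strain (body P) u) (stress v)"
  by (simp add: form_A_def l2_inner_def)

lemma mass_form_eq: "mass_form P u v = l2_inner M (\<lambda>x. density P x *\<^sub>R u x) v"
  by (simp add: mass_form_def l2_inner_def)

lemma elliptic_form_A: "\<exists>c>0. \<forall>v\<in>H1 (body P). c * (L2_norm M (strain (body P) v))\<^sup>2 \<le> form_A P v v"
proof -
  obtain c where c: "0 < c" "AE x in M.
        \<forall>E. transpose E = E \<longrightarrow> c * (E \<bullet> E) \<le> E \<bullet> contract (stiffness P x) E"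
    using stiffness_elliptic by blast
  have "c * (L2_norm M (strain (body P) v))\<^sup>2 \<le> form_A P v v" if v: "v \<in> H1 (body P)" for v
    unfolding L2_norm_square form_A_eq unfolding l2_inner_def integral_mult_right_zero[symmetric]
  proof (rule integral_mono_AE)
    show "AE x in M. c * (strain (body P) v x \<bullet> strain (body P) v x) \<le> strain (body P) v x \<bullet> stress v x"
      using c(2) by eventually_elim (simp add: transpose_strain)
  qed (use v in \<open>auto intro!: integrable_mult_right square_integrable_inner strain_square_integrable
      stress_square_integrable\<close>)
  then show ?thesis using c(1) by blast
qed

lemma mass_form_pos: "\<exists>r>0. \<forall>v\<in>H1 (body P). r * (L2_norm M v)\<^sup>2 \<le> mass_form P v v"
proof -
  obtain r where r: "0 < r" "AE x in M. r \<le> density P x" using density_pos by blast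
  have "r * (L2_norm M v)\<^sup>2 \<le> mass_form P v v" if v: "v \<in> H1 (body P)" for v
    unfolding L2_norm_square mass_form_eq unfolding l2_inner_def integral_mult_right_zero[symmetric]
  proof (rule integral_mono_AE)
    show "AE x in M. r * (v x \<bullet> v x) \<le> (density P x *\<^sub>R v x) \<bullet> v x"
      using r(2) by eventually_elim (simp add: mult_right_mono)
  qed (use H1_D(1)[OF v] in \<open>auto intro!: integrable_mult_right square_integrable_inner
      weighted_square_integrable simp del: inner_scaleR_left\<close>)
  then show ?thesis using r(1) by blast
qed

text \<open>Strain is additive only almost everywhere, so the stress in the second argument is
  replaced under the integral; linearity in the first argument then follows from symmetry of the
  stiffness.\<close>

lemma form_A_semi_inner: "semi_inner (H1 (body P)) (form_A P)"
proof
  show "linear_form_on (H1 (body P)) (form_A P u)" if u: "u \<in> H1 (body P)" for u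
    unfolding linear_form_on_def
  proof (intro conjI ballI allI)
    fix v w assume v: "v \<in> H1 (body P)" and w: "w \<in> H1 (body P)"
    have "form_A P u (v + w) = l2_inner M (strain (body P) u) (stress v + stress w)"
      unfolding form_A_eq
    proof (rule l2_inner_cong_AE)
      show "AE x in M. stress (v + w) x = (stress v + stress w) x"
        using strain_add[OF v w] by eventually_elim (simp add: contract_add)
      show "square_integrable M (stress v + stress w)"
        using v w g.closed_ops(2) stress_square_integrable by blast
    qed (use u v w in \<open>auto intro!: strain_square_integrable stress_square_integrable H1_add\<close>)
    then show "form_A P u (v + w) = form_A P u v + form_A P u w"
      using u v w by (simp add: form_A_eq g.add_right strain_square_integrable stress_square_integrable)
  next
    fix c v assume v: "v \<in> H1 (body P)"
    have "form_A P u (c *\<^sub>R v) = l2_inner M (strain (body P) u) (c *\<^sub>R stress v)"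
      unfolding form_A_eq
    proof (rule l2_inner_cong_AE)
      show "AE x in M. stress (c *\<^sub>R v) x = (c *\<^sub>R stress v) x"
        using strain_scale[OF v, of c] by eventually_elim (simp add: contract_scaleR)
      show "square_integrable M (c *\<^sub>R stress v)"
        using v g.closed_ops(3) stress_square_integrable by blast
    qed (use u v in \<open>auto intro!: strain_square_integrable stress_square_integrable H1_scale\<close>)
    then show "form_A P u (c *\<^sub>R v) = c * form_A P u v"
      using u v by (simp add: form_A_eq g.scale_right strain_square_integrable stress_square_integrable)
  qed
  show "form_A P u v = form_A P v u" if "u \<in> H1 (body P)" "v \<in> H1 (body P)" for u v
    unfolding form_A_eq unfolding l2_inner_def
  proof (rule integral_cong_AE)
    show "AE x in M. strain (body P) u x \<bullet> stress v x = strain (body P) v x \<bullet> stress u x"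
      using stiffness_sym by eventually_elim (rule inner_contract_sym)
  qed (use that in \<open>simp_all add: borel_measurable_inner square_integrable_measurable
      strain_square_integrable stress_square_integrable\<close>)
  show "0 \<le> form_A P u u" if "u \<in> H1 (body P)" for u
    using elliptic_form_A that by (meson less_imp_le mult_nonneg_nonneg order_trans zero_le_power2)
qed (rule subspace_H1)

lemma mass_form_semi_inner: "semi_inner (H1 (body P)) (mass_form P)"
proof
  show "linear_form_on (H1 (body P)) (mass_form P u)" if u: "u \<in> H1 (body P)" for u
    using u by (simp add: linear_form_on_def mass_form_eq v.add_right v.scale_right
        weighted_square_integrable H1_D)
  show "mass_form P u v = mass_form P v u" for u v
    by (simp add: mass_form_def inner_commute)
  show "0 \<le> mass_form P u u" if "u \<in> H1 (body P)" for u
    using mass_form_pos that by (meson less_imp_le mult_nonneg_nonneg order_trans zero_le_power2)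
qed (rule subspace_H1)

sublocale A: semi_inner "H1 (body P)" "form_A P"
  by (rule form_A_semi_inner)

sublocale mass: semi_inner "H1 (body P)" "mass_form P"
  by (rule mass_form_semi_inner)

section \<open>The energy inner product and its equivalence with H^1\<close>

lemma inner_w_semi_inner: "semi_inner (H1 (body P)) (inner_w P)"
proof
  show "linear_form_on (H1 (body P)) (inner_w P u)" if "u \<in> H1 (body P)" for u
    using that by (simp add: linear_form_on_def inner_w_def A.bilinear_simps mass.bilinear_simps algebra_simps)
  show "inner_w P u v = inner_w P v u" if "u \<in> H1 (body P)" "v \<in> H1 (body P)" for u v
    using that by (simp add: inner_w_def A.sym[of u v] mass.sym[of u v])
  show "0 \<le> inner_w P u u" if "u \<in> H1 (body P)" for u
    using that by (simp add: inner_w_def A.nonneg mass.nonneg)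
qed (rule subspace_H1)

sublocale w: semi_inner "H1 (body P)" "inner_w P"
  by (rule inner_w_semi_inner)

lemma w_nrm: "w.nrm v = norm_w P v"
  by (simp add: w.nrm_def norm_w_def)

lemma h1_inner_self: "h1_inner v v = (H1_norm (body P) v)\<^sup>2"
  by (simp add: h1_inner_def H1_norm_def flip: L2_norm_square)

text \<open>Korn's second inequality needs both the strain and the L2 norm. Ellipticity controls the
  former, and the mass term, with \<omega> > 0 and density bounded below, the latter, so the bound
  holds on all of H^1.\<close>

lemma inner_w_lower: "\<exists>c>0. \<forall>v\<in>H1 (body P). c * h1_inner v v \<le> inner_w P v v"
proof -
  obtain c where c: "0 < c" "\<And>v. v \<in> H1 (body P) \<Longrightarrow> c * (L2_norm M (strain (body P) v))\<^sup>2 \<le> form_A P v v"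
    using elliptic_form_A by blast
  obtain r where r: "0 < r" "\<And>v. v \<in> H1 (body P) \<Longrightarrow> r * (L2_norm M v)\<^sup>2 \<le> mass_form P v v"
    using mass_form_pos by blast
  obtain k where k: "\<And>v. v \<in> H1 (body P) \<Longrightarrow> (H1_norm (body P) v)\<^sup>2 \<le>
        k * ((L2_norm M v)\<^sup>2 + (L2_norm M (strain (body P) v))\<^sup>2)"
    using regular unfolding regular_domain_def by blast
  define m where "m = min c ((frequency P)\<^sup>2 * r)"
  have m: "0 < m" using c(1) r(1) frequency_pos by (simp add: m_def)
  have "m / (\<bar>k\<bar> + 1) * h1_inner v v \<le> inner_w P v v" if v: "v \<in> H1 (body P)" for v
  proof -
    let ?s = "(L2_norm M v)\<^sup>2 + (L2_norm M (strain (body P) v))\<^sup>2"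
    have "h1_inner v v \<le> k * ?s" using k[OF v] by (simp add: h1_inner_self)
    also have "\<dots> \<le> (\<bar>k\<bar> + 1) * ?s" by (intro mult_right_mono) auto
    finally have "h1_inner v v / (\<bar>k\<bar> + 1) \<le> ?s" by (simp add: pos_divide_le_eq mult.commute)
    then have "m * (h1_inner v v / (\<bar>k\<bar> + 1)) \<le> m * ?s" using m by (intro mult_left_mono) auto
    also have "\<dots> = m * (L2_norm M (strain (body P) v))\<^sup>2 + m * (L2_norm M v)\<^sup>2" by (simp add: algebra_simps)
    also have "\<dots> \<le> c * (L2_norm M (strain (body P) v))\<^sup>2 + ((frequency P)\<^sup>2 * r) * (L2_norm M v)\<^sup>2"
      by (intro add_mono mult_right_mono) (auto simp: m_def)
    also have "\<dots> \<le> form_A P v v + (frequency P)\<^sup>2 * mass_form P v v"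
      unfolding mult.assoc using c(2)[OF v] r(2)[OF v] by (intro add_mono mult_left_mono) auto
    finally show ?thesis by (simp add: inner_w_def)
  qed
  then show ?thesis using m by (intro exI[of _ "m / (\<bar>k\<bar> + 1)"]) auto
qed

lemma inner_w_upper: "\<exists>C. \<forall>v\<in>H1 (body P). inner_w P v v \<le> C * h1_inner v v"
proof -
  obtain a where a: "0 \<le> a" "\<And>v. AE x in M. norm (stress v x) \<le> a * norm (strain (body P) v x)"
    using stress_le by blast
  obtain r where r: "AE x in M. \<bar>density P x\<bar> \<le> r" using density_bounded by blast
  have A_le: "form_A P v v \<le> a * l2_inner M (weak_gradient (body P) v) (weak_gradient (body P) v)"
    if v: "v \<in> H1 (body P)" for v
    unfolding form_A_eq unfolding l2_inner_def integral_mult_right_zero[symmetric]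
  proof (rule integral_mono_AE)
    show "AE x in M. strain (body P) v x \<bullet> stress v x \<le> a * (weak_gradient (body P) v x \<bullet> weak_gradient (body P) v x)"
      using a(2)[of v]
    proof eventually_elim
      case (elim x)
      have "strain (body P) v x \<bullet> stress v x \<le> norm (strain (body P) v x) * norm (stress v x)"
        by (rule norm_cauchy_schwarz)
      also have "\<dots> \<le> norm (weak_gradient (body P) v x) * (a * norm (weak_gradient (body P) v x))"
        using norm_strain[of "body P" v x] a(1)
        by (intro mult_mono order_trans[OF elim] mult_left_mono) auto
      finally show ?case by (simp add: dot_square_norm power2_eq_square algebra_simps)
    qed
  qed (use v in \<open>auto intro!: integrable_mult_right square_integrable_inner strain_square_integrable
      stress_square_integrable H1_D\<close>)
  have mass_le: "mass_form P v v \<le> \<bar>r\<bar> * l2_inner M v v" if v: "v \<in> H1 (body P)" for v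
    unfolding mass_form_eq unfolding l2_inner_def integral_mult_right_zero[symmetric]
  proof (rule integral_mono_AE)
    show "AE x in M. (density P x *\<^sub>R v x) \<bullet> v x \<le> \<bar>r\<bar> * (v x \<bullet> v x)"
      using r by eventually_elim (simp add: mult_right_mono)
  qed (use H1_D(1)[OF v] in \<open>auto intro!: integrable_mult_right square_integrable_inner
      weighted_square_integrable simp del: inner_scaleR_left\<close>)
  have "inner_w P v v \<le> (a + (frequency P)\<^sup>2 * \<bar>r\<bar>) * h1_inner v v" if v: "v \<in> H1 (body P)" for v
  proof -
    let ?l = "l2_inner M v v" and ?g = "l2_inner M (weak_gradient (body P) v) (weak_gradient (body P) v)"
    have pos: "0 \<le> ?l" "0 \<le> ?g" by (simp_all add: l2_inner_def)
    have "inner_w P v v \<le> a * ?g + (frequency P)\<^sup>2 * (\<bar>r\<bar> * ?l)"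
      unfolding inner_w_def using A_le[OF v] mass_le[OF v] by (intro add_mono mult_left_mono) auto
    also have "\<dots> \<le> (a + (frequency P)\<^sup>2 * \<bar>r\<bar>) * (?l + ?g)"
      using a(1) pos by (simp add: algebra_simps)
    finally show ?thesis by (simp add: h1_inner_def)
  qed
  then show ?thesis by blast
qed

lemma w_hilbert: "semi_hilbert (H1_vanishing_on (body P) \<Sigma>) (inner_w P)"
proof -
  have sub: "H1_vanishing_on (body P) \<Sigma> \<subseteq> H1 (body P)" by (auto simp: H1_vanishing_on_def)
  obtain c C where "0 < c" "\<forall>v\<in>H1 (body P). c * h1_inner v v \<le> inner_w P v v"
    "\<forall>v\<in>H1 (body P). inner_w P v v \<le> C * h1_inner v v"
    using inner_w_lower inner_w_upper by blast
  with sub show ?thesis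
    by (intro semi_hilbert.equivalent_complete[OF vanishing_hilbert w.on_subspace[OF subspace_vanishing sub], of c C]) auto
qed

text \<open>Links the two notions of equality: uniqueness and the decomposition are stated almost
  everywhere, while the abstract results speak of differences of norm zero.\<close>

lemma field_eq_iff:
  assumes u: "u \<in> H1 (body P)" and v: "v \<in> H1 (body P)"
  shows "field_eq P u v \<longleftrightarrow> norm_w P (u - v) = 0"
proof
  note uv = H1_diff(1)[OF u v]
  assume "field_eq P u v"
  then have ae: "AE x in M. (u - v) x = (0 :: real^'n \<Rightarrow> real^'n) x"
    unfolding field_eq_def by eventually_elim simp
  \<comment> \<open>A field vanishing a.e. is orthogonal to everything in L2, in particular to
    derivatives of test functions, so 0 is one of its weak gradients.\<close>
  have orth: "l2_inner M (u - v) z = 0" if "square_integrable M z" for z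
    using l2_inner_cong_AE[OF H1_D(1)[OF uv] _ that that ae] v.minus_left[of z 0] that
    by (simp add: zero_fun_def l2_inner_def)
  note zero = orth[OF H1_D(1)[OF uv]]
  have grad: "has_weak_gradient (body P) (u - v) 0"
    unfolding has_weak_gradient_iff using orth[OF test_square_integrable(1)] by (simp add: l2_inner_def)
  have sq0: "square_integrable M (0 :: real^'n \<Rightarrow> real^'n^'n)" by (simp add: zero_fun_def)
  have "l2_inner M (weak_gradient (body P) (u - v)) (weak_gradient (body P) (u - v))
      = l2_inner M (0 :: real^'n \<Rightarrow> real^'n^'n) 0"
    using H1_I(2)[OF H1_D(1)[OF uv] sq0 grad] H1_D(2)[OF uv] sq0 by (intro l2_inner_cong_AE)
  then have "h1_inner (u - v) (u - v) = 0" using zero by (simp add: h1_inner_def l2_inner_def)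
  then have "inner_w P (u - v) (u - v) \<le> 0" using inner_w_upper uv by (metis mult_zero_right)
  then show "norm_w P (u - v) = 0" using w.nonneg[OF uv] by (simp add: norm_w_def)
next
  note uv = H1_diff(1)[OF u v]
  assume "norm_w P (u - v) = 0"
  then have "inner_w P (u - v) (u - v) = 0" by (simp add: norm_w_def)
  moreover obtain c where c: "0 < c" "c * h1_inner (u - v) (u - v) \<le> inner_w P (u - v) (u - v)"
    using inner_w_lower uv by blast
  ultimately have "h1_inner (u - v) (u - v) \<le> 0" by (simp add: mult_le_0_iff)
  then have "l2_inner M (u - v) (u - v) = 0"
    using L2_norm_square[of M "u - v"] L2_norm_square[of M "weak_gradient (body P) (u - v)"]
      zero_le_power2[of "L2_norm M (u - v)"] zero_le_power2[of "L2_norm M (weak_gradient (body P) (u - v))"]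
    by (simp add: h1_inner_def)
  then have "AE x in M. (u - v) x \<bullet> (u - v) x = 0"
    using square_integrable_inner[OF H1_D(1)[OF uv] H1_D(1)[OF uv]]
    unfolding l2_inner_def by (subst (asm) integral_nonneg_eq_0_iff_AE) auto
  then show "field_eq P u v" unfolding field_eq_def by eventually_elim simp
qed

end

section \<open>The coupled elastodynamic problem\<close>

lemma linear_functional_on_iff: "linear_functional_on V F \<longleftrightarrow> linear_form_on V F"
  by (simp add: linear_functional_on_def linear_form_on_def plus_fun_def scaleR_fun_def)

context elastic
begin

lemma space_U_H1: "space_U P \<subseteq> H1 (body P)" and space_W_U: "space_W P \<subseteq> space_U P"
  by (auto simp: space_U_def space_W_def H1_vanishing_on_def)

lemma norm_w_nonneg: "v \<in> H1 (body P) \<Longrightarrow> 0 \<le> norm_w P v"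
  using w.nrm_nonneg by (simp add: w_nrm)

text \<open>A real supremum is meaningful only for a nonempty set that is bounded above; boundedness
  comes from membership in the dual space. That membership also forces F to vanish where the norm
  does, which rescues the estimate where the quotient is 0/0.\<close>

lemma dual_norm:
  assumes F: "F \<in> dual_space P V" and V: "V \<subseteq> H1 (body P)" and V': "V' \<subseteq> V"
  shows "\<forall>v\<in>V'. \<bar>F v\<bar> \<le> dual_norm P V' F * norm_w P v"
    and "V' \<noteq> {} \<Longrightarrow> 0 \<le> dual_norm P V' F"
    and "V' \<noteq> {} \<Longrightarrow> dual_norm P V' F \<le> dual_norm P V F"
proof -
  obtain m where m: "\<And>v. v \<in> V \<Longrightarrow> \<bar>F v\<bar> \<le> m * norm_w P v" using F by (auto simp: dual_space_def)
  have pos: "0 \<le> norm_w P v" if "v \<in> V" for v using norm_w_nonneg V that by blast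
  have "\<bar>F v\<bar> / norm_w P v \<le> \<bar>m\<bar>" if v: "v \<in> V" for v
  proof (cases "norm_w P v = 0")
    case False
    have "\<bar>F v\<bar> \<le> \<bar>m\<bar> * norm_w P v"
      using m[OF v] mult_right_mono[OF abs_ge_self[of m] pos[OF v]] by linarith
    then show ?thesis using False pos[OF v] by (simp add: divide_le_eq)
  qed simp
  then have bdd: "bdd_above ((\<lambda>v. \<bar>F v\<bar> / norm_w P v) ` V)" by (intro bdd_aboveI2)
  then have bdd': "bdd_above ((\<lambda>v. \<bar>F v\<bar> / norm_w P v) ` V')"
    using V' by (meson bdd_above_mono image_mono)
  have upper: "\<bar>F v\<bar> / norm_w P v \<le> dual_norm P V' F" if "v \<in> V'" for v
    unfolding dual_norm_def using that by (rule cSUP_upper[OF _ bdd'])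
  show "\<forall>v\<in>V'. \<bar>F v\<bar> \<le> dual_norm P V' F * norm_w P v"
  proof
    fix v assume v: "v \<in> V'"
    show "\<bar>F v\<bar> \<le> dual_norm P V' F * norm_w P v"
    proof (cases "norm_w P v = 0")
      case True
      then show ?thesis using m[of v] v V' by auto
    next
      case False
      then show ?thesis using upper[OF v] pos[of v] v V' by (simp add: divide_le_eq subset_iff)
    qed
  qed
  show "0 \<le> dual_norm P V' F" if "V' \<noteq> {}"
  proof -
    obtain v where v: "v \<in> V'" using \<open>V' \<noteq> {}\<close> by blast
    have "0 \<le> \<bar>F v\<bar> / norm_w P v" using pos[of v] v V' by auto
    then show ?thesis using upper[OF v] by linarith
  qed
  show "dual_norm P V' F \<le> dual_norm P V F" if "V' \<noteq> {}"
    unfolding dual_norm_def using that bdd V' by (rule cSUP_subset_mono) simp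
qed

text \<open>The elastic and the mass part each satisfy Cauchy-Schwarz with norms below
  \<open>norm_w\<close>; the crude constant 2 is harmless because it instantiates only
  \<open>M\<close>.\<close>

lemma form_B_bounded:
  assumes u: "u \<in> H1 (body P)" and v: "v \<in> H1 (body P)"
  shows "\<bar>form_B P u v\<bar> \<le> 2 * norm_w P u * norm_w P v"
proof -
  have A: "A.nrm v \<le> norm_w P v" if "v \<in> H1 (body P)" for v
    using mass.nonneg[OF that] by (simp add: A.nrm_def norm_w_def inner_w_def)
  have m: "frequency P * mass.nrm v \<le> norm_w P v" if "v \<in> H1 (body P)" for v
  proof -
    have "frequency P * mass.nrm v = sqrt ((frequency P)\<^sup>2 * mass_form P v v)"
      using frequency_pos by (simp add: mass.nrm_def real_sqrt_mult)
    then show ?thesis using A.nonneg[OF that] by (simp add: norm_w_def inner_w_def)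
  qed
  have "\<bar>form_A P u v\<bar> \<le> norm_w P u * norm_w P v"
    using A.cauchy_schwarz[OF u v] mult_mono[OF A[OF u] A[OF v] norm_w_nonneg[OF u] A.nrm_nonneg[OF v]]
    by linarith
  moreover have "\<bar>(frequency P)\<^sup>2 * mass_form P u v\<bar> \<le> norm_w P u * norm_w P v"
  proof -
    have "\<bar>(frequency P)\<^sup>2 * mass_form P u v\<bar> \<le> (frequency P)\<^sup>2 * (mass.nrm u * mass.nrm v)"
      unfolding abs_mult using mass.cauchy_schwarz[OF u v] by (simp add: mult_left_mono)
    also have "\<dots> = (frequency P * mass.nrm u) * (frequency P * mass.nrm v)"
      by (simp add: power2_eq_square algebra_simps)
    also have "\<dots> \<le> norm_w P u * norm_w P v"
      using frequency_pos mass.nrm_nonneg[OF v]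
      by (intro mult_mono m u v norm_w_nonneg mult_nonneg_nonneg) auto
    finally show ?thesis .
  qed
  ultimately show ?thesis unfolding form_B_def by linarith
qed

text \<open>Translates the infimum in the extended reals into the quotient-free condition of
  \<open>coupled_problem\<close>.\<close>

lemma inf_sup_constant_le:
  assumes \<beta>: "ereal \<beta> = inf_sup_constant P" and w: "w \<in> perp_K P" and c: "0 \<le> c"
    and le: "\<And>u. u \<in> space_U P \<Longrightarrow> form_B P u w \<le> c * norm_w P u"
  shows "\<beta> * norm_w P w \<le> c"
proof (cases "norm_w P w = 0")
  case True
  then show ?thesis using c by simp
next
  case False
  have wH: "w \<in> H1 (body P)" using w space_W_U space_U_H1 by (auto simp: perp_K_def)
  then have pos: "0 < norm_w P w" using False norm_w_nonneg by (simp add: less_le)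
  have "ereal \<beta> \<le> (SUP u\<in>{u \<in> space_U P. norm_w P u \<noteq> 0}. ereal (form_B P u w / (norm_w P u * norm_w P w)))"
    unfolding \<beta> inf_sup_constant_def using w False by (intro INF_lower) simp
  also have "\<dots> \<le> ereal (c / norm_w P w)"
  proof (rule SUP_least)
    fix u assume u: "u \<in> {u \<in> space_U P. norm_w P u \<noteq> 0}"
    then have "0 < norm_w P u" using norm_w_nonneg[of u] space_U_H1 by (auto simp: less_le)
    then show "ereal (form_B P u w / (norm_w P u * norm_w P w)) \<le> ereal (c / norm_w P w)"
      using le[of u] u pos by (simp add: field_simps)
  qed
  finally show ?thesis using pos by (simp add: pos_le_divide_eq)
qed

end

text \<open>The nine coefficients of the three bounds, grouped by the norms of f, of g on H and of g
  on its complement; the last two norms are at most that of g.\<close>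

definition stability_constant :: "real \<Rightarrow> real \<Rightarrow> real \<Rightarrow> real \<Rightarrow> real \<Rightarrow> real \<Rightarrow> real" where
  "stability_constant \<kappa> \<alpha> \<beta> \<delta> a d =
    (let qa = a / \<alpha>; qd = d / \<delta>; ra = a / \<beta>;
         Q = \<kappa> * inverse \<alpha> * (qd * ra + sqrt (4 * \<alpha> * inverse (\<kappa> * \<delta>) + qd\<^sup>2 * ra\<^sup>2)) / 2
     in (inverse \<alpha> + inverse \<beta> * qd * (1 + qa) + inverse \<beta> * (1 + qa))
      + (Q + (inverse \<delta> + qd * ra * Q) + ra * Q)
      + (\<kappa> * inverse \<beta> * qa + \<kappa> * inverse \<beta> * qa * qd * ra + \<kappa> * inverse \<beta> * qa * ra))"

text \<open>C is quantified before the body and the data, which expresses that it depends on the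
  listed constants only. The bounds are claimed for every decomposition of u that holds almost
  everywhere. The coefficient of the norm of d_0 in the bound for u_0 starts with
  \<open>inverse \<delta>\<close>, and a summand 1 in its place would be wrong: for D equal to
  \<delta> times the energy product, f = 0 and d vanishing on the complement of a nontrivial H, the
  solution has w = 0, u_1 = 0 and |u_0| = |d_0|/\<delta>, while Q with q_d = 1 grows only like the
  inverse square root of \<delta> as \<delta> tends to 0.\<close>

theorem theorem1:
  assumes "CARD('n::finite) \<le> 3"
  shows "\<exists>C :: real \<Rightarrow> real \<Rightarrow> real \<Rightarrow> real \<Rightarrow> real \<Rightarrow> real \<Rightarrow> real.
    \<forall>(P :: 'n elastic_body) D a d \<alpha> \<beta> \<delta>.
      elastic_setting P \<longrightarrow>
      symmetric_positive_form_on (space_U P) D \<longrightarrow>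
      0 < a \<longrightarrow> (\<forall>w\<in>space_W P. \<forall>w'\<in>space_W P. form_A P w w' \<le> a * norm_w P w * norm_w P w') \<longrightarrow>
      0 < d \<longrightarrow> (\<forall>u\<in>space_U P. \<forall>u'\<in>space_U P. D u u' \<le> d * norm_w P u * norm_w P u') \<longrightarrow>
      0 < \<delta> \<longrightarrow> (\<forall>v\<in>null_H P. \<delta> * (norm_w P v)\<^sup>2 \<le> D v v) \<longrightarrow>
      0 < hausdorff_outer (CARD('n) - 1) (dirichlet P \<union> unspecified P) \<longrightarrow>
      0 < \<alpha> \<longrightarrow> (\<forall>w\<in>space_W P. \<alpha> * (norm_w P w)\<^sup>2 \<le> form_A P w w) \<longrightarrow>
      0 < \<beta> \<longrightarrow> ereal \<beta> = inf_sup_constant P \<longrightarrow>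
      (\<forall>f\<in>dual_space P (space_W P). \<forall>g\<in>dual_space P (space_U P). \<forall>\<kappa>>0.
        let nf = dual_norm P (space_W P) f;
            ng = dual_norm P (space_U P) g;
            ng\<^sub>0 = dual_norm P (null_H P) g;
            ng\<^sub>1 = dual_norm P (perp_H P) g;
            q\<^sub>a = a / \<alpha>; q\<^sub>d = d / \<delta>; r\<^sub>a = a / \<beta>; r\<^sub>d = d / \<beta>;
            Q = \<kappa> * inverse \<alpha> * (q\<^sub>d * r\<^sub>a + sqrt (4 * \<alpha> * inverse (\<kappa> * \<delta>) + q\<^sub>d\<^sup>2 * r\<^sub>a\<^sup>2)) / 2
        in \<exists>w u. solves_coupled P D \<kappa> f g w u \<and>
             (\<forall>w' u'. solves_coupled P D \<kappa> f g w' u' \<longrightarrow> field_eq P w' w \<and> field_eq P u' u) \<and>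
             norm_w P u + norm_w P w \<le> C \<kappa> \<alpha> \<beta> \<delta> a d * (nf + ng) \<and>
             (\<exists>u\<^sub>0\<in>null_H P. \<exists>u\<^sub>1\<in>perp_H P. field_eq P u (\<lambda>x. u\<^sub>0 x + u\<^sub>1 x)) \<and>
             (\<forall>u\<^sub>0\<in>null_H P. \<forall>u\<^sub>1\<in>perp_H P. field_eq P u (\<lambda>x. u\<^sub>0 x + u\<^sub>1 x) \<longrightarrow>
                norm_w P w \<le> inverse \<alpha> * nf + Q * ng\<^sub>0 + \<kappa> * inverse \<beta> * q\<^sub>a * ng\<^sub>1 \<and>
                norm_w P u\<^sub>0 \<le> inverse \<beta> * q\<^sub>d * (1 + q\<^sub>a) * nf
                   + (inverse \<delta> + q\<^sub>d * r\<^sub>a * Q) * ng\<^sub>0 + \<kappa> * inverse \<beta> * q\<^sub>a * q\<^sub>d * r\<^sub>a * ng\<^sub>1 \<and>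
                norm_w P u\<^sub>1 \<le> inverse \<beta> * (1 + q\<^sub>a) * nf + r\<^sub>a * Q * ng\<^sub>0
                   + \<kappa> * inverse \<beta> * q\<^sub>a * r\<^sub>a * ng\<^sub>1))"
proof (rule exI[of _ stability_constant], intro allI impI ballI, goal_cases)
  case (1 P D a d \<alpha> \<beta> \<delta> f g \<kappa>)
  note hyps = 1
  interpret elastic P by unfold_locales (rule hyps(1))
  have U_H1: "u \<in> space_U P \<Longrightarrow> u \<in> H1 (body P)" and W_H1: "w \<in> space_W P \<Longrightarrow> w \<in> H1 (body P)" for u w
    using space_U_H1 space_W_U by auto
  interpret U: semi_hilbert "space_U P" "inner_w P" unfolding space_U_def by (rule w_hilbert)
  interpret W: semi_hilbert "space_W P" "inner_w P" unfolding space_W_def by (rule w_hilbert)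
  have B_linear: "linear_form_on (H1 (body P)) (form_B P u)"
    and B_linear_left: "linear_form_on (H1 (body P)) (\<lambda>v. form_B P v u)" if "u \<in> H1 (body P)" for u
    using that by (simp_all add: linear_form_on_def form_B_def A.bilinear_simps mass.bilinear_simps algebra_simps)
  note D = hyps(2)[unfolded symmetric_positive_form_on_def linear_functional_on_iff]
  interpret cp: coupled_problem "space_U P" "space_W P" "inner_w P" "form_A P" "form_B P" D a d \<alpha> \<beta> \<delta> 2
    "null_H P" "null_K P" "perp_H P" "perp_K P"
  \<comment> \<open>The complements are folded last because their definitions mention
    \<open>null_H P\<close> and \<open>null_K P\<close>.\<close>
  proof (unfold_locales, unfold w_nrm, fold null_H_def null_K_def, fold perp_H_def perp_K_def)
    show "linear_form_on (space_W P) (form_A P w)" if "w \<in> space_W P" for w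
      using linear_form_on_subset[OF A.linear[OF W_H1[OF that]]] W_H1 by blast
    show "form_A P w w' = form_A P w' w" if "w \<in> space_W P" "w' \<in> space_W P" for w w'
      using that by (intro A.sym W_H1)
    show "linear_form_on (space_W P) (form_B P u)" if "u \<in> space_U P" for u
      using linear_form_on_subset[OF B_linear[OF U_H1[OF that]]] W_H1 by blast
    show "linear_form_on (space_U P) (\<lambda>u. form_B P u w)" if "w \<in> space_W P" for w
      using linear_form_on_subset[OF B_linear_left[OF W_H1[OF that]]] U_H1 by blast
    show "\<bar>form_B P u w\<bar> \<le> 2 * norm_w P u * norm_w P w" if "u \<in> space_U P" "w \<in> space_W P" for u w
      using that by (intro form_B_bounded U_H1 W_H1)
    show "\<beta> * norm_w P w \<le> c" if "w \<in> perp_K P" "0 \<le> c"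
      "\<And>u. u \<in> space_U P \<Longrightarrow> form_B P u w \<le> c * norm_w P u" for w c
      by (rule inf_sup_constant_le[OF hyps(13) that])
  qed (use hyps(3-12) D space_W_U in auto)
  let ?nf = "dual_norm P (space_W P) f" and ?ng = "dual_norm P (space_U P) g"
    and ?ngH = "dual_norm P (null_H P) g" and ?ngP = "dual_norm P (perp_H P) g"
  define Q where "Q = \<kappa> * inverse \<alpha> * (d / \<delta> * (a / \<beta>)
    + sqrt (4 * \<alpha> * inverse (\<kappa> * \<delta>) + (d / \<delta>)\<^sup>2 * (a / \<beta>)\<^sup>2)) / 2"
  have \<kappa>: "0 < \<kappa>" by (rule hyps(16))
  have f_lin: "linear_form_on (space_W P) f" and g_lin: "linear_form_on (space_U P) g"
    using hyps(14,15) by (simp_all add: dual_space_def linear_functional_on_iff)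
  \<comment> \<open>Nonemptiness makes the suprema in the dual norms meaningful; for
    \<open>perp_H P\<close> an element comes from decomposing the zero field.\<close>
  have ne: "space_W P \<noteq> {}" "space_U P \<noteq> {}" "null_H P \<noteq> {}" "perp_H P \<noteq> {}"
    and sub: "null_H P \<subseteq> space_U P" "perp_H P \<subseteq> space_U P"
    using W.closed_ops(1) U.closed_ops(1) cp.H.closed_ops(1) cp.decomposition[OF U.closed_ops(1)]
      cp.H_U cp.H'_U by auto
  have WH: "space_W P \<subseteq> H1 (body P)" using W_H1 by blast
  note nf = dual_norm[OF hyps(14) WH order_refl]
    and ng = dual_norm[OF hyps(15) space_U_H1 order_refl]
    and ng0 = dual_norm[OF hyps(15) space_U_H1 sub(1)]
    and ng1 = dual_norm[OF hyps(15) space_U_H1 sub(2)]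
  have solves: "solves_coupled P D \<kappa> f g w u \<longleftrightarrow> cp.solves \<kappa> f g w u" for w u
    by (simp add: solves_coupled_def cp.solves_def)
  obtain w u where s: "cp.solves \<kappa> f g w u"
    using cp.solution_exists[OF \<kappa> f_lin _ g_lin, of ?nf ?ng] nf(1) ng(1) by (auto simp: w_nrm)
  note wu = cp.solvesD(1,2)[OF s]
  have unique: "field_eq P w' w \<and> field_eq P u' u" if "cp.solves \<kappa> f g w' u'" for w' u'
    using cp.solution_unique[OF that s \<kappa>] cp.solvesD(1,2)[OF that] wu U_H1 W_H1
    by (simp add: field_eq_iff w_nrm)
  \<comment> \<open>An a.e. decomposition becomes one up to norm zero, which is what
    \<open>stability\<close> accepts.\<close>
  have field_eq_plus: "U.nrm (u - (u0 + u1)) = 0"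
    if "u0 \<in> null_H P" "u1 \<in> perp_H P" "field_eq P u (\<lambda>x. u0 x + u1 x)" for u0 u1
    using field_eq_iff[of u "u0 + u1"] that wu(2) sub U_H1 U.closed_ops(2)[of u0 u1]
    by (auto simp: w_nrm plus_fun_def)
  note bounds = cp.stability[OF s \<kappa> f_lin _ g_lin _ _ _ _ _ _ Q_def, of ?nf ?ng ?ngH ?ngP, unfolded w_nrm,
      OF nf(1) ng(1) ng0(1) ng1(1) nf(2)[OF ne(1)] ng0(2)[OF ne(3)] ng1(2)[OF ne(4)]]
  obtain u0 u1 where u01: "u0 \<in> null_H P" "u1 \<in> perp_H P" "u = u0 + u1"
    using cp.decomposition[OF wu(2)] by blast
  have u01_eq: "field_eq P u (\<lambda>x. u0 x + u1 x)" by (simp add: u01(3) field_eq_def)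
  let ?cf = "inverse \<alpha> + inverse \<beta> * (d / \<delta>) * (1 + a / \<alpha>) + inverse \<beta> * (1 + a / \<alpha>)"
    and ?cH = "Q + (inverse \<delta> + d / \<delta> * (a / \<beta>) * Q) + a / \<beta> * Q"
    and ?cP = "\<kappa> * inverse \<beta> * (a / \<alpha>) + \<kappa> * inverse \<beta> * (a / \<alpha>) * (d / \<delta>) * (a / \<beta>)
      + \<kappa> * inverse \<beta> * (a / \<alpha>) * (a / \<beta>)"
  have C: "stability_constant \<kappa> \<alpha> \<beta> \<delta> a d = ?cf + ?cH + ?cP"
    by (simp add: stability_constant_def Let_def Q_def)
  have pos: "0 \<le> Q" "0 \<le> ?cf" "0 \<le> ?cP" "0 \<le> ?nf" "0 \<le> ?ng"
    using cp.pos \<kappa> nf(2)[OF ne(1)] ng(2)[OF ne(2)] by (simp_all add: Q_def)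
  then have c0: "0 \<le> ?cH" using cp.pos by simp
  have "norm_w P u + norm_w P w \<le> ?cf * ?nf + ?cH * ?ngH + ?cP * ?ngP"
    using bounds[OF u01(1,2) field_eq_plus[OF u01(1,2) u01_eq, unfolded w_nrm]]
    by (simp add: algebra_simps)
  also have "\<dots> \<le> ?cf * ?nf + ?cH * ?ng + ?cP * ?ng"
    by (rule add_mono[OF add_mono[OF order_refl mult_left_mono[OF ng0(3)[OF ne(3)] c0]]
          mult_left_mono[OF ng1(3)[OF ne(4)] pos(3)]])
  also have "\<dots> \<le> (?cf + ?cH + ?cP) * (?nf + ?ng)"
  proof -
    have "x * p + y * q + z * q \<le> (x + y + z) * (p + q)"
      if "0 \<le> x" "0 \<le> y" "0 \<le> z" "0 \<le> p" "0 \<le> q" for x y z p q :: real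
      using that by (simp add: algebra_simps)
    from this[OF pos(2) c0 pos(3-5)] show ?thesis .
  qed
  finally have total: "norm_w P u + norm_w P w \<le> stability_constant \<kappa> \<alpha> \<beta> \<delta> a d * (?nf + ?ng)"
    unfolding C .
  show ?case
    unfolding Let_def Q_def[symmetric] solves
  proof (rule exI[of _ w], rule exI[of _ u], intro conjI allI impI ballI)
    show "cp.solves \<kappa> f g w u" by (rule s)
    show "field_eq P w' w" "field_eq P u' u" if "cp.solves \<kappa> f g w' u'" for w' u'
      using unique[OF that] by simp_all
    show "norm_w P u + norm_w P w \<le> stability_constant \<kappa> \<alpha> \<beta> \<delta> a d * (?nf + ?ng)" by (rule total)
    show "\<exists>u\<^sub>0\<in>null_H P. \<exists>u\<^sub>1\<in>perp_H P. field_eq P u (\<lambda>x. u\<^sub>0 x + u\<^sub>1 x)"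
      using u01(1,2) u01_eq by blast
    fix v0 v1 assume v: "v0 \<in> null_H P" "v1 \<in> perp_H P" "field_eq P u (\<lambda>x. v0 x + v1 x)"
    note b = bounds[OF v(1,2) field_eq_plus[OF v, unfolded w_nrm]]
    show "norm_w P w \<le> inverse \<alpha> * ?nf + Q * ?ngH + \<kappa> * inverse \<beta> * (a / \<alpha>) * ?ngP"
      by (rule b(1))
    show "norm_w P v0 \<le> inverse \<beta> * (d / \<delta>) * (1 + a / \<alpha>) * ?nf
        + (inverse \<delta> + d / \<delta> * (a / \<beta>) * Q) * ?ngH
        + \<kappa> * inverse \<beta> * (a / \<alpha>) * (d / \<delta>) * (a / \<beta>) * ?ngP"
      by (rule b(2))
    show "norm_w P v1 \<le> inverse \<beta> * (1 + a / \<alpha>) * ?nf + a / \<beta> * Q * ?ngH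
        + \<kappa> * inverse \<beta> * (a / \<alpha>) * (a / \<beta>) * ?ngP"
      by (rule b(3))
  qed
qed

end
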